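(* Suppose $X$ is a locally path connected, connected Polish space. Each of the following groups is of cardinality $2^{\aleph_0}$ or $\leq \aleph_0$, and in case $X$ is compact each of them is of cardinality $2^{\aleph_0}$ or is finitely generated: (1) $\pi_1(X)$; (2) $\pi_1(X)/(\pi_1(X))^{(\alpha)}$ for any ordinal $\alpha<\omega_1$; (3) $\pi_1(X)/(\pi_1(X))_n$ for any $n\in \omega$; (4) $\pi_1(X)/N$, where $N$ is the normal subgroup generated by the squares of elements, the cubes of elements, or the $n$-th powers of elements of $\pi_1(X)$. Moreover, in case $X$ is compact, $\pi_1(X)$ is countable if and only if $\pi_1(X)$ is finitely presented.
   Context: A topological space is Polish if it is completely metrizable and separable. A space $Z$ is locally path connected if for every $z\in Z$ and every neighborhood $U$ of $z$ there is a path connected neighborhood $V\subseteq U$ of $z$. For a group $G$, the derived series is defined by $G^{(0)}=G$, $G^{(\alpha+1)}=[G^{(\alpha)},G^{(\alpha)}]$, and $G^{(\beta)}=\bigcap_{\alpha<\beta}G^{(\alpha)}$ for limit ordinals $\beta$. The lower central series is defined by $G_0=G$ and $G_{n+1}=[G,G_n]$. *)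

theory Defs
  imports
    "HOL-Analysis.Analysis"
    "HOL-Library.Equipollence"
    "HOL-Algebra.Coset"
    "HOL-Algebra.Generated_Groups"
begin

definition polish_topology :: "'a topology \<Rightarrow> bool" where
  "polish_topology T \<longleftrightarrow> completely_metrizable_space T \<and> separable_space T"

definition based_loops :: "'a::topological_space set \<Rightarrow> 'a \<Rightarrow> (real \<Rightarrow> 'a) set" where
  "based_loops X x0 =
     {p. path p \<and> path_image p \<subseteq> X \<and> pathstart p = x0 \<and> pathfinish p = x0}"

definition path_homotopy :: "'a::topological_space set \<Rightarrow> ((real \<Rightarrow> 'a) \<times> (real \<Rightarrow> 'a)) set" where
  "path_homotopy X = {(p, q). homotopic_paths X p q}"

text \<open>Homotopy classes are multiplied like cosets: the class of all concatenations of
  representatives.\<close>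

definition fundamental_group ::
    "'a::topological_space set \<Rightarrow> 'a \<Rightarrow> (real \<Rightarrow> 'a) set monoid" where
  "fundamental_group X x0 =
     \<lparr>carrier = based_loops X x0 // path_homotopy X,
      mult = (\<lambda>A B. path_homotopy X `` {p +++ q |p q. p \<in> A \<and> q \<in> B}),
      one = path_homotopy X `` {\<lambda>_. x0}\<rparr>"

definition normal_closure :: "('a, 'b) monoid_scheme \<Rightarrow> 'a set \<Rightarrow> 'a set" where
  "normal_closure G S = \<Inter> {N. N \<lhd> G \<and> S \<subseteq> N}"

definition power_subgroup :: "('a, 'b) monoid_scheme \<Rightarrow> nat \<Rightarrow> 'a set" where
  "power_subgroup G n = normal_closure G {x [^]\<^bsub>G\<^esub> n |x. x \<in> carrier G}"

definition commutator_subgroup :: "('a, 'b) monoid_scheme \<Rightarrow> 'a set \<Rightarrow> 'a set \<Rightarrow> 'a set" where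
  "commutator_subgroup G H K =
     generate G {h \<otimes>\<^bsub>G\<^esub> k \<otimes>\<^bsub>G\<^esub> inv\<^bsub>G\<^esub> h \<otimes>\<^bsub>G\<^esub> inv\<^bsub>G\<^esub> k |h k. h \<in> H \<and> k \<in> K}"

primrec lower_central :: "('a, 'b) monoid_scheme \<Rightarrow> nat \<Rightarrow> 'a set" where
  "lower_central G 0 = carrier G"
| "lower_central G (Suc n) = commutator_subgroup G (carrier G) (lower_central G n)"

text \<open>An ordinal \<open>\<alpha>\<close> is represented by a (reflexive) well-order \<open>r\<close> of type \<open>\<alpha>\<close>. An element
  \<open>a\<close> of its field then stands for the ordinal \<open>\<beta> < \<alpha>\<close> that is the order type of
  \<open>underS r a\<close>. In \<open>derived_step G r f J\<close>, the set \<open>J\<close> is an initial segment of \<open>r\<close> and \<open>f\<close>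
  gives the terms of the series at the elements of \<open>J\<close>; the value is the term at the order
  type of \<open>J\<close>, which is zero if \<open>J\<close> is empty, a successor if \<open>J\<close> has a greatest element
  (which then stands for the predecessor), and a limit otherwise. The countable ordinals are
  exactly the order types of the well-orders \<open>r :: nat rel\<close>, whose field may be any set of
  naturals.\<close>

definition derived_step ::
    "('a, 'b) monoid_scheme \<Rightarrow> 'i rel \<Rightarrow> ('i \<Rightarrow> 'a set) \<Rightarrow> 'i set \<Rightarrow> 'a set" where
  "derived_step G r f J =
     (if J = {} then carrier G
      else if \<exists>m\<in>J. \<forall>j\<in>J. (j, m) \<in> r
        then derived G (f (THE m. m \<in> J \<and> (\<forall>j\<in>J. (j, m) \<in> r)))
      else \<Inter> (f ` J))"

definition derived_term :: "('a, 'b) monoid_scheme \<Rightarrow> 'i rel \<Rightarrow> 'i \<Rightarrow> 'a set" where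
  "derived_term G r = wfrec (r - Id) (\<lambda>f a. derived_step G r f (underS r a))"

definition derived_series :: "('a, 'b) monoid_scheme \<Rightarrow> 'i rel \<Rightarrow> 'a set" where
  "derived_series G r = derived_step G r (derived_term G r) (Field r)"

lemma derived_term_unfold:
  assumes "Well_order r"
  shows "derived_term G r a = derived_step G r (derived_term G r) (underS r a)"
proof -
  let ?F = "\<lambda>f a. derived_step G r f (underS r a)"
  have wf: "wf (r - Id)"
    using assms by (simp add: well_order_on_def)
  have anti: "antisym r"
    using assms by (simp add: well_order_on_def linear_order_on_def partial_order_on_def)
  have "derived_step G r (cut (derived_term G r) (r - Id) a) (underS r a)
      = derived_step G r (derived_term G r) (underS r a)"
  proof -
    have cut: "cut (derived_term G r) (r - Id) a b = derived_term G r b" if "b \<in> underS r a" for b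
      using that by (auto simp: underS_def cut_apply)
    have the: "(THE m. m \<in> underS r a \<and> (\<forall>j\<in>underS r a. (j, m) \<in> r)) \<in> underS r a"
      if "\<exists>m\<in>underS r a. \<forall>j\<in>underS r a. (j, m) \<in> r"
    proof -
      have "\<exists>!m. m \<in> underS r a \<and> (\<forall>j\<in>underS r a. (j, m) \<in> r)"
        using that by (blast intro: antisymD[OF anti])
      from theI'[OF this] show ?thesis
        by (rule conjunct1)
    qed
    show ?thesis
    proof (cases "\<exists>m\<in>underS r a. \<forall>j\<in>underS r a. (j, m) \<in> r")
      case True
      then show ?thesis
        unfolding derived_step_def by (simp only: cut[OF the[OF True]] if_True)
    next
      case False
      have "cut (derived_term G r) (r - Id) a ` underS r a = derived_term G r ` underS r a"
        by (rule image_cong[OF refl cut])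
      with False show ?thesis
        unfolding derived_step_def by (simp only: if_False)
    qed
  qed
  then show ?thesis
    using wfrec[OF wf, of ?F a] unfolding derived_term_def[symmetric] by (rule trans[rotated])
qed

definition finitely_generated :: "('a, 'b) monoid_scheme \<Rightarrow> bool" where
  "finitely_generated G \<longleftrightarrow>
     (\<exists>S. finite S \<and> S \<subseteq> carrier G \<and> generate G S = carrier G)"

text \<open>Words over \<open>S\<close>: the letter \<open>(s, True)\<close> stands for \<open>s\<close> and \<open>(s, False)\<close> for its formal
  inverse.\<close>

definition words :: "'s set \<Rightarrow> ('s \<times> bool) list set" where
  "words S = lists (S \<times> UNIV)"

definition word_cancel :: "'s set \<Rightarrow> ('s \<times> bool) list rel" where
  "word_cancel S =
     {(u @ [(s, b), (s, \<not> b)] @ v, u @ v) |u v s b. u \<in> words S \<and> v \<in> words S \<and> s \<in> S}"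

definition word_equiv :: "'s set \<Rightarrow> ('s \<times> bool) list rel" where
  "word_equiv S = (word_cancel S \<union> (word_cancel S)\<inverse>)\<^sup>*"

definition free_group :: "'s set \<Rightarrow> ('s \<times> bool) list set monoid" where
  "free_group S =
     \<lparr>carrier = words S // word_equiv S,
      mult = (\<lambda>A B. word_equiv S `` {u @ v |u v. u \<in> A \<and> v \<in> B}),
      one = word_equiv S `` {[]}\<rparr>"

definition finitely_presented :: "('a, 'b) monoid_scheme \<Rightarrow> bool" where
  "finitely_presented G \<longleftrightarrow>
     (\<exists>(n::nat) R. finite R \<and> R \<subseteq> carrier (free_group {..<n}) \<and>
        G \<cong> free_group {..<n} Mod normal_closure (free_group {..<n}) R)"

definition continuum_sized :: "'a set \<Rightarrow> bool" where
  "continuum_sized A \<longleftrightarrow> A \<approx> (UNIV :: nat set set)"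

definition continuum_or_countable :: "('a, 'b) monoid_scheme \<Rightarrow> bool" where
  "continuum_or_countable G \<longleftrightarrow> continuum_sized (carrier G) \<or> countable (carrier G)"

definition continuum_or_fin_gen :: "('a, 'b) monoid_scheme \<Rightarrow> bool" where
  "continuum_or_fin_gen G \<longleftrightarrow> continuum_sized (carrier G) \<or> finitely_generated G"

end

theory Submission
  imports Defs
begin

text \<open>
  Let \<open>N\<close> be a normal subgroup of \<open>\<pi>\<^sub>1(X)\<close> whose loops form an analytic set; this class contains the
  trivial subgroup and is closed under products, countable unions and countable intersections,
  hence contains all subgroups in question. If every point has a neighbourhood whose loops lie in
  \<open>N\<close>, then uniformly close loops agree modulo \<open>N\<close>, so separability of the loop space makes the
  quotient countable, and on a compact space a finite net gives finitely many generators (and, for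
  \<open>N = 1\<close>, finitely many relators). Otherwise there are loops \<open>p\<^sub>n \<notin> N\<close> at some point \<open>x\<close> that
  shrink to \<open>x\<close>. Concatenating \<open>p\<^sub>n\<close> for the \<open>n\<close> selected by \<open>\<alpha>\<close> is continuous in \<open>\<alpha>\<close>, and
  changing one selection changes the class modulo \<open>N\<close>. An analytic equivalence relation has the
  Baire property, so this flip condition forces it to be meager, and Mycielski's theorem gives
  continuum many inequivalent selections.
\<close>

section \<open>Paths\<close>

text \<open>Homotopy is an existential condition over maps of the unit square, so lying in one coset
  of \<open>N\<close> is in general only a projection of a closed relation; hence the Baire property
  is needed for analytic relations. Since the ambient type carries nothing but a topology, no space
  of loops is formed: the Baire space codes all maps of the square into \<open>X\<close>, and sets
  of classes are parametrised by closed sets of codes. The flip condition rules out a nonmeager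
  relation because such a relation fills some box up to a meager set, and flipping the first
  coordinate that the box leaves free maps the box to itself. The shrinking loops need not sit at
  \<open>x0\<close>, and the other case cuts paths into pieces that are not loops; both are handled
  by extending the class map to a multiplicative invariant of all paths. Finitely many relators are
  enough because the word read off along a fine grid changes, under a homotopy, only across
  triangles of close net points.\<close>

definition path_in :: "'a::topological_space set \<Rightarrow> (real \<Rightarrow> 'a) \<Rightarrow> bool" where
  "path_in X p \<longleftrightarrow> path p \<and> path_image p \<subseteq> X"

text \<open>No order is imposed on \<open>a\<close> and \<open>b\<close>: for \<open>b < a\<close>
  the segment runs backwards and for \<open>a = b\<close> it is constant, so segments compose
  without case distinctions.\<close>

definition segment_path :: "real \<Rightarrow> real \<Rightarrow> (real \<Rightarrow> 'a) \<Rightarrow> real \<Rightarrow> 'a" where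
  "segment_path a b p = p \<circ> linepath a b"

lemma path_in_alt: "path_in X p \<longleftrightarrow> continuous_on {0..1} p \<and> (\<forall>t\<in>{0..1}. p t \<in> X)"
  by (auto simp: path_in_def path_def path_image_def)

lemma path_in_const [simp]: "path_in X (\<lambda>_. x) \<longleftrightarrow> x \<in> X"
  by (auto simp: path_in_alt intro: bexI[of _ 0])

lemma path_in_join [simp]:
  "pathfinish p = pathstart q \<Longrightarrow> path_in X (p +++ q) \<longleftrightarrow> path_in X p \<and> path_in X q"
  by (auto simp: path_in_def path_image_join)

lemma path_in_reversepath [simp]: "path_in X (reversepath p) \<longleftrightarrow> path_in X p"
  by (simp add: path_in_def)

lemma path_in_pathstart [simp, intro]: "path_in X p \<Longrightarrow> pathstart p \<in> X"
  by (auto simp: path_in_alt pathstart_def)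

lemma path_in_pathfinish [simp, intro]: "path_in X p \<Longrightarrow> pathfinish p \<in> X"
  by (auto simp: path_in_alt pathfinish_def)

lemma path_in_mono: "path_in X p \<Longrightarrow> X \<subseteq> Y \<Longrightarrow> path_in Y p"
  by (auto simp: path_in_def)

lemma pathstart_const [simp]: "pathstart (\<lambda>_. x) = x"
  and pathfinish_const [simp]: "pathfinish (\<lambda>_. x) = x"
  by (simp_all add: pathstart_def pathfinish_def)

text \<open>Paths in the unit interval with common ends are homotopic by convexity, and
  \<open>p\<close> carries the homotopy to \<open>X\<close>. The unit, inverse and segment laws
  below are the instances in which \<open>f\<close> is a join of linear paths.\<close>

lemma homotopic_paths_comp_interval:
  assumes p: "path_in X p" and f: "path_in {0..1::real} f" and g: "path_in {0..1} g"
    and "pathstart f = pathstart g" "pathfinish f = pathfinish g"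
  shows "homotopic_paths X (p \<circ> f) (p \<circ> g)"
proof (rule homotopic_paths_continuous_image[where S = "{0..1}"])
  show "homotopic_paths {0..1} f g"
    using assms by (intro homotopic_paths_linear)
      (auto simp: path_in_alt path_def closed_segment_subset)
qed (use p in \<open>auto simp: path_in_alt\<close>)

lemma linepath_in_unit: "a \<in> {0..1} \<Longrightarrow> b \<in> {0..1} \<Longrightarrow> path_in {0..1::real} (linepath a b)"
  unfolding path_in_def by (metis convex_real_interval(5) path_image_linepath path_linepath closed_segment_subset)

lemma linepath_same: "linepath a a = (\<lambda>_. a)"
  by (auto simp: linepath_def algebra_simps simp flip: scaleR_add_left)

lemma comp_linepath_01: "p \<circ> linepath 0 (1::real) = p"
  by (auto simp: linepath_def)

lemma comp_linepath_10: "p \<circ> linepath 1 (0::real) = reversepath p"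
  by (auto simp: linepath_def reversepath_def)

lemma comp_linepath_const: "p \<circ> linepath a a = (\<lambda>_. p a)"
  by (auto simp: linepath_same)

lemma homotopic_paths_refl_in: "homotopic_paths X p p \<longleftrightarrow> path_in X p"
  by (simp add: path_in_def)

lemma homotopic_paths_assoc_in:
  "path_in X p \<Longrightarrow> path_in X q \<Longrightarrow> path_in X r \<Longrightarrow> pathfinish p = pathstart q \<Longrightarrow> pathfinish q = pathstart r \<Longrightarrow>
    homotopic_paths X (p +++ (q +++ r)) ((p +++ q) +++ r)"
  unfolding path_in_def by (intro homotopic_paths_assoc) auto

lemma homotopic_paths_const_right:
  assumes "path_in X p" "x = pathfinish p"
  shows "homotopic_paths X (p +++ (\<lambda>_. x)) p"
  using homotopic_paths_comp_interval[OF assms(1), of "linepath 0 1 +++ linepath 1 1" "linepath 0 1"]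
  by (simp add: linepath_in_unit path_compose_join comp_linepath_01 comp_linepath_const assms(2) pathfinish_def[of p])

lemma homotopic_paths_const_left:
  assumes "path_in X p" "x = pathstart p"
  shows "homotopic_paths X ((\<lambda>_. x) +++ p) p"
  using homotopic_paths_comp_interval[OF assms(1), of "linepath 0 0 +++ linepath 0 1" "linepath 0 1"]
  by (simp add: linepath_in_unit path_compose_join comp_linepath_01 comp_linepath_const assms(2) pathstart_def[of p])

lemma homotopic_paths_reversepath_right:
  assumes "path_in X p"
  shows "homotopic_paths X (p +++ reversepath p) (\<lambda>_. pathstart p)"
  using homotopic_paths_comp_interval[OF assms(1), of "linepath 0 1 +++ linepath 1 0" "linepath 0 0"]
  by (simp add: linepath_in_unit path_compose_join comp_linepath_01 comp_linepath_10 comp_linepath_const pathstart_def[of p])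

lemma homotopic_paths_reversepath_left:
  assumes "path_in X p"
  shows "homotopic_paths X (reversepath p +++ p) (\<lambda>_. pathfinish p)"
  using homotopic_paths_reversepath_right[of X "reversepath p"] assms by simp

lemma pathstart_segment_path [simp]: "pathstart (segment_path a b p) = p a"
  and pathfinish_segment_path [simp]: "pathfinish (segment_path a b p) = p b"
  by (simp_all add: segment_path_def pathstart_def pathfinish_def linepath_def)

lemma path_in_comp_unit: "path_in X p \<Longrightarrow> path_in {0..1} f \<Longrightarrow> path_in X (p \<circ> f)"
  unfolding path_in_alt by (auto intro!: continuous_on_compose2[of "{0..1}" p])

lemma path_in_segment_path:
  "path_in X p \<Longrightarrow> a \<in> {0..1} \<Longrightarrow> b \<in> {0..1} \<Longrightarrow> path_in X (segment_path a b p)"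
  unfolding segment_path_def by (intro path_in_comp_unit linepath_in_unit)

lemma path_in_segment_pathI:
  assumes "path_in X p" "0 \<le> a" "a \<le> b" "b \<le> 1" "\<And>t. a \<le> t \<Longrightarrow> t \<le> b \<Longrightarrow> p t \<in> Y"
  shows "path_in Y (segment_path a b p)"
proof -
  have "linepath a b t \<in> {a..b}" if "t \<in> {0..1}" for t
    using that assms path_image_linepath[of a b]
    by (metis closed_segment_eq_real_ivl imageI path_image_def)
  with assms path_in_segment_path[of X p a b] show ?thesis
    by (auto simp: path_in_alt segment_path_def)
qed

lemma homotopic_paths_segment_join:
  assumes "path_in X p" "a \<in> {0..1}" "b \<in> {0..1}" "c \<in> {0..1}"
  shows "homotopic_paths X (segment_path a b p +++ segment_path b c p) (segment_path a c p)"
  using homotopic_paths_comp_interval[OF assms(1), of "linepath a b +++ linepath b c" "linepath a c"] assms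
  by (simp add: linepath_in_unit path_compose_join segment_path_def)

lemma segment_path_01 [simp]: "segment_path 0 1 p = p"
  by (simp add: segment_path_def comp_linepath_01)

section \<open>Path characters\<close>

text \<open>The group need not be commutative, so the factors are kept in the order of their
  indices.\<close>

primrec gprod :: "('a, 'b) monoid_scheme \<Rightarrow> (nat \<Rightarrow> 'a) \<Rightarrow> nat \<Rightarrow> 'a" where
  "gprod H f 0 = \<one>\<^bsub>H\<^esub>"
| "gprod H f (Suc n) = gprod H f n \<otimes>\<^bsub>H\<^esub> f n"

context group begin

lemma gprod_closed [simp, intro]: "(\<And>i. i < n \<Longrightarrow> f i \<in> carrier G) \<Longrightarrow> gprod G f n \<in> carrier G"
  by (induction n) auto

lemma gprod_cong: "(\<And>i. i < n \<Longrightarrow> f i = g i) \<Longrightarrow> gprod G f n = gprod G g n"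
  by (induction n) auto

lemma gprod_add:
  "(\<And>i. i < m + n \<Longrightarrow> f i \<in> carrier G) \<Longrightarrow>
    gprod G f (m + n) = gprod G f m \<otimes> gprod G (\<lambda>i. f (m + i)) n"
  by (induction n) (auto simp: m_assoc)

text \<open>Regrouping into blocks is what compares a product over a grid with the product over a
  refinement of it.\<close>

lemma gprod_mult:
  "(\<And>i. i < m * n \<Longrightarrow> f i \<in> carrier G) \<Longrightarrow>
    gprod G f (m * n) = gprod G (\<lambda>i. gprod G (\<lambda>j. f (i * n + j)) n) m"
proof (induction m)
  case (Suc m)
  then show ?case
    using gprod_add[of "m * n" n f] by (simp add: add.commute)
qed simp

text \<open>The discrete analogue of a homotopy: \<open>s i\<close> are the rungs of a ladder with sides \<open>a\<close> and
  \<open>b\<close> all of whose squares commute.\<close>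

lemma gprod_ladder:
  assumes "\<And>i. i < n \<Longrightarrow> a i \<in> carrier G" "\<And>i. i < n \<Longrightarrow> b i \<in> carrier G"
    "\<And>i. i \<le> n \<Longrightarrow> s i \<in> carrier G"
    "\<And>i. i < n \<Longrightarrow> a i \<otimes> s (Suc i) = s i \<otimes> b i"
  shows "gprod G a n \<otimes> s n = s 0 \<otimes> gprod G b n"
  using assms
proof (induction n)
  case (Suc n)
  have cl: "gprod G a n \<in> carrier G" "gprod G b n \<in> carrier G"
    using Suc.prems by auto
  have "gprod G a (Suc n) \<otimes> s (Suc n) = gprod G a n \<otimes> (a n \<otimes> s (Suc n))"
    using Suc.prems cl by (simp add: m_assoc)
  also have "\<dots> = (gprod G a n \<otimes> s n) \<otimes> b n"
    using Suc.prems cl by (simp add: m_assoc)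
  also have "\<dots> = s 0 \<otimes> gprod G b (Suc n)"
    using Suc cl by (simp add: m_assoc)
  finally show ?case .
qed auto

text \<open>The rule \<open>f i j \<otimes> f j k = f i k\<close> also forces \<open>f i i\<close>
  to be idempotent and hence trivial, which is the empty case. The instances are the segments of a
  path and the labels inside one cell of a grid.\<close>

lemma gprod_telescope:
  assumes "\<And>i j. i \<le> n \<Longrightarrow> j \<le> n \<Longrightarrow> f i j \<in> carrier G"
    "\<And>i j k. i \<le> n \<Longrightarrow> j \<le> n \<Longrightarrow> k \<le> n \<Longrightarrow> f i j \<otimes> f j k = f i k"
  shows "gprod G (\<lambda>i. f i (Suc i)) n = f 0 n"
proof -
  have "m \<le> n \<Longrightarrow> gprod G (\<lambda>i. f i (Suc i)) m = f 0 m" for m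
  proof (induction m)
    case 0
    have "f 0 0 \<otimes> f 0 0 = f 0 0" using assms by auto
    then show ?case using assms(1)[of 0 0] by (simp add: l_cancel_one)
  next
    case (Suc m)
    then show ?case using assms(2)[of 0 m "Suc m"] by simp
  qed
  then show ?thesis by simp
qed

end

text \<open>In other words, a functor from the fundamental groupoid of \<open>X\<close> to a group.
  It is kept abstract because the same arguments are applied to classes in the fundamental group, to
  their cosets, and to invariants computed from a finite net.\<close>

locale path_character = group H for H (structure) +
  fixes X :: "'a::topological_space set" and \<kappa> :: "(real \<Rightarrow> 'a) \<Rightarrow> 'h"
  assumes closed [simp]: "path_in X p \<Longrightarrow> \<kappa> p \<in> carrier H"
    and join: "path_in X p \<Longrightarrow> path_in X q \<Longrightarrow> pathfinish p = pathstart q \<Longrightarrow> \<kappa> (p +++ q) = \<kappa> p \<otimes> \<kappa> q"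
    and homotopic: "homotopic_paths X p q \<Longrightarrow> \<kappa> p = \<kappa> q"
begin

lemma const [simp]: "x \<in> X \<Longrightarrow> \<kappa> (\<lambda>_. x) = \<one>"
proof -
  assume x: "x \<in> X"
  have "\<kappa> (\<lambda>_. x) \<otimes> \<kappa> (\<lambda>_. x) = \<kappa> (\<lambda>_. x)"
    using homotopic[OF homotopic_paths_const_right[of X "\<lambda>_. x" x]] x
    by (simp add: join)
  then show ?thesis using x by (simp add: l_cancel_one)
qed

lemma reversepath [simp]: "path_in X p \<Longrightarrow> \<kappa> (reversepath p) = inv (\<kappa> p)"
proof -
  assume p: "path_in X p"
  have "\<kappa> (reversepath p) \<otimes> \<kappa> p = \<one>"
    using homotopic[OF homotopic_paths_reversepath_left[OF p]] p
    by (simp add: join path_in_pathfinish)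
  then show ?thesis using p by (metis closed inv_equality path_in_reversepath)
qed

lemma cong: "path_in X p \<Longrightarrow> (\<And>t. t \<in> {0..1} \<Longrightarrow> p t = q t) \<Longrightarrow> \<kappa> p = \<kappa> q"
  by (intro homotopic homotopic_paths_eq) (auto simp: path_in_def)

lemma segment_join:
  assumes "path_in X p" "a \<in> {0..1}" "b \<in> {0..1}" "c \<in> {0..1}"
  shows "\<kappa> (segment_path a b p) \<otimes> \<kappa> (segment_path b c p) = \<kappa> (segment_path a c p)"
  using assms homotopic[OF homotopic_paths_segment_join[OF assms]]
  by (simp add: join path_in_segment_path)

lemma grid:
  assumes "path_in X p" "n > 0"
  shows "\<kappa> p = gprod H (\<lambda>i. \<kappa> (segment_path (i / n) (Suc i / n) p)) n"
proof -
  have u: "real i / n \<in> {0..1}" if "i \<le> n" for i using that assms(2) by (auto simp: field_simps)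
  have "gprod H (\<lambda>i. (\<lambda>i j. \<kappa> (segment_path (i / n) (j / n) p)) i (Suc i)) n
      = \<kappa> (segment_path (real 0 / n) (n / n) p)"
    by (rule gprod_telescope) (intro closed segment_join path_in_segment_path u assms; assumption)+
  then show ?thesis using assms by simp
qed

lemma square:
  assumes "path_in X p" "path_in X q" "path_in X s" "path_in X s'"
    "pathfinish p = pathstart s'" "pathfinish s' = pathfinish q" "pathstart q = pathfinish s"
    "pathstart s = pathstart p"
    "\<kappa> ((p +++ s') +++ reversepath (s +++ q)) = \<one>"
  shows "\<kappa> p \<otimes> \<kappa> s' = \<kappa> s \<otimes> \<kappa> q"
proof -
  have "(\<kappa> p \<otimes> \<kappa> s') \<otimes> inv (\<kappa> s \<otimes> \<kappa> q) = \<one>"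
    using assms by (simp add: join)
  then show ?thesis using assms by (metis closed inv_equality inv_inv inv_closed m_closed)
qed

end

section \<open>The fundamental group\<close>

locale based_space =
  fixes X :: "'a::topological_space set" and x0 :: 'a
  assumes x0: "x0 \<in> X"
begin

definition cl :: "(real \<Rightarrow> 'a) \<Rightarrow> (real \<Rightarrow> 'a) set" where
  "cl p = {q. homotopic_paths X p q}"

abbreviation "\<G> \<equiv> fundamental_group X x0"

definition loop :: "(real \<Rightarrow> 'a) \<Rightarrow> bool" where
  "loop p \<longleftrightarrow> path_in X p \<and> pathstart p = x0 \<and> pathfinish p = x0"

lemma loop_const: "loop (\<lambda>_. x0)" using x0 by (simp add: loop_def)
lemma loop_join: "loop p \<Longrightarrow> loop q \<Longrightarrow> loop (p +++ q)" by (simp add: loop_def)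
lemma loop_reversepath: "loop p \<Longrightarrow> loop (reversepath p)" by (simp add: loop_def)

lemma cl_eq_iff: "path_in X p \<Longrightarrow> cl p = cl q \<longleftrightarrow> homotopic_paths X p q"
  unfolding cl_def path_in_def
  by (metis (mono_tags, lifting) Collect_cong homotopic_paths_refl homotopic_paths_sym
      homotopic_paths_trans mem_Collect_eq)

lemma path_homotopy_Image: "path_homotopy X `` {p} = cl p"
  by (auto simp: path_homotopy_def cl_def)

lemma carrier_Pi: "carrier \<G> = cl ` {p. loop p}"
  by (auto simp: fundamental_group_def quotient_def path_homotopy_Image based_loops_def loop_def
      path_in_def)

lemma one_Pi: "\<one>\<^bsub>\<G>\<^esub> = cl (\<lambda>_. x0)"
  by (simp add: fundamental_group_def path_homotopy_Image)

lemma mult_Pi: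
  assumes "loop p" "loop q"
  shows "cl p \<otimes>\<^bsub>\<G>\<^esub> cl q = cl (p +++ q)"
proof -
  have "cl p \<otimes>\<^bsub>\<G>\<^esub> cl q = path_homotopy X `` {p' +++ q' |p' q'. p' \<in> cl p \<and> q' \<in> cl q}"
    by (simp add: fundamental_group_def)
  also have "\<dots> = cl (p +++ q)"
  proof (rule Set.set_eqI, rule iffI)
    fix r assume "r \<in> path_homotopy X `` {p' +++ q' |p' q'. p' \<in> cl p \<and> q' \<in> cl q}"
    then obtain p' q' where "homotopic_paths X p p'" "homotopic_paths X q q'" "homotopic_paths X (p' +++ q') r"
      by (auto simp: path_homotopy_def cl_def)
    then show "r \<in> cl (p +++ q)"
      using assms homotopic_paths_join[of X p p' q q'] homotopic_paths_trans
      by (auto simp: cl_def loop_def)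
  next
    fix r assume "r \<in> cl (p +++ q)"
    moreover have "p \<in> cl p" "q \<in> cl q" using assms by (auto simp: cl_def loop_def path_in_def)
    ultimately show "r \<in> path_homotopy X `` {p' +++ q' |p' q'. p' \<in> cl p \<and> q' \<in> cl q}"
      unfolding path_homotopy_def cl_def by blast
  qed
  finally show ?thesis .
qed

lemma cl_eqI: "homotopic_paths X p q \<Longrightarrow> cl p = cl q"
  by (metis cl_eq_iff homotopic_paths_imp_path homotopic_paths_imp_subset path_in_def)

lemma group_Pi: "group \<G>"
proof (rule groupI)
  fix x y assume "x \<in> carrier \<G>" "y \<in> carrier \<G>"
  then show "x \<otimes>\<^bsub>\<G>\<^esub> y \<in> carrier \<G>"
    by (auto simp: carrier_Pi mult_Pi intro: loop_join)
next
  show "\<one>\<^bsub>\<G>\<^esub> \<in> carrier \<G>" by (auto simp: carrier_Pi one_Pi intro: loop_const)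
next
  fix x y z assume "x \<in> carrier \<G>" "y \<in> carrier \<G>" "z \<in> carrier \<G>"
  then obtain p q r where [simp]: "x = cl p" "y = cl q" "z = cl r" and l: "loop p" "loop q" "loop r"
    by (auto simp: carrier_Pi)
  show "x \<otimes>\<^bsub>\<G>\<^esub> y \<otimes>\<^bsub>\<G>\<^esub> z = x \<otimes>\<^bsub>\<G>\<^esub> (y \<otimes>\<^bsub>\<G>\<^esub> z)"
    using l homotopic_paths_assoc[of p X q r]
    by (simp add: mult_Pi loop_join) (auto intro!: cl_eqI homotopic_paths_sym simp: loop_def path_in_def)
next
  fix x assume "x \<in> carrier \<G>"
  then obtain p where [simp]: "x = cl p" and l: "loop p" by (auto simp: carrier_Pi)
  show "\<one>\<^bsub>\<G>\<^esub> \<otimes>\<^bsub>\<G>\<^esub> x = x"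
    using l by (auto simp: one_Pi mult_Pi loop_const intro!: cl_eqI homotopic_paths_const_left) (auto simp: loop_def)
  have "cl (reversepath p) \<otimes>\<^bsub>\<G>\<^esub> cl p = \<one>\<^bsub>\<G>\<^esub>"
    using l homotopic_paths_reversepath_left[of X p]
    by (auto simp: mult_Pi loop_reversepath one_Pi loop_def intro!: cl_eqI)
  then show "\<exists>y\<in>carrier \<G>. y \<otimes>\<^bsub>\<G>\<^esub> x = \<one>\<^bsub>\<G>\<^esub>"
    using l by (auto simp: carrier_Pi intro: loop_reversepath)
qed

sublocale Pi: group \<G> by (rule group_Pi)

lemma inv_Pi: "loop p \<Longrightarrow> inv\<^bsub>\<G>\<^esub> (cl p) = cl (reversepath p)"
proof (rule Pi.inv_equality)
  assume l: "loop p"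
  show "cl (reversepath p) \<otimes>\<^bsub>\<G>\<^esub> cl p = \<one>\<^bsub>\<G>\<^esub>"
    using l homotopic_paths_reversepath_left[of X p]
    by (auto simp: mult_Pi loop_reversepath one_Pi loop_def intro!: cl_eqI)
qed (auto simp: carrier_Pi intro: loop_reversepath)

end

section \<open>Extending homotopy classes from loops to all paths\<close>

locale connected_based_space = based_space +
  assumes path_connected: "path_connected X"
begin

text \<open>The tether of \<open>x0\<close> itself is forced to be constant, so that tying a loop at
  \<open>x0\<close> does not conjugate its class.\<close>

definition tether :: "'a \<Rightarrow> real \<Rightarrow> 'a" where
  "tether x = (if x = x0 then (\<lambda>_. x0)
     else (SOME p. path_in X p \<and> pathstart p = x0 \<and> pathfinish p = x))"

lemma tether:
  assumes "x \<in> X"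
  shows "path_in X (tether x)" "pathstart (tether x) = x0" "pathfinish (tether x) = x"
proof -
  have "\<exists>p. path_in X p \<and> pathstart p = x0 \<and> pathfinish p = x"
    using path_connected assms x0 by (auto simp: path_connected_def path_in_def)
  from someI_ex[OF this] show "path_in X (tether x)" "pathstart (tether x) = x0" "pathfinish (tether x) = x"
    using x0 by (auto simp: tether_def)
qed

definition tie :: "(real \<Rightarrow> 'a) \<Rightarrow> real \<Rightarrow> 'a" where
  "tie p = (tether (pathstart p) +++ p) +++ reversepath (tether (pathfinish p))"

text \<open>This retracts the fundamental groupoid onto its vertex group at \<open>x0\<close>. Loops
  based at any other point thereby obtain a class in the same group.\<close>

definition \<gamma> :: "(real \<Rightarrow> 'a) \<Rightarrow> (real \<Rightarrow> 'a) set" where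
  "\<gamma> p = cl (tie p)"

lemma loop_tie: "path_in X p \<Longrightarrow> loop (tie p)"
  by (simp add: tie_def loop_def tether path_in_pathstart path_in_pathfinish)

text \<open>When two tied paths are multiplied, the return along the tether of the common point
  cancels against the next departure along it.\<close>

lemma cancel_middle:
  assumes "path_in X a" "path_in X c" "path_in X b" "pathfinish a = pathstart b" "pathstart c = pathstart b"
  shows "homotopic_paths X ((a +++ b) +++ (reversepath b +++ c)) (a +++ c)"
proof -
  note simps = homotopic_paths_refl_in
  have 1: "homotopic_paths X ((a +++ b) +++ (reversepath b +++ c)) (a +++ (b +++ (reversepath b +++ c)))"
    using assms by (intro homotopic_paths_sym[OF homotopic_paths_assoc_in]) simp_all
  have 2: "homotopic_paths X (b +++ (reversepath b +++ c)) ((b +++ reversepath b) +++ c)"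
    using assms by (intro homotopic_paths_assoc_in) simp_all
  have 3: "homotopic_paths X ((b +++ reversepath b) +++ c) ((\<lambda>_. pathstart b) +++ c)"
    using assms by (intro homotopic_paths_join homotopic_paths_reversepath_right) (simp_all add: simps del: homotopic_paths_refl)
  have 4: "homotopic_paths X ((\<lambda>_. pathstart b) +++ c) c"
    using assms by (intro homotopic_paths_const_left) auto
  have 5: "homotopic_paths X (b +++ (reversepath b +++ c)) c"
    using 2 3 4 homotopic_paths_trans by blast
  have "homotopic_paths X (a +++ (b +++ (reversepath b +++ c))) (a +++ c)"
    using assms 5 by (intro homotopic_paths_join) (simp_all add: simps del: homotopic_paths_refl)
  with 1 show ?thesis using homotopic_paths_trans by blast
qed

sublocale gamma: path_character \<G> X \<gamma>
proof
  fix p assume "path_in X p"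
  then show "\<gamma> p \<in> carrier \<G>" by (auto simp: \<gamma>_def carrier_Pi loop_tie)
next
  fix p q assume p: "path_in X p" and q: "path_in X q" and e: "pathfinish p = pathstart q"
  define a where "a = tether (pathstart p)"
  define b where "b = tether (pathstart q)"
  define c where "c = tether (pathfinish q)"
  have t: "path_in X a" "pathstart a = x0" "pathfinish a = pathstart p"
    "path_in X b" "pathstart b = x0" "pathfinish b = pathstart q"
    "path_in X c" "pathstart c = x0" "pathfinish c = pathfinish q"
    using p q by (simp_all add: a_def b_def c_def tether path_in_pathstart path_in_pathfinish)
  have 1: "homotopic_paths X (((a +++ p) +++ reversepath b) +++ ((b +++ q) +++ reversepath c))
      (((a +++ p) +++ reversepath b) +++ (b +++ (q +++ reversepath c)))"
    using p q e t
    by (intro homotopic_paths_join homotopic_paths_sym[OF homotopic_paths_assoc_in])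
       (simp_all add: homotopic_paths_refl_in del: homotopic_paths_refl)
  have 2: "homotopic_paths X (((a +++ p) +++ reversepath b) +++ (b +++ (q +++ reversepath c)))
      ((a +++ p) +++ (q +++ reversepath c))"
    using cancel_middle[of "a +++ p" "q +++ reversepath c" "reversepath b"] p q e t by simp
  have 3: "homotopic_paths X ((a +++ p) +++ (q +++ reversepath c)) (((a +++ p) +++ q) +++ reversepath c)"
    using p q e t by (intro homotopic_paths_assoc_in) simp_all
  have 4: "homotopic_paths X (((a +++ p) +++ q) +++ reversepath c) ((a +++ (p +++ q)) +++ reversepath c)"
    using p q e t
    by (intro homotopic_paths_join homotopic_paths_sym[OF homotopic_paths_assoc_in])
       (simp_all add: homotopic_paths_refl_in del: homotopic_paths_refl)
  have "homotopic_paths X (((a +++ p) +++ reversepath b) +++ ((b +++ q) +++ reversepath c))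
      ((a +++ (p +++ q)) +++ reversepath c)"
    using 1 2 3 4 homotopic_paths_trans by blast
  from cl_eqI[OF this] show "\<gamma> (p +++ q) = \<gamma> p \<otimes>\<^bsub>\<G>\<^esub> \<gamma> q"
    using e p q by (simp add: \<gamma>_def mult_Pi loop_tie) (simp add: tie_def a_def b_def c_def)
next
  fix p q assume h: "homotopic_paths X p q"
  then have e: "pathstart p = pathstart q" "pathfinish p = pathfinish q"
    and i: "path_in X p" "path_in X q"
    by (auto dest: homotopic_paths_imp_pathstart homotopic_paths_imp_pathfinish
        homotopic_paths_imp_path homotopic_paths_imp_subset simp: path_in_def)
  show "\<gamma> p = \<gamma> q"
    unfolding \<gamma>_def tie_def e
    using e i tether(1)[OF path_in_pathstart[OF i(2)]] tether(3)[OF path_in_pathstart[OF i(2)]]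
      tether(1)[OF path_in_pathfinish[OF i(2)]] tether(3)[OF path_in_pathfinish[OF i(2)]]
    by (intro cl_eqI homotopic_paths_join h)
       (simp_all add: homotopic_paths_refl_in del: homotopic_paths_refl)
qed

lemma gamma_loop: "loop p \<Longrightarrow> \<gamma> p = cl p"
proof -
  assume l: "loop p"
  have "homotopic_paths X (((\<lambda>_. x0) +++ p) +++ (\<lambda>_. x0)) ((\<lambda>_. x0) +++ p)"
    using l x0 by (intro homotopic_paths_const_right) (auto simp: loop_def)
  moreover have "homotopic_paths X ((\<lambda>_. x0) +++ p) p"
    using l x0 by (intro homotopic_paths_const_left) (auto simp: loop_def)
  ultimately have "homotopic_paths X (((\<lambda>_. x0) +++ p) +++ (\<lambda>_. x0)) p"
    using homotopic_paths_trans by blast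
  moreover have "reversepath (\<lambda>_. x0) = (\<lambda>_. x0)" by (simp add: reversepath_def)
  ultimately show ?thesis using l
    by (auto simp: \<gamma>_def tie_def loop_def tether_def intro!: cl_eqI)
qed

text \<open>Tying a tether yields the tether followed by its own reverse. The tethers thus act like
  a spanning tree whose edges become trivial, which is what the presentation theorem asks of its
  paths \<open>T u\<close>.\<close>

lemma gamma_tether: "x \<in> X \<Longrightarrow> \<gamma> (tether x) = \<one>\<^bsub>\<G>\<^esub>"
proof -
  assume x: "x \<in> X"
  define c where "c = tether x"
  have c: "path_in X c" "pathstart c = x0" "pathfinish c = x" using x by (simp_all add: c_def tether)
  have t0: "tether x0 = (\<lambda>_. x0)" by (simp add: tether_def)
  have "homotopic_paths X (((\<lambda>_. x0) +++ c) +++ reversepath c) (c +++ reversepath c)"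
    using c by (intro homotopic_paths_join homotopic_paths_const_left) (auto simp: path_in_def)
  moreover have "homotopic_paths X (c +++ reversepath c) (\<lambda>_. x0)"
    using homotopic_paths_reversepath_right[OF c(1)] c by simp
  ultimately have "cl (((\<lambda>_. x0) +++ c) +++ reversepath c) = cl (\<lambda>_. x0)"
    using homotopic_paths_trans cl_eqI by blast
  then show ?thesis
    using c by (simp add: \<gamma>_def tie_def one_Pi t0 flip: c_def)
qed

end

section \<open>Category in the Baire space\<close>

definition cyl :: "(nat \<Rightarrow> 'b) \<Rightarrow> nat \<Rightarrow> (nat \<Rightarrow> 'b) set" where
  "cyl z n = {w. \<forall>i<n. w i = z i}"

lemma cyl_refl [simp]: "z \<in> cyl z n" by (simp add: cyl_def)

lemma cyl_mono: "y \<in> cyl x m \<Longrightarrow> m \<le> k \<Longrightarrow> cyl y k \<subseteq> cyl x m"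
  by (auto simp: cyl_def)

lemma open_cyl [simp]: "open (cyl (z :: nat \<Rightarrow> nat) n)"
proof -
  have "open ((\<lambda>w::nat \<Rightarrow> nat. w i) -` {z i})" for i
    by (rule open_vimage[OF open_discrete continuous_on_product_coordinates])
  then have "open (\<Inter>i<n. (\<lambda>w::nat \<Rightarrow> nat. w i) -` {z i})" by (intro open_INT) auto
  also have "(\<Inter>i<n. (\<lambda>w::nat \<Rightarrow> nat. w i) -` {z i}) = cyl z n" by (auto simp: cyl_def)
  finally show ?thesis .
qed

lemma open_contains_cyl:
  assumes "open U" "(z :: nat \<Rightarrow> nat) \<in> U"
  obtains n where "cyl z n \<subseteq> U"
proof -
  have "openin (product_topology (\<lambda>i. euclidean) UNIV) U"
    using assms(1) by (simp add: open_fun_def)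
  from product_topology_open_contains_basis[OF this assms(2)] obtain Y where
    Y: "z \<in> (\<Pi>\<^sub>E i\<in>UNIV. Y i)" "finite {i. Y i \<noteq> UNIV}" "(\<Pi>\<^sub>E i\<in>UNIV. Y i) \<subseteq> U"
    by auto
  then obtain n where n: "\<forall>i\<in>{i. Y i \<noteq> UNIV}. i < n" using finite_nat_set_iff_bounded by blast
  have "cyl z n \<subseteq> (\<Pi>\<^sub>E i\<in>UNIV. Y i)"
  proof
    fix w assume w: "w \<in> cyl z n"
    have "w i \<in> Y i" for i
      using w n Y(1) by (cases "i < n") (auto simp: cyl_def PiE_iff)
    then show "w \<in> (\<Pi>\<^sub>E i\<in>UNIV. Y i)" by auto
  qed
  from that[OF subset_trans[OF this Y(3)]] show ?thesis .
qed

lemma open_contains_cyl_prod: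
  assumes "open W" "(a :: nat \<Rightarrow> nat, b :: nat \<Rightarrow> nat) \<in> W"
  obtains n where "cyl a n \<times> cyl b n \<subseteq> W"
proof -
  obtain U V where "open U" "open V" "a \<in> U" "b \<in> V" "U \<times> V \<subseteq> W"
    using open_prod_elim[OF assms] by (metis mem_Sigma_iff)
  moreover obtain m k where "cyl a m \<subseteq> U" "cyl b k \<subseteq> V"
    using calculation open_contains_cyl by metis
  moreover have "cyl a (max m k) \<subseteq> cyl a m" "cyl b (max m k) \<subseteq> cyl b k"
    by (intro cyl_mono; simp)+
  ultimately show ?thesis using that[of "max m k"] by blast
qed

section \<open>Meager sets and the Baire property of projections\<close>

definition meager :: "'a::topological_space set \<Rightarrow> bool" where
  "meager A \<longleftrightarrow> (\<exists>F :: nat \<Rightarrow> 'a set. (\<forall>n. closed (F n) \<and> interior (F n) = {}) \<and> A \<subseteq> (\<Union>n. F n))"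

lemma meager_subset: "meager B \<Longrightarrow> A \<subseteq> B \<Longrightarrow> meager A"
  unfolding meager_def by blast

lemma meager_closed: "closed A \<Longrightarrow> interior A = {} \<Longrightarrow> meager A"
  unfolding meager_def by (intro exI[of _ "\<lambda>_. A"]) auto

lemma meager_empty [simp]: "meager {}" by (intro meager_closed) auto

lemma meager_UN_nat:
  assumes "\<And>n::nat. meager (A n)"
  shows "meager (\<Union>n. A n)"
proof -
  obtain F where F: "\<And>n m. closed (F n m) \<and> interior (F n m) = {}" "\<And>n. A n \<subseteq> (\<Union>m. F n (m::nat))"
    using assms unfolding meager_def by metis
  have "(\<Union>n. A n) \<subseteq> (\<Union>k. (\<lambda>(n, m). F n m) (prod_decode k))"
  proof
    fix x assume "x \<in> (\<Union>n. A n)"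
    then obtain n m where "x \<in> F n m" using F(2) by blast
    then show "x \<in> (\<Union>k. (\<lambda>(n, m). F n m) (prod_decode k))"
      by (intro UN_I[of "prod_encode (n, m)"]) auto
  qed
  then show ?thesis
    unfolding meager_def using F(1)
    by (intro exI[of _ "\<lambda>k. (\<lambda>(n, m). F n m) (prod_decode k)"]) (auto split: prod.split)
qed

lemma meager_UN:
  assumes "countable I" "\<And>i. i \<in> I \<Longrightarrow> meager (A i)"
  shows "meager (\<Union>i\<in>I. A i)"
proof (cases "I = {}")
  case False
  then have r: "range (from_nat_into I) = I" using assms(1) by (rule range_from_nat_into)
  then have "meager (\<Union>n. A (from_nat_into I n))"
    using assms(2) by (intro meager_UN_nat) auto
  moreover have "(\<Union>i\<in>I. A i) \<subseteq> (\<Union>n. A (from_nat_into I n))"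
  proof
    fix x assume "x \<in> (\<Union>i\<in>I. A i)"
    then obtain i where "i \<in> I" "x \<in> A i" by auto
    moreover from this(1) obtain n where "i = from_nat_into I n" using r by (metis imageE)
    ultimately show "x \<in> (\<Union>n. A (from_nat_into I n))" by auto
  qed
  ultimately show ?thesis by (rule meager_subset)
qed simp

lemma meager_Un: "meager A \<Longrightarrow> meager B \<Longrightarrow> meager (A \<union> B)"
  using meager_UN[of "{True, False}" "\<lambda>b. if b then A else B"] by (simp add: Un_commute)

lemma not_meager_open:
  assumes "completely_metrizable_space (euclidean :: 'a::topological_space topology)"
    and "open U" "U \<noteq> {}"
  shows "\<not> meager (U :: 'a set)"
proof
  assume "meager U"
  then obtain F where F: "\<And>n::nat. closed (F n) \<and> interior (F n) = {}" "U \<subseteq> (\<Union>n. F n)"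
    unfolding meager_def by auto
  have "euclidean interior_of \<Union>(range F) = {}"
    using assms(1) F(1) by (intro Baire_category_alt) auto
  moreover have "U \<subseteq> euclidean interior_of \<Union>(range F)"
    using assms(2) F(2) by (intro interior_of_maximal) auto
  ultimately show False using assms(3) by auto
qed

text \<open>A continuous involution is a homeomorphism, so it preserves closed sets with empty
  interior. The intended map flips one coordinate.\<close>

lemma meager_vimage_involution:
  assumes "continuous_on UNIV f" "\<And>x. f (f x) = x" "meager A"
  shows "meager (f -` A)"
proof -
  obtain F where F: "\<And>n::nat. closed (F n) \<and> interior (F n) = {}" "A \<subseteq> (\<Union>n. F n)"
    using assms(3) unfolding meager_def by auto
  have "interior (f -` F n) = {}" for n
  proof -
    have "open (f -` interior (f -` F n))"
      using assms(1) by (intro open_vimage) auto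
    moreover have "f -` interior (f -` F n) \<subseteq> F n"
      using interior_subset assms(2) by (metis (no_types, lifting) subsetD subsetI vimage_eq)
    ultimately have "f -` interior (f -` F n) \<subseteq> interior (F n)" by (rule interior_maximal[rotated])
    then show ?thesis using F(1)[of n] assms(2) by (metis equals0I subset_empty vimageI2 empty_iff)
  qed
  moreover have "closed (f -` F n)" for n using F(1) assms(1) by (intro closed_vimage) auto
  moreover have "f -` A \<subseteq> (\<Union>n. f -` F n)"
    using vimage_mono[OF F(2)] by (simp add: vimage_UN)
  ultimately show ?thesis unfolding meager_def by (intro exI[of _ "\<lambda>n. f -` F n"]) auto
qed

text \<open>The closed set that agrees with \<open>A\<close> up to a meager set if \<open>A\<close> has the Baire property.\<close>

definition heart :: "'a::topological_space set \<Rightarrow> 'a set" where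
  "heart A = {x. \<forall>U. open U \<longrightarrow> x \<in> U \<longrightarrow> \<not> meager (A \<inter> U)}"

lemma closed_heart: "closed (heart A)"
proof -
  have "- heart A = \<Union>{U. open U \<and> meager (A \<inter> U)}" by (auto simp: heart_def)
  then show ?thesis by (simp add: closed_def open_Union)
qed

lemma heart_subset_closed: "A \<subseteq> C \<Longrightarrow> closed C \<Longrightarrow> heart A \<subseteq> C"
proof
  fix x assume "A \<subseteq> C" "closed C" "x \<in> heart A"
  then show "x \<in> C" by (cases "x \<in> C") (force simp: heart_def closed_def dest!: spec[of _ "- C"]
     simp: disjoint_eq_subset_Compl[THEN iffD2])+
qed

text \<open>A point of \<open>A\<close> outside the heart has a basic open neighbourhood in which
  \<open>A\<close> is meager, and there are only countably many basic open sets.\<close>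

lemma meager_Diff_heart: "meager (A - heart A)" for A :: "'a::second_countable_topology set"
proof -
  obtain \<B> :: "'a set set" where B: "countable \<B>" "topological_basis \<B>" using ex_countable_basis by auto
  have "A - heart A \<subseteq> (\<Union>U\<in>{U\<in>\<B>. meager (A \<inter> U)}. A \<inter> U)"
  proof
    fix x assume x: "x \<in> A - heart A"
    then obtain U where U: "open U" "x \<in> U" "meager (A \<inter> U)" by (auto simp: heart_def)
    obtain V where "V \<in> \<B>" "x \<in> V" "V \<subseteq> U" using topological_basisE[OF B(2) U(1,2)] .
    then show "x \<in> (\<Union>U\<in>{U\<in>\<B>. meager (A \<inter> U)}. A \<inter> U)"
      using x U(3) by (intro UN_I[of V]) (auto intro: meager_subset)
  qed
  moreover have "meager (\<Union>U\<in>{U\<in>\<B>. meager (A \<inter> U)}. A \<inter> U)"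
    using B(1) by (intro meager_UN) auto
  ultimately show ?thesis by (rule meager_subset[rotated])
qed

text \<open>If the difference were not meager, its heart would contain a nonempty open set
  \<open>V\<close>. Every \<open>A n\<close>, and so their union, would be meager in
  \<open>V\<close>, although \<open>V\<close> lies in the heart of the union.\<close>

lemma meager_heart_Diff:
  fixes A :: "nat \<Rightarrow> 'a::second_countable_topology set"
  shows "meager (heart (\<Union>n. A n) - (\<Union>n. heart (A n)))" (is "meager ?P")
proof (cases "interior (heart ?P) = {}")
  case True
  then have "meager ((?P - heart ?P) \<union> heart ?P)"
    by (intro meager_Un meager_Diff_heart meager_closed closed_heart)
  then show ?thesis by (rule meager_subset) auto
next
  case False
  define V where "V = interior (heart ?P)"
  have V: "open V" "V \<noteq> {}" "V \<subseteq> heart ?P" using False interior_subset by (auto simp: V_def)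
  have "meager (A n \<inter> V)" for n
  proof -
    \<comment> \<open>A point of \<open>W\<close> would make the difference nonmeager in
      \<open>W\<close>, while the difference is disjoint from \<open>heart (A n)\<close> by
      construction.\<close>
    define W where "W = V \<inter> interior (heart (A n))"
    have "W = {}"
    proof (rule ccontr)
      assume "W \<noteq> {}"
      then obtain x where "x \<in> W" by auto
      moreover have "open W" using V by (auto simp: W_def)
      ultimately have "\<not> meager (?P \<inter> W)" using V(3) by (auto simp: heart_def W_def)
      moreover have "?P \<inter> W = {}" using interior_subset by (auto simp: W_def)
      ultimately show False by (metis meager_empty)
    qed
    have "closed (heart (A n) - interior (heart (A n)))" by (intro closed_Diff closed_heart) auto
    moreover have "interior (heart (A n) - interior (heart (A n))) = {}"
      using interior_maximal[OF _ open_interior, of "heart (A n) - interior (heart (A n))" "heart (A n)"]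
        interior_subset[of "heart (A n) - interior (heart (A n))"] by blast
    ultimately have "meager ((A n - heart (A n)) \<union> (heart (A n) - interior (heart (A n))))"
      by (intro meager_Un meager_Diff_heart meager_closed)
    then show ?thesis by (rule meager_subset) (use \<open>W = {}\<close> in \<open>auto simp: W_def\<close>)
  qed
  then have "meager (\<Union>n. A n \<inter> V)" by (rule meager_UN_nat)
  then have m: "meager ((\<Union>n. A n) \<inter> V)" by (rule meager_subset) auto
  obtain x where x: "x \<in> V" using V by auto
  have "heart ?P \<subseteq> heart (\<Union>n. A n)" by (intro heart_subset_closed closed_heart) auto
  then show ?thesis using x V m by (auto simp: heart_def)
qed

text \<open>The Souslin scheme of a projection yields the Baire property: off a meager set, membership in
  the heart propagates along a branch of the scheme, and closedness identifies the limit.\<close>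

lemma meager_heart_Diff_projection:
  fixes R :: "('a::second_countable_topology \<times> (nat \<Rightarrow> nat)) set"
  assumes "closed R"
  shows "meager (heart (fst ` R) - fst ` R)"
proof -
  \<comment> \<open>\<open>A s\<close> collects the points with a witness extending the finite
    sequence \<open>s\<close>. Finite sequences are countable, so the exceptional set
    \<open>M\<close> below is a countable union.\<close>
  define A where "A s = {x. \<exists>w. (\<forall>i<length s. w i = s ! i) \<and> (x, w) \<in> R}" for s
  have A_UN: "A s = (\<Union>n. A (s @ [n]))" for s
  proof (intro Set.set_eqI iffI)
    fix x assume "x \<in> A s"
    then obtain w where w: "\<forall>i<length s. w i = s ! i" "(x, w) \<in> R" by (auto simp: A_def)
    then have "x \<in> A (s @ [w (length s)])"
      by (auto simp: A_def nth_append less_Suc_eq intro!: exI[of _ w])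
    then show "x \<in> (\<Union>n. A (s @ [n]))" by blast
  next
    fix x assume "x \<in> (\<Union>n. A (s @ [n]))"
    then obtain n w where w: "\<forall>i<Suc (length s). w i = (s @ [n]) ! i" "(x, w) \<in> R" by (auto simp: A_def)
    have "w i = s ! i" if "i < length s" for i
      using w(1)[rule_format, of i] that by (simp add: nth_append)
    with w(2) show "x \<in> A s" by (auto simp: A_def)
  qed
  define M where "M = (\<Union>s. heart (A s) - (\<Union>n. heart (A (s @ [n]))))"
  have "meager M"
    unfolding M_def
  proof (rule meager_UN)
    show "meager (heart (A s) - (\<Union>n. heart (A (s @ [n]))))" for s
      using meager_heart_Diff[of "\<lambda>n. A (s @ [n])"] unfolding A_UN[symmetric] .
  qed auto
  moreover have "heart (fst ` R) - fst ` R \<subseteq> M"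
  proof (rule subsetI, rule ccontr)
    fix x assume x: "x \<in> heart (fst ` R) - fst ` R" "x \<notin> M"
    have "\<exists>n. x \<in> heart (A (s @ [n]))" if "x \<in> heart (A s)" for s
      using that x(2) by (auto simp: M_def)
    then obtain c where c: "\<And>s. x \<in> heart (A s) \<Longrightarrow> x \<in> heart (A (s @ [c s]))" by metis
    define S where "S = rec_nat [] (\<lambda>_ s. s @ [c s])"
    have S: "S 0 = []" "S (Suc k) = S k @ [c (S k)]" for k by (simp_all add: S_def)
    have "A [] = fst ` R" by (force simp: A_def)
    then have h: "x \<in> heart (A (S k))" for k
      by (induction k) (use x(1) c S in auto)
    define z where "z k = c (S k)" for k
    have Sz: "S k = map z [0..<k]" for k by (induction k) (auto simp: S z_def)
    \<comment> \<open>Every box around \<open>(x, z)\<close> meets \<open>R\<close>: the heart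
      provides points of \<open>A (S n)\<close> close to \<open>x\<close>, and their witnesses agree
      with \<open>z\<close> below \<open>n\<close>.\<close>
    have "(x, z) \<in> R"
    proof (rule ccontr)
      assume "(x, z) \<notin> R"
      then have "(x, z) \<in> - R" "open (- R)" using assms by auto
      then obtain U W where UW: "open U" "open W" "x \<in> U" "z \<in> W" "U \<times> W \<subseteq> - R"
        using open_prod_elim by (metis mem_Sigma_iff)
      obtain n where n: "cyl z n \<subseteq> W" using open_contains_cyl[OF UW(2,4)] by auto
      have "A (S n) \<inter> U \<noteq> {}" using h[of n] UW by (auto simp: heart_def)
      then obtain x' w where "x' \<in> U" "(x', w) \<in> R" "\<forall>i<n. w i = z i"
        by (auto simp: A_def Sz)
      then show False using UW(5) n by (auto simp: cyl_def)
    qed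
    then show False using x(1) by force
  qed
  ultimately show ?thesis by (rule meager_subset)
qed

text \<open>Selections of indices are coded by parities, so that the Baire space can replace the Cantor
  space.\<close>

definition flip :: "nat \<Rightarrow> (nat \<Rightarrow> nat) \<Rightarrow> nat \<Rightarrow> nat" where
  "flip n x = x(n := if even (x n) then x n + 1 else x n - 1)"

lemma flip_flip [simp]: "flip n (flip n x) = x"
  by (auto simp: flip_def)

lemma continuous_flip: "continuous_on UNIV (flip n)"
proof (rule continuous_on_coordinatewise_then_product)
  fix i
  have "continuous_on UNIV ((\<lambda>k::nat. if even k then k + 1 else k - 1) \<circ> (\<lambda>x. x n))"
    by (intro continuous_on_compose continuous_on_product_coordinates)
       (auto simp: continuous_on_open_invariant open_discrete)
  then show "continuous_on UNIV (\<lambda>x. flip n x i)"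
    by (cases "i = n") (auto simp: flip_def o_def)
qed

section \<open>Independent points for relations on the Baire space\<close>

lemma completely_metrizable_baire: "completely_metrizable_space (euclidean :: (nat \<Rightarrow> nat) topology)"
proof -
  have "(euclidean :: nat topology) = discrete_topology UNIV"
    using discrete_topology_unique[of UNIV "euclidean :: nat topology"] by (simp add: open_discrete)
  then have "completely_metrizable_space (euclidean :: nat topology)"
    by (metis completely_metrizable_space_discrete_topology)
  then have "completely_metrizable_space (product_topology (\<lambda>i::nat. euclidean :: nat topology) UNIV)"
    by (auto simp: completely_metrizable_space_product_topology)
  then show ?thesis by (simp add: euclidean_product_topology)
qed

lemma completely_metrizable_baire_prod:
  "completely_metrizable_space (euclidean :: ((nat \<Rightarrow> nat) \<times> (nat \<Rightarrow> nat)) topology)"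
  using completely_metrizable_baire
  by (metis completely_metrizable_space_prod_topology prod_topology_euclidean)

text \<open>The pairs are treated one after the other. Since \<open>F\<close> is nowhere dense, the
  box of the current pair contains a smaller box that avoids \<open>F\<close>, and shrinking all
  cylinders keeps the earlier boxes disjoint from \<open>F\<close>.\<close>

lemma separate_boxes:
  fixes F :: "((nat \<Rightarrow> nat) \<times> (nat \<Rightarrow> nat)) set" and x :: "'i \<Rightarrow> nat \<Rightarrow> nat"
  assumes "closed F" "interior F = {}" "finite P" "\<And>u v. (u, v) \<in> P \<Longrightarrow> u \<noteq> v"
  shows "\<exists>x' m'. m \<le> m' \<and> (\<forall>u. x' u \<in> cyl (x u) m) \<and>
    (\<forall>(u, v)\<in>P. (cyl (x' u) m' \<times> cyl (x' v) m') \<inter> F = {})"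
  using assms(3,4)
proof (induction P)
  case empty
  then show ?case by (intro exI[of _ x] exI[of _ m]) auto
next
  case (insert p P)
  obtain u v where p: "p = (u, v)" by (cases p)
  have uv: "u \<noteq> v" using insert.prems p by auto
  obtain x' m' where x': "m \<le> m'" "\<And>u. x' u \<in> cyl (x u) m"
    "\<And>u v. (u, v) \<in> P \<Longrightarrow> (cyl (x' u) m' \<times> cyl (x' v) m') \<inter> F = {}"
    using insert by fast
  define W where "W = (cyl (x' u) m' \<times> cyl (x' v) m') - F"
  have "open (cyl (x' u) m' \<times> cyl (x' v) m')" by (intro open_Times open_cyl)
  moreover have "cyl (x' u) m' \<times> cyl (x' v) m' \<noteq> {}" using cyl_refl by blast
  ultimately have "W \<noteq> {}" "open W"
    unfolding W_def using assms(1,2) interior_maximal[of "cyl (x' u) m' \<times> cyl (x' v) m'" F]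
    by (auto intro: open_Diff)
  then obtain a b where ab: "(a, b) \<in> W" by auto
  obtain k where k: "cyl a k \<times> cyl b k \<subseteq> W"
    using open_contains_cyl_prod[OF \<open>open W\<close> ab] .
  \<comment> \<open>Both centres can be moved independently because \<open>u\<close> and
    \<open>v\<close> differ; a diagonal pair could not be treated this way.\<close>
  define x'' where "x'' = x'(u := a, v := b)"
  have in': "x'' w \<in> cyl (x' w) m'" for w
    using ab uv by (auto simp: x''_def W_def)
  have sub: "cyl (x'' w) (max m' k) \<subseteq> cyl (x' w) m'" for w
    by (rule cyl_mono[OF in']) auto
  have "cyl (x' w) m' \<subseteq> cyl (x w) m" for w by (rule cyl_mono[OF x'(2) x'(1)])
  then have 1: "x'' w \<in> cyl (x w) m" for w using in' by blast
  have 2: "(cyl (x'' u') (max m' k) \<times> cyl (x'' v') (max m' k)) \<inter> F = {}" if "(u', v') \<in> insert p P" for u' v'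
  proof (cases "(u', v') = (u, v)")
    case True
    have "cyl a (max m' k) \<subseteq> cyl a k" "cyl b (max m' k) \<subseteq> cyl b k"
      by (intro cyl_mono; simp)+
    then show ?thesis using True k uv by (auto simp: x''_def W_def)
  next
    case False
    then have "(u', v') \<in> P" using that p by auto
    then show ?thesis using x'(3)[of u' v'] sub[of u'] sub[of v'] by blast
  qed
  show ?case
    using 1 2 x'(1) by (intro exI[of _ x''] exI[of _ "max m' k"]) auto
qed

text \<open>Mycielski's theorem for binary relations on the Baire space.\<close>

lemma meager_relation_independent:
  fixes E :: "((nat \<Rightarrow> nat) \<times> (nat \<Rightarrow> nat)) set"
  assumes "meager E"
  obtains f :: "nat set \<Rightarrow> nat \<Rightarrow> nat" where "\<And>A B. A \<noteq> B \<Longrightarrow> (f A, f B) \<notin> E"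
proof -
  obtain F where F: "\<And>n::nat. closed (F n) \<and> interior (F n) = {}" "E \<subseteq> (\<Union>n. F n)"
    using assms unfolding meager_def by auto
  \<comment> \<open>Increasing unions make it enough that two branches avoid \<open>G n\<close> from
    some level on.\<close>
  define G where "G n = (\<Union>k\<le>n. F k)" for n
  have G: "closed (G n)" "interior (G n) = {}" for n
  proof -
    show "closed (G n)" for n unfolding G_def using F by (intro closed_UN) auto
    show "interior (G n) = {}"
    proof (induction n)
      case 0
      then show ?case using F by (simp add: G_def)
    next
      case (Suc n)
      have "G (Suc n) = G n \<union> F (Suc n)" by (auto simp: G_def le_Suc_eq)
      then show ?case using Suc F \<open>closed (G n)\<close>
        by (metis interior_closed_Un_empty_interior)
    qed
  qed
  define T :: "nat \<Rightarrow> bool list set" where "T n = {u. length u = n}" for n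
  have finT: "finite (T n)" for n
    using finite_lists_length_eq[of "UNIV :: bool set" n] by (simp add: T_def)
  \<comment> \<open>A stage is a choice of a centre for every node of the binary tree together with
    one common depth. Passing to the next stage keeps each node inside the cylinder of its parent
    and takes the boxes of distinct nodes of length \<open>Suc n\<close> away from
    \<open>G n\<close>.\<close>
  define Q where "Q n s s' \<longleftrightarrow> snd s < snd s' \<and> (\<forall>u. fst s' u \<in> cyl (fst s (take n u)) (snd s)) \<and>
      (\<forall>u\<in>T (Suc n). \<forall>v\<in>T (Suc n). u \<noteq> v \<longrightarrow>
        (cyl (fst s' u) (snd s') \<times> cyl (fst s' v) (snd s')) \<inter> G n = {})"
    for n and s s' :: "(bool list \<Rightarrow> nat \<Rightarrow> nat) \<times> nat"
  have step: "\<exists>s'. Q n s s'"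
    for s :: "(bool list \<Rightarrow> nat \<Rightarrow> nat) \<times> nat" and n
  proof -
    have "finite (T (Suc n) \<times> T (Suc n) - Id)" using finT by auto
    from separate_boxes[OF G(1) G(2)[of n] this, of "Suc (snd s)" "\<lambda>u. fst s (take n u)"]
    obtain x' m' where x': "Suc (snd s) \<le> m'" "\<forall>u. x' u \<in> cyl (fst s (take n u)) (Suc (snd s))"
      "\<forall>(u, v)\<in>T (Suc n) \<times> T (Suc n) - Id. (cyl (x' u) m' \<times> cyl (x' v) m') \<inter> G n = {}"
      by auto
    have 3: "(cyl (x' u) m' \<times> cyl (x' v) m') \<inter> G n = {}"
      if "u \<in> T (Suc n)" "v \<in> T (Suc n)" "u \<noteq> v" for u v
      using bspec[OF x'(3), of "(u, v)"] that by simp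
    have "x' u \<in> cyl (fst s (take n u)) (snd s)" for u
      using x'(2) by (auto simp: cyl_def)
    with x'(1) 3 have "Q n s (x', m')" by (simp add: Q_def)
    then show ?thesis ..
  qed
  obtain s where "\<And>n. Q n (s n) (s (Suc n))"
    using dependent_nat_choice[of "\<lambda>_ _. True" Q] step by auto
  then have s: "\<And>n. snd (s n) < snd (s (Suc n))"
    "\<And>n u. fst (s (Suc n)) u \<in> cyl (fst (s n) (take n u)) (snd (s n))"
    "\<And>n u v. u \<in> T (Suc n) \<Longrightarrow> v \<in> T (Suc n) \<Longrightarrow> u \<noteq> v \<Longrightarrow>
        (cyl (fst (s (Suc n)) u) (snd (s (Suc n))) \<times> cyl (fst (s (Suc n)) v) (snd (s (Suc n)))) \<inter> G n = {}"
    unfolding Q_def by blast+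
  define m where "m n = snd (s n)" for n
  define Y where "Y A n = fst (s n) (map (\<lambda>i. i \<in> A) [0..<n])" for A :: "nat set" and n
  have m: "strict_mono m" using s(1) by (simp add: strict_mono_Suc_iff m_def)
  have Ystep: "Y A (Suc n) \<in> cyl (Y A n) (m n)" for A n
    using s(2)[of n "map (\<lambda>i. i \<in> A) [0..<Suc n]"] by (simp add: Y_def m_def take_map)
  have Ycyl: "Y A (n + k) \<in> cyl (Y A n) (m n)" for A n k
  proof (induction k)
    case (Suc k)
    have "m n \<le> m (n + k)" using m by (simp add: strict_mono_less_eq)
    then show ?case using Suc Ystep[of A "n + k"] by (auto simp: cyl_def)
  qed simp
  \<comment> \<open>The depths increase strictly, so coordinate \<open>i\<close> is final from stage
    \<open>Suc i\<close> on.\<close>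
  define f where "f A i = Y A (Suc i) i" for A i
  have mn: "n \<le> m n" for n using m by (rule strict_mono_imp_increasing)
  have f: "f A \<in> cyl (Y A n) (m n)" for A n
  proof -
    have "Y A (Suc i) i = Y A n i" if "i < m n" for i
    proof (cases "n \<le> Suc i")
      case True
      then show ?thesis using Ycyl[of A n "Suc i - n"] that by (auto simp: cyl_def)
    next
      case False
      then show ?thesis using Ycyl[of A "Suc i" "n - Suc i"] mn[of "Suc i"] by (auto simp: cyl_def)
    qed
    then show ?thesis by (simp add: cyl_def f_def)
  qed
  show ?thesis
  proof
    fix A B :: "nat set" assume "A \<noteq> B"
    then obtain k where k: "(k \<in> A) \<noteq> (k \<in> B)" by blast
    \<comment> \<open>The nodes of \<open>A\<close> and \<open>B\<close> of length
      \<open>Suc n\<close> include position \<open>k\<close>, so they are distinct as soon as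
      \<open>n\<close> is at least \<open>k\<close>.\<close>
    have "(f A, f B) \<notin> G n" if n: "n \<ge> k" for n
    proof -
      have "map (\<lambda>i. i \<in> A) [0..<Suc n] ! k \<noteq> map (\<lambda>i. i \<in> B) [0..<Suc n] ! k"
        using k n by (auto simp: nth_append simp del: upt_Suc)
      then have "map (\<lambda>i. i \<in> A) [0..<Suc n] \<noteq> map (\<lambda>i. i \<in> B) [0..<Suc n]" by metis
      then show ?thesis
        using s(3)[of "map (\<lambda>i. i \<in> A) [0..<Suc n]" n "map (\<lambda>i. i \<in> B) [0..<Suc n]"] f[of A "Suc n"] f[of B "Suc n"]
        unfolding T_def Y_def m_def by (auto simp del: upt_Suc)
    qed
    moreover have "F n \<subseteq> G (max n k)" for n unfolding G_def by (rule UN_upper) simp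
    ultimately have "(f A, f B) \<notin> F n" for n by (metis max.cobounded2 subsetD)
    then show "(f A, f B) \<notin> E" using F(2) by blast
  qed
qed

text \<open>If \<open>E\<close> were not meager, it would contain almost all of a box, in the sense
  of category. A generic point \<open>(x, y)\<close> of the box would then satisfy both
  \<open>E x y\<close> and \<open>E (flip n x) y\<close>, so that \<open>x\<close> would be
  equivalent to its flip. Hence \<open>E\<close> is meager.\<close>

theorem flip_inequivalent_imp_independent:
  fixes E :: "(nat \<Rightarrow> nat) \<Rightarrow> (nat \<Rightarrow> nat) \<Rightarrow> bool"
  assumes "closed R" and R: "\<And>x y. E x y \<longleftrightarrow> (\<exists>z :: nat \<Rightarrow> nat. ((x, y), z) \<in> R)"
    and "symp E" "transp E" and flip: "\<And>n x. \<not> E x (flip n x)"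
  obtains f :: "nat set \<Rightarrow> nat \<Rightarrow> nat" where "\<And>A B. A \<noteq> B \<Longrightarrow> \<not> E (f A) (f B)"
proof -
  have ER: "fst ` R = {(x, y). E x y}" using R by force
  have "meager (fst ` R)"
  proof (rule ccontr)
    assume nm: "\<not> meager (fst ` R)"
    have "interior (heart (fst ` R)) \<noteq> {}"
    proof
      assume "interior (heart (fst ` R)) = {}"
      then have "meager ((fst ` R - heart (fst ` R)) \<union> heart (fst ` R))"
        by (intro meager_Un meager_Diff_heart meager_closed closed_heart)
      then show False using nm meager_subset by blast
    qed
    then obtain a b where ab: "(a, b) \<in> interior (heart (fst ` R))" by auto
    obtain n where "cyl a n \<times> cyl b n \<subseteq> interior (heart (fst ` R))"
      using open_contains_cyl_prod[OF open_interior ab] .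
    then have n: "cyl a n \<times> cyl b n \<subseteq> heart (fst ` R)" using interior_subset by (rule subset_trans)
    define Z where "Z = heart (fst ` R) - fst ` R"
    have Z: "meager Z" unfolding Z_def by (rule meager_heart_Diff_projection[OF assms(1)])
    \<comment> \<open>Depth \<open>n\<close> fixes the coordinates below \<open>n\<close> only, so
      changing coordinate \<open>n\<close> maps the box to itself.\<close>
    define \<phi> where "\<phi> p = (flip n (fst p), snd p)" for p :: "(nat \<Rightarrow> nat) \<times> (nat \<Rightarrow> nat)"
    have "meager (\<phi> -` Z)"
    proof (rule meager_vimage_involution[OF _ _ Z])
      have "continuous_on UNIV (\<lambda>p :: (nat \<Rightarrow> nat) \<times> (nat \<Rightarrow> nat). flip n (fst p))"
        by (rule continuous_on_compose2[OF continuous_flip continuous_on_fst[OF continuous_on_id]]) simp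
      then show "continuous_on UNIV \<phi>"
        unfolding \<phi>_def by (rule continuous_on_Pair[OF _ continuous_on_snd[OF continuous_on_id]])
    qed (auto simp: \<phi>_def)
    then have "meager (Z \<union> \<phi> -` Z)" using Z by (rule meager_Un[rotated])
    moreover have "\<not> meager (cyl a n \<times> cyl b n)"
      by (intro not_meager_open completely_metrizable_baire_prod open_Times open_cyl)
         (use cyl_refl in blast)
    ultimately have "\<not> cyl a n \<times> cyl b n \<subseteq> Z \<union> \<phi> -` Z" using meager_subset by blast
    then obtain x y where xy: "x \<in> cyl a n" "y \<in> cyl b n" "(x, y) \<notin> Z" "\<phi> (x, y) \<notin> Z" by auto
    have "flip n x \<in> cyl a n" using xy(1) by (auto simp: cyl_def flip_def)
    then have "E x y" "E (flip n x) y"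
      using xy n ER by (auto simp: Z_def \<phi>_def)
    then have "E x (flip n x)" using transpD[OF assms(4)] sympD[OF assms(3)] by blast
    then show False using flip by blast
  qed
  then obtain f :: "nat set \<Rightarrow> nat \<Rightarrow> nat" where f: "\<And>A B. A \<noteq> B \<Longrightarrow> (f A, f B) \<notin> fst ` R"
    by (rule meager_relation_independent) blast
  have "\<not> E (f A) (f B)" if "A \<noteq> B" for A B using f[OF that] ER by simp
  then show ?thesis by (rule that)
qed

section \<open>A universal family of maps on the unit square\<close>

lemma openI_cyl:
  assumes "\<And>z. z \<in> U \<Longrightarrow> \<exists>n. cyl z n \<subseteq> U"
  shows "open (U :: (nat \<Rightarrow> nat) set)"
proof -
  obtain n where n: "\<And>z. z \<in> U \<Longrightarrow> cyl z (n z) \<subseteq> U" using assms by metis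
  then have "U = (\<Union>z\<in>U. cyl z (n z))" using cyl_refl by blast
  then show ?thesis by (metis open_UN open_cyl)
qed

abbreviation unit_square :: "(real \<times> real) set" where
  "unit_square \<equiv> {0..1} \<times> {0..1}"

text \<open>The metric is an explicit function on \<open>X\<close>, since the ambient type is merely
  a topological space and need not be metrizable. The sequence \<open>e\<close> enumerates a dense
  set, possibly with repetitions.\<close>

locale polish_subspace = Metric_space X d for X :: "'a::topological_space set" and d +
  fixes e :: "nat \<Rightarrow> 'a"
  assumes complete: "mcomplete"
    and mtopology: "mtopology = top_of_set X"
    and e_in: "\<And>n. e n \<in> X"
    and e_dense: "\<And>x \<epsilon>. x \<in> X \<Longrightarrow> \<epsilon> > 0 \<Longrightarrow> \<exists>n. d x (e n) < \<epsilon>"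
begin

lemma openin_mball_X: "x \<in> X \<Longrightarrow> openin (top_of_set X) (mball x \<epsilon>)"
  using openin_mball mtopology by metis

lemma openin_X_iff:
  "openin (top_of_set X) U \<longleftrightarrow> U \<subseteq> X \<and> (\<forall>x\<in>U. \<exists>\<epsilon>>0. mball x \<epsilon> \<subseteq> U)"
  unfolding mtopology[symmetric] openin_mtopology by blast

lemma continuous_on_iff_d:
  assumes "f ` S \<subseteq> X"
  shows "continuous_on S f \<longleftrightarrow>
    (\<forall>x\<in>S. \<forall>\<epsilon>>0. \<exists>U. open U \<and> x \<in> U \<and> (\<forall>y\<in>S \<inter> U. d (f x) (f y) < \<epsilon>))" (is "?L \<longleftrightarrow> ?R")
proof
  assume L: ?L
  show ?R
  proof (intro ballI allI impI)
    fix x and \<epsilon> :: real assume x: "x \<in> S" "\<epsilon> > 0"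
    have fx: "f x \<in> X" using x assms by auto
    have "openin (top_of_set S) (S \<inter> f -` mball (f x) \<epsilon>)"
      using L openin_mball_X[OF fx] assms by (intro continuous_openin_preimage[of _ _ X]) auto
    then obtain U where U: "open U" "S \<inter> f -` mball (f x) \<epsilon> = S \<inter> U"
      by (auto simp: openin_open)
    have "x \<in> S \<inter> f -` mball (f x) \<epsilon>" using x fx by simp
    then have "x \<in> U" using U by auto
    moreover have "d (f x) (f y) < \<epsilon>" if "y \<in> S \<inter> U" for y
    proof -
      have "y \<in> S \<inter> f -` mball (f x) \<epsilon>" using that U(2) by blast
      then show ?thesis by auto
    qed
    ultimately show "\<exists>U. open U \<and> x \<in> U \<and> (\<forall>y\<in>S \<inter> U. d (f x) (f y) < \<epsilon>)"
      using U(1) by blast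
  qed
next
  assume R: ?R
  have "openin (top_of_set S) (S \<inter> f -` V)" if V: "openin (top_of_set X) V" for V
  proof (subst openin_subopen, intro ballI)
    fix x assume x: "x \<in> S \<inter> f -` V"
    then obtain \<epsilon> where \<epsilon>: "\<epsilon> > 0" "mball (f x) \<epsilon> \<subseteq> V" using V by (auto simp: openin_X_iff)
    obtain U where U: "open U" "x \<in> U" "\<forall>y\<in>S \<inter> U. d (f x) (f y) < \<epsilon>"
      using R x \<epsilon>(1) by (meson IntD1)
    have "f y \<in> V" if "y \<in> S \<inter> U" for y
    proof -
      have "f y \<in> mball (f x) \<epsilon>" using that U x assms by auto
      then show ?thesis using \<epsilon>(2) by blast
    qed
    then have "S \<inter> U \<subseteq> S \<inter> f -` V" by blast
    with U x show "\<exists>T. openin (top_of_set S) T \<and> x \<in> T \<and> T \<subseteq> S \<inter> f -` V"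
      by (intro exI[of _ "S \<inter> U"]) (auto simp: openin_open)
  qed
  then show ?L using assms by (subst continuous_on_open_gen[of _ _ X]) auto
qed

text \<open>Cover \<open>S\<close> by open sets on which \<open>f\<close> stays within half of
  \<epsilon> of its value at a centre; a Lebesgue number of this cover is the modulus.\<close>

lemma uniform_modulus:
  fixes S :: "'s::metric_space set"
  assumes "compact S" "continuous_on S f" "f ` S \<subseteq> X" "\<epsilon> > 0"
  obtains \<delta> where "\<delta> > 0" "\<And>x y. x \<in> S \<Longrightarrow> y \<in> S \<Longrightarrow> dist x y < \<delta> \<Longrightarrow> d (f x) (f y) < \<epsilon>"
proof -
  have "\<forall>x\<in>S. \<exists>U. open U \<and> x \<in> U \<and> (\<forall>y\<in>S \<inter> U. d (f x) (f y) < \<epsilon> / 2)"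
    using assms(2,4) continuous_on_iff_d[OF assms(3)] by (meson half_gt_zero)
  then obtain U where U: "\<And>x. x \<in> S \<Longrightarrow> open (U x)" "\<And>x. x \<in> S \<Longrightarrow> x \<in> U x"
    "\<And>x y. x \<in> S \<Longrightarrow> y \<in> S \<Longrightarrow> y \<in> U x \<Longrightarrow> d (f x) (f y) < \<epsilon> / 2" by (metis IntI)
  obtain \<delta> where \<delta>: "\<delta> > 0" "\<And>x. x \<in> S \<Longrightarrow> \<exists>G\<in>U ` S. ball x \<delta> \<subseteq> G"
    using Heine_Borel_lemma[OF assms(1), of "U ` S"] U by blast
  show ?thesis
  proof (rule that[OF \<delta>(1)])
    fix x y assume xy: "x \<in> S" "y \<in> S" "dist x y < \<delta>"
    then obtain w where w: "w \<in> S" "ball x \<delta> \<subseteq> U w" using \<delta>(2) by blast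
    then have "d (f w) (f x) < \<epsilon> / 2" "d (f w) (f y) < \<epsilon> / 2"
      using U(3) xy \<delta>(1) by (auto simp: subset_iff)
    moreover have "d (f x) (f y) \<le> d (f w) (f x) + d (f w) (f y)"
      using triangle[of "f x" "f w" "f y"] assms(3) w(1) xy commute by fastforce
    ultimately show "d (f x) (f y) < \<epsilon>" by linarith
  qed
qed

text \<open>A number codes a mesh \<open>m\<close> and a list of indices into the dense sequence;
  the value at a point is read off at the lower corner of its cell. These step functions are not
  continuous in general. There are \<open>Suc m\<close> positions per row because the coordinate 1
  has index \<open>m\<close>. Whatever the list, the value is some \<open>e n\<close> and so lies in
  \<open>X\<close>.\<close>

definition grid_map :: "nat \<Rightarrow> real \<times> real \<Rightarrow> 'a" where
  "grid_map k p = (case from_nat k of (m, l) \<Rightarrow>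
     e (l ! (nat \<lfloor>real m * fst p\<rfloor> * Suc m + nat \<lfloor>real m * snd p\<rfloor>)))"

lemma grid_map_in [simp]: "grid_map k p \<in> X"
  by (simp add: grid_map_def e_in split: prod.split)

lemma grid_map_approximates:
  assumes "continuous_on unit_square H" "H ` unit_square \<subseteq> X" "\<epsilon> > 0"
  shows "\<exists>k. \<forall>p\<in>unit_square. d (H p) (grid_map k p) < \<epsilon>"
proof -
  have "compact unit_square" by (intro compact_Times) auto
  then obtain \<delta> where \<delta>: "\<delta> > 0"
    "\<And>p q. p \<in> unit_square \<Longrightarrow> q \<in> unit_square \<Longrightarrow> dist p q < \<delta> \<Longrightarrow> d (H p) (H q) < \<epsilon> / 2"
    using uniform_modulus[of unit_square H "\<epsilon> / 2"] assms by (metis half_gt_zero)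
  \<comment> \<open>Each coordinate differs from that of the lower corner by at most
    \<open>1 / m\<close>, so the distance is at most twice that.\<close>
  obtain m :: nat where m: "2 / \<delta> < real m" using reals_Archimedean2 by blast
  then have m0: "real m > 0" using \<delta>(1) by (meson divide_pos_pos less_trans zero_less_numeral)
  have m1: "2 * (1 / m) < \<delta>" using m m0 \<delta>(1) by (simp add: field_simps)
  have "\<forall>a b. \<exists>n. a \<le> m \<and> b \<le> m \<longrightarrow> d (H (a / m, b / m)) (e n) < \<epsilon> / 2"
  proof (intro allI)
    fix a b :: nat
    show "\<exists>n. a \<le> m \<and> b \<le> m \<longrightarrow> d (H (a / m, b / m)) (e n) < \<epsilon> / 2"
    proof (cases "a \<le> m \<and> b \<le> m")
      case True
      then have "(a / m, b / m) \<in> unit_square" using m0 by auto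
      then have "H (a / m, b / m) \<in> X" using assms(2) by blast
      from e_dense[OF this, of "\<epsilon> / 2"] show ?thesis using assms(3) by auto
    qed auto
  qed
  then obtain n where n: "\<And>a b. a \<le> m \<Longrightarrow> b \<le> m \<Longrightarrow> d (H (real a / m, real b / m)) (e (n a b)) < \<epsilon> / 2"
    by metis
  \<comment> \<open>The corner values are listed row by row, the corner \<open>(a, b)\<close> at
    position \<open>a * Suc m + b\<close>.\<close>
  define l where "l = map (\<lambda>i. n (i div Suc m) (i mod Suc m)) [0..<Suc m * Suc m]"
  have cell: "nat \<lfloor>real m * x\<rfloor> \<le> m" "\<bar>x - real (nat \<lfloor>real m * x\<rfloor>) / m\<bar> \<le> 1 / m" if "x \<in> {0..1}" for x :: real
  proof -
    have 0: "0 \<le> real m * x" "real m * x \<le> m" using that m0 by (auto intro: mult_left_le)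
    then show "nat \<lfloor>real m * x\<rfloor> \<le> m" by linarith
    have "\<bar>real m * x - real (nat \<lfloor>real m * x\<rfloor>)\<bar> \<le> 1" using 0 by linarith
    then have "\<bar>real m * x - real (nat \<lfloor>real m * x\<rfloor>)\<bar> / m \<le> 1 / m"
      using m0 by (simp add: divide_right_mono)
    also have "\<bar>real m * x - real (nat \<lfloor>real m * x\<rfloor>)\<bar> / m = \<bar>(real m * x - real (nat \<lfloor>real m * x\<rfloor>)) / m\<bar>"
      by simp
    also have "(real m * x - real (nat \<lfloor>real m * x\<rfloor>)) / m = x - real (nat \<lfloor>real m * x\<rfloor>) / m"
      using m0 by (simp add: diff_divide_distrib)
    finally show "\<bar>x - real (nat \<lfloor>real m * x\<rfloor>) / m\<bar> \<le> 1 / m" .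
  qed
  have "d (H p) (grid_map (to_nat (m, l)) p) < \<epsilon>" if p: "p \<in> unit_square" for p
  proof -
    obtain x y where xy: "p = (x, y)" "x \<in> {0..1}" "y \<in> {0..1}" using p by auto
    define a b where "a = nat \<lfloor>real m * x\<rfloor>" and "b = nat \<lfloor>real m * y\<rfloor>"
    have ab: "a \<le> m" "b \<le> m" "\<bar>x - a / m\<bar> \<le> 1 / m" "\<bar>y - b / m\<bar> \<le> 1 / m"
      using cell xy by (auto simp: a_def b_def)
    have "a * Suc m + b < Suc m * Suc m"
    proof -
      have "a * Suc m + b < a * Suc m + Suc m" using ab by simp
      also have "\<dots> = Suc a * Suc m" by simp
      also have "\<dots> \<le> Suc m * Suc m" using ab by (intro mult_le_mono1) simp
      finally show ?thesis .
    qed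
    moreover have "(a * Suc m + b) div Suc m = a" "(a * Suc m + b) mod Suc m = b"
      using ab by (auto simp: div_mult_self3 simp del: mult_Suc_right)
    ultimately have g: "grid_map (to_nat (m, l)) p = e (n a b)"
      by (simp add: grid_map_def xy l_def a_def b_def del: mult_Suc_right mult_Suc upt_Suc)
    have q: "(a / m, b / m) \<in> unit_square" using ab m0 by auto
    have "dist p (a / m, b / m) \<le> \<bar>x - a / m\<bar> + \<bar>y - b / m\<bar>"
      unfolding xy dist_Pair_Pair dist_real_def using sqrt_sum_squares_le_sum_abs by auto
    also have "\<dots> < \<delta>" using ab m1 by simp
    finally have "d (H p) (H (a / m, b / m)) < \<epsilon> / 2" using \<delta>(2) p q by blast
    moreover have "d (H (a / m, b / m)) (e (n a b)) < \<epsilon> / 2" using n ab by blast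
    moreover have "d (H p) (e (n a b)) \<le> d (H p) (H (a / m, b / m)) + d (H (a / m, b / m)) (e (n a b))"
      using assms(2) p q e_in by (intro triangle) blast+
    ultimately show ?thesis using g by simp
  qed
  then show ?thesis by blast
qed

section \<open>Limits of coded step functions\<close>

lemma dyadic_limit:
  assumes "\<And>n. x n \<in> X" "\<And>n. d (x n) (x (Suc n)) \<le> (1/2) ^ n"
  obtains l where "l \<in> X" "\<And>n. d (x n) l \<le> 2 * (1/2) ^ n"
proof -
  \<comment> \<open>Keeping the subtracted tail of the geometric series makes the estimate
    inductive.\<close>
  have step: "d (x n) (x (n + k)) \<le> 2 * (1/2) ^ n - 2 * (1/2) ^ (n + k)" for n k
  proof (induction k)
    case 0
    then show ?case using assms by simp
  next
    case (Suc k)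
    have "d (x n) (x (n + Suc k)) \<le> d (x n) (x (n + k)) + d (x (n + k)) (x (n + Suc k))"
      using assms by (intro triangle) auto
    also have "d (x (n + k)) (x (n + Suc k)) \<le> (1/2) ^ (n + k)" using assms(2)[of "n + k"] by simp
    finally show ?case using Suc by simp
  qed
  have le: "d (x n) (x m) \<le> 2 * (1/2) ^ n" if "n \<le> m" for n m
    using step[of n "m - n"] that by (smt (verit) le_add_diff_inverse zero_le_power half_gt_zero_iff)
  have "MCauchy x"
    unfolding MCauchy_def
  proof (intro conjI allI impI)
    show "range x \<subseteq> X" using assms by auto
    fix \<epsilon> :: real assume "\<epsilon> > 0"
    then obtain N where N: "(1/2) ^ N < \<epsilon> / 4" using real_arch_pow_inv[of "\<epsilon> / 4" "1/2"] by auto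
    have "d (x n) (x m) < \<epsilon>" if "N \<le> n" "N \<le> m" for n m
    proof -
      have "d (x n) (x m) \<le> d (x N) (x n) + d (x N) (x m)"
        using triangle[of "x n" "x N" "x m"] assms(1) commute by metis
      then show ?thesis using le[OF that(1)] le[OF that(2)] N by linarith
    qed
    then show "\<exists>N. \<forall>n n'. N \<le> n \<longrightarrow> N \<le> n' \<longrightarrow> d (x n) (x n') < \<epsilon>" by blast
  qed
  then obtain l where l: "limitin mtopology x l sequentially" using complete by (auto simp: mcomplete_def)
  then have lX: "l \<in> X" by (simp add: limit_metric_sequentially)
  have "d (x n) l \<le> 2 * (1/2) ^ n" for n
  proof (rule field_le_epsilon)
    fix \<epsilon> :: real assume "\<epsilon> > 0"
    moreover have "\<forall>\<epsilon>>0. \<exists>N. \<forall>n\<ge>N. x n \<in> X \<and> d (x n) l < \<epsilon>"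
      using l by (simp add: limit_metric_sequentially)
    ultimately obtain N where N: "\<And>m. m \<ge> N \<Longrightarrow> d (x m) l < \<epsilon>" by meson
    have "d (x n) l \<le> d (x n) (x (max n N)) + d (x (max n N)) l" using assms lX by (intro triangle) auto
    then show "d (x n) l \<le> 2 * (1/2) ^ n + \<epsilon>" using N[of "max n N"] le[of n "max n N"] by simp
  qed
  with lX show ?thesis by (rule that)
qed

text \<open>The second condition makes the limit of a coded sequence continuous. Both conditions involve
  finitely many coordinates, so they define a closed set of codes.\<close>

definition code_ok :: "nat \<Rightarrow> nat \<Rightarrow> nat \<Rightarrow> bool" where
  "code_ok n a b \<longleftrightarrow> (\<forall>p\<in>unit_square. d (grid_map a p) (grid_map b p) \<le> (1/2) ^ n) \<and>
     (\<exists>\<delta>>0. \<forall>p\<in>unit_square. \<forall>q\<in>unit_square. dist p q < \<delta> \<longrightarrow>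
        d (grid_map a p) (grid_map a q) \<le> (1/2) ^ n)"

definition codes :: "(nat \<Rightarrow> nat) set" where
  "codes = {z. \<forall>n. code_ok n (z n) (z (Suc n))}"

lemma closed_codes: "closed codes"
  unfolding closed_def
proof (rule openI_cyl)
  fix z assume "z \<in> - codes"
  then obtain n where n: "\<not> code_ok n (z n) (z (Suc n))" by (auto simp: codes_def)
  have "cyl z (n + 2) \<subseteq> - codes"
  proof
    fix w assume "w \<in> cyl z (n + 2)"
    then have "w n = z n" "w (Suc n) = z (Suc n)" by (auto simp: cyl_def)
    with n have "\<not> code_ok n (w n) (w (Suc n))" by simp
    then show "w \<in> - codes" by (auto simp: codes_def)
  qed
  then show "\<exists>n. cyl z n \<subseteq> - codes" by blast
qed

text \<open>The estimate determines \<open>l\<close>: two such limits are at distance at most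
  \<open>4 * (1/2) ^ n\<close> for every \<open>n\<close>.\<close>

definition decode :: "(nat \<Rightarrow> nat) \<times> (real \<times> real) \<Rightarrow> 'a" where
  "decode = (\<lambda>(z, p). SOME l. l \<in> X \<and> (\<forall>n. d (grid_map (z n) p) l \<le> 2 * (1/2) ^ n))"

lemma decode:
  assumes "z \<in> codes" "p \<in> unit_square"
  shows "decode (z, p) \<in> X" "d (grid_map (z n) p) (decode (z, p)) \<le> 2 * (1/2) ^ n"
proof -
  have "\<exists>l. l \<in> X \<and> (\<forall>n. d (grid_map (z n) p) l \<le> 2 * (1/2) ^ n)"
  proof -
    have "d (grid_map (z n) p) (grid_map (z (Suc n)) p) \<le> (1/2) ^ n" for n
      using assms unfolding codes_def code_ok_def by blast
    then obtain l where "l \<in> X" "\<And>n. d (grid_map (z n) p) l \<le> 2 * (1/2) ^ n"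
      using dyadic_limit[of "\<lambda>n. grid_map (z n) p"] grid_map_in by metis
    then show ?thesis by blast
  qed
  from someI_ex[OF this] show "decode (z, p) \<in> X" "d (grid_map (z n) p) (decode (z, p)) \<le> 2 * (1/2) ^ n"
    by (auto simp: decode_def)
qed

lemma continuous_decode: "continuous_on (codes \<times> unit_square) decode"
proof -
  have im: "decode ` (codes \<times> unit_square) \<subseteq> X" using decode(1) by auto
  show ?thesis
    unfolding continuous_on_iff_d[OF im]
  proof (intro ballI allI impI)
    fix zp and \<epsilon> :: real assume zp: "zp \<in> codes \<times> unit_square" and \<epsilon>: "\<epsilon> > 0"
    obtain z p where [simp]: "zp = (z, p)" and z: "z \<in> codes" and p: "p \<in> unit_square" using zp by blast
    \<comment> \<open>Five parts: two for each passage between a limit and its \<open>n\<close>-th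
      step function, and one for the oscillation of that step function. A cylinder of depth
      \<open>Suc n\<close> fixes the \<open>n\<close>-th entry, so both limits share it.\<close>
    obtain n where n: "(1/2) ^ n < \<epsilon> / 5" using real_arch_pow_inv[of "\<epsilon> / 5" "1/2"] \<epsilon> by auto
    obtain \<delta> where \<delta>: "\<delta> > 0" "\<And>q. q \<in> unit_square \<Longrightarrow> dist p q < \<delta> \<Longrightarrow>
        d (grid_map (z n) p) (grid_map (z n) q) \<le> (1/2) ^ n"
      using z p unfolding codes_def code_ok_def by blast
    have "d (decode (z, p)) (decode (w, q)) < \<epsilon>"
      if w: "w \<in> codes" "q \<in> unit_square" "w \<in> cyl z (Suc n)" "q \<in> ball p \<delta>" for w q
    proof -
      have wn: "w n = z n" using w(3) by (auto simp: cyl_def)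
      have "d (decode (z, p)) (decode (w, q)) \<le> d (decode (z, p)) (grid_map (z n) p) + d (grid_map (z n) p) (decode (w, q))"
        using decode(1) z p w by (intro triangle) auto
      also have "d (grid_map (z n) p) (decode (w, q)) \<le>
          d (grid_map (z n) p) (grid_map (z n) q) + d (grid_map (z n) q) (decode (w, q))"
        using decode(1) z p w by (intro triangle) auto
      finally show ?thesis
        using decode(2)[OF z p, of n] decode(2)[OF w(1,2), of n] \<delta>(2)[OF w(2)] w(4) n wn
          commute[of "decode (z, p)" "grid_map (z n) p"] by (simp add: mem_ball)
    qed
    then show "\<exists>U. open U \<and> zp \<in> U \<and> (\<forall>y\<in>codes \<times> unit_square \<inter> U. d (decode zp) (decode y) < \<epsilon>)"
      using \<delta>(1) by (intro exI[of _ "cyl z (Suc n) \<times> ball p \<delta>"]) (auto intro!: open_Times)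
  qed
qed

lemma decode_surj:
  assumes "continuous_on unit_square H" "H ` unit_square \<subseteq> X"
  obtains z where "z \<in> codes" "\<And>p. p \<in> unit_square \<Longrightarrow> decode (z, p) = H p"
proof -
  \<comment> \<open>A quarter suits both conditions on codes: consecutive step functions differ by
    at most 1/4 + 1/8, and the oscillation is at most 1/4 + 1/2 + 1/4, in units of
    \<open>(1/2) ^ n\<close>.\<close>
  have "\<forall>n. \<exists>k. \<forall>p\<in>unit_square. d (H p) (grid_map k p) < (1/2) ^ n / 4"
    by (intro allI grid_map_approximates[OF assms]) simp
  then obtain z where z: "\<And>n p. p \<in> unit_square \<Longrightarrow> d (H p) (grid_map (z n) p) < (1/2) ^ n / 4"
    by metis
  have HX: "H p \<in> X" if "p \<in> unit_square" for p using that assms(2) by blast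
  have zc: "z \<in> codes"
    unfolding codes_def code_ok_def mem_Collect_eq
  proof (intro allI conjI ballI)
    fix n p assume p: "p \<in> unit_square"
    have "d (grid_map (z n) p) (grid_map (z (Suc n)) p) \<le>
        d (H p) (grid_map (z n) p) + d (H p) (grid_map (z (Suc n)) p)"
      using triangle[of "grid_map (z n) p" "H p" "grid_map (z (Suc n)) p"] HX[OF p] commute[of "H p"] by simp
    then show "d (grid_map (z n) p) (grid_map (z (Suc n)) p) \<le> (1/2) ^ n"
      using z[OF p, of n] z[OF p, of "Suc n"] zero_less_power[of "1/2::real" n] unfolding power_Suc by linarith
  next
    fix n
    have "compact unit_square" by (intro compact_Times) auto
    moreover have "(1/2::real) ^ n / 2 > 0" by simp
    ultimately obtain \<delta> where \<delta>: "\<delta> > 0"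
      "\<And>p q. p \<in> unit_square \<Longrightarrow> q \<in> unit_square \<Longrightarrow> dist p q < \<delta> \<Longrightarrow> d (H p) (H q) < (1/2) ^ n / 2"
      using uniform_modulus[of unit_square H "(1/2) ^ n / 2"] assms by metis
    have "d (grid_map (z n) p) (grid_map (z n) q) \<le> (1/2) ^ n"
      if pq: "p \<in> unit_square" "q \<in> unit_square" "dist p q < \<delta>" for p q
    proof -
      have "d (grid_map (z n) p) (grid_map (z n) q) \<le> d (grid_map (z n) p) (H p) + d (H p) (grid_map (z n) q)"
        using HX pq by (intro triangle) auto
      also have "d (H p) (grid_map (z n) q) \<le> d (H p) (H q) + d (H q) (grid_map (z n) q)"
        using HX pq by (intro triangle) auto
      finally show ?thesis
        using z[OF pq(1), of n] z[OF pq(2), of n] \<delta>(2)[OF pq] commute[of "H p" "grid_map (z n) p"] by simp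
    qed
    then show "\<exists>\<delta>>0. \<forall>p\<in>unit_square. \<forall>q\<in>unit_square. dist p q < \<delta> \<longrightarrow>
        d (grid_map (z n) p) (grid_map (z n) q) \<le> (1/2) ^ n"
      using \<delta>(1) by blast
  qed
  have "decode (z, p) = H p" if p: "p \<in> unit_square" for p
  proof (rule ccontr)
    assume "decode (z, p) \<noteq> H p"
    then have pos: "d (decode (z, p)) (H p) > 0" using decode(1)[OF zc p] HX[OF p] mdist_pos_less by metis
    then obtain n where n: "(1/2) ^ n < d (decode (z, p)) (H p) / 3"
      using real_arch_pow_inv[of "d (decode (z, p)) (H p) / 3" "1/2"] by auto
    have "d (decode (z, p)) (H p) \<le> d (grid_map (z n) p) (decode (z, p)) + d (H p) (grid_map (z n) p)"
      using triangle[of "decode (z, p)" "grid_map (z n) p" "H p"] decode(1)[OF zc p] HX[OF p]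
        commute by (metis grid_map_in)
    then show False using decode(2)[OF zc p, of n] z[OF p, of n] n
      zero_less_power[of "1/2::real" n] by linarith
  qed
  with zc show ?thesis by (rule that)
qed

end

section \<open>Continuous families of paths and analytic sets of homotopy classes\<close>

definition part :: "nat \<Rightarrow> (nat \<Rightarrow> 'b) \<Rightarrow> nat \<Rightarrow> 'b" where
  "part n z = (\<lambda>i. z (prod_encode (n, i)))"

definition merge :: "(nat \<Rightarrow> nat \<Rightarrow> 'b) \<Rightarrow> nat \<Rightarrow> 'b" where
  "merge w k = (case prod_decode k of (n, i) \<Rightarrow> w n i)"

lemma part_merge [simp]: "part n (merge w) = w n"
  by (simp add: part_def merge_def)

lemma continuous_on_reindex:
  "continuous_on S (\<lambda>z :: nat \<Rightarrow> 'b::topological_space. \<lambda>i. z (h i))"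
  by (intro continuous_on_coordinatewise_then_product continuous_on_subset[OF continuous_on_product_coordinates]) auto

lemma continuous_on_part: "continuous_on S (part n :: (nat \<Rightarrow> 'b::topological_space) \<Rightarrow> _)"
  unfolding part_def[abs_def] by (rule continuous_on_reindex)

lemma continuous_on_part_comp: "continuous_on S (\<lambda>z. part m (part n z :: nat \<Rightarrow> 'b::topological_space))"
  unfolding part_def[abs_def] by (rule continuous_on_reindex)

locale polish_based_space = polish_subspace X d e + based_space X x0
  for X :: "'a::topological_space set" and d e x0
begin

text \<open>Joint continuity in parameter and time takes the place of continuity into a path space,
  for which a topology would have to be set up.\<close>

definition family :: "'t::topological_space set \<Rightarrow> ('t \<Rightarrow> real \<Rightarrow> 'a) \<Rightarrow> bool" where
  "family K F \<longleftrightarrow> continuous_on (K \<times> {0..1}) (\<lambda>(z, t). F z t) \<and> (\<forall>z\<in>K. path_in X (F z))"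

lemma familyI:
  assumes "continuous_on (K \<times> {0..1}) (\<lambda>(z, t). F z t)" "\<And>z t. z \<in> K \<Longrightarrow> t \<in> {0..1} \<Longrightarrow> F z t \<in> X"
  shows "family K F"
  unfolding family_def path_in_alt
proof (intro conjI ballI)
  fix z assume z: "z \<in> K"
  have "continuous_on {0..1} ((\<lambda>(z, t). F z t) \<circ> (\<lambda>t. (z, t)))"
    by (intro continuous_on_compose continuous_intros continuous_on_subset[OF assms(1)]) (use z in auto)
  then show "continuous_on {0..1} (F z)" by (simp add: o_def)
qed (use assms in auto)

lemma family_slice: "family K F \<Longrightarrow> t \<in> {0..1} \<Longrightarrow> continuous_on K (\<lambda>z. F z t)"
proof -
  assume F: "family K F" "t \<in> {0..1}"
  then have "continuous_on K (\<lambda>z. (\<lambda>(z, t). F z t) (z, t))"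
    by (intro continuous_on_compose2[of "K \<times> {0..1}" "\<lambda>(z, t). F z t" K "\<lambda>z. (z, t)"] continuous_on_Pair
        continuous_on_id continuous_on_const) (auto simp: family_def)
  then show ?thesis by simp
qed

lemma family_const: "path_in X p \<Longrightarrow> family K (\<lambda>_. p)"
proof (rule familyI)
  assume p: "path_in X p"
  then have "continuous_on (K \<times> {0..1}) (\<lambda>x. p (snd x))"
    by (intro continuous_on_compose2[of "{0..1}" p _ snd] continuous_on_snd continuous_on_id)
       (auto simp: path_in_alt)
  then show "continuous_on (K \<times> {0..1}) (\<lambda>(z, t). p t)" by (simp add: case_prod_beta)
qed (auto simp: path_in_alt)

lemma family_comp:
  assumes "family K F" "continuous_on L g" "g ` L \<subseteq> K"
  shows "family L (\<lambda>w. F (g w))"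
proof (rule familyI)
  have "continuous_on (L \<times> {0..1::real}) (\<lambda>p. (g (fst p), snd p))"
    by (intro continuous_on_Pair continuous_on_compose2[OF assms(2)] continuous_on_fst continuous_on_snd
        continuous_on_id) auto
  then have "continuous_on (L \<times> {0..1}) (\<lambda>p. (\<lambda>(z, t). F z t) (g (fst p), snd p))"
    by (rule continuous_on_compose2[where t = "K \<times> {0..1}", rotated])
       (use assms in \<open>auto simp: family_def\<close>)
  then show "continuous_on (L \<times> {0..1}) (\<lambda>(w, t). F (g w) t)" by (simp add: case_prod_beta)
qed (use assms in \<open>auto simp: family_def path_in_alt\<close>)

lemma family_mono: "family K F \<Longrightarrow> L \<subseteq> K \<Longrightarrow> family L F"
  using family_comp[of K F L "\<lambda>x. x"] by auto

lemma family_reversepath: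
  assumes "family K F"
  shows "family K (\<lambda>z. reversepath (F z))"
proof (rule familyI)
  have "continuous_on (K \<times> {0..1::real}) (\<lambda>p. (fst p, 1 - snd p))"
    by (intro continuous_intros)
  then have "continuous_on (K \<times> {0..1}) (\<lambda>p. (\<lambda>(z, t). F z t) (fst p, 1 - snd p))"
    by (rule continuous_on_compose2[where t = "K \<times> {0..1}", rotated])
       (use assms in \<open>auto simp: family_def\<close>)
  then show "continuous_on (K \<times> {0..1}) (\<lambda>(w, t). reversepath (F w) t)"
    by (simp add: case_prod_beta reversepath_def)
qed (use assms in \<open>auto simp: family_def path_in_alt reversepath_def\<close>)

lemma family_join:
  assumes F: "family K F" and G: "family K G"
    and e: "\<And>z. z \<in> K \<Longrightarrow> pathfinish (F z) = pathstart (G z)"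
  shows "family K (\<lambda>z. F z +++ G z)"
proof (rule familyI)
  let ?h = "snd :: 'b \<times> real \<Rightarrow> real"
  have "continuous_on {p \<in> K \<times> {0..1}. snd p \<le> (1/2::real)} (\<lambda>p. (fst p, 2 * snd p))"
    by (intro continuous_intros)
  then have 1: "continuous_on {p \<in> K \<times> {0..1}. snd p \<le> (1/2::real)} (\<lambda>p. (\<lambda>(z, t). F z t) (fst p, 2 * snd p))"
    by (rule continuous_on_compose2[where t = "K \<times> {0..1}", rotated])
       (use F in \<open>auto simp: family_def\<close>)
  have "continuous_on {p \<in> K \<times> {0..1}. (1/2::real) \<le> snd p} (\<lambda>p. (fst p, 2 * snd p - 1))"
    by (intro continuous_intros)
  then have 2: "continuous_on {p \<in> K \<times> {0..1}. (1/2::real) \<le> snd p} (\<lambda>p. (\<lambda>(z, t). G z t) (fst p, 2 * snd p - 1))"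
    by (rule continuous_on_compose2[where t = "K \<times> {0..1}", rotated])
       (use G in \<open>auto simp: family_def\<close>)
  have "continuous_on (K \<times> {0..1}) (\<lambda>p. if snd p \<le> 1/2 then (\<lambda>(z, t). F z t) (fst p, 2 * snd p)
      else (\<lambda>(z, t). G z t) (fst p, 2 * snd p - 1))"
    using 1 2 continuous_on_snd[OF continuous_on_id]
  proof (rule continuous_on_cases_le)
    fix p :: "'b \<times> real" assume p: "p \<in> K \<times> {0..1}" "snd p = 1/2"
    then have "2 * snd p = 1" "2 * snd p - 1 = 0" by auto
    then show "(\<lambda>(z, t). F z t) (fst p, 2 * snd p) = (\<lambda>(z, t). G z t) (fst p, 2 * snd p - 1)"
      using e p(1) by (auto simp: pathfinish_def pathstart_def)
  qed
  then show "continuous_on (K \<times> {0..1}) (\<lambda>(z, t). (F z +++ G z) t)"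
    by (simp add: case_prod_beta joinpaths_def cong: if_cong)
next
  fix z and t :: real assume z: "z \<in> K" "t \<in> {0..1}"
  then have "path_in X (F z +++ G z)" using F G e[of z] by (simp add: family_def)
  then show "(F z +++ G z) t \<in> X" using z(2) by (simp add: path_in_alt)
qed

lemma continuous_on_d:
  assumes "continuous_on K f" "continuous_on K g" "f ` K \<subseteq> X" "g ` K \<subseteq> X"
  shows "continuous_on K (\<lambda>z. d (f z) (g z))"
  unfolding continuous_on_topological
proof (intro ballI allI impI)
  fix z and B :: "real set" assume z: "z \<in> K" and B: "open B" "d (f z) (g z) \<in> B"
  obtain \<epsilon> where \<epsilon>: "\<epsilon> > 0" "ball (d (f z) (g z)) \<epsilon> \<subseteq> B" using B open_contains_ball by blast
  obtain U where U: "open U" "z \<in> U" "\<And>y. y \<in> K \<inter> U \<Longrightarrow> d (f z) (f y) < \<epsilon> / 2"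
    using continuous_on_iff_d[OF assms(3)] assms(1) z \<epsilon>(1) by (metis half_gt_zero)
  obtain V where V: "open V" "z \<in> V" "\<And>y. y \<in> K \<inter> V \<Longrightarrow> d (g z) (g y) < \<epsilon> / 2"
    using continuous_on_iff_d[OF assms(4)] assms(2) z \<epsilon>(1) by (metis half_gt_zero)
  have "d (f y) (g y) \<in> B" if y: "y \<in> K" "y \<in> U \<inter> V" for y
  proof -
    have X: "f z \<in> X" "g z \<in> X" "f y \<in> X" "g y \<in> X" using assms y z by auto
    have "\<bar>d (f z) (g z) - d (f y) (g y)\<bar> < \<epsilon>"
      using triangle[of "f z" "f y" "g z"] triangle[of "f y" "g y" "g z"]
        triangle[of "f y" "f z" "g y"] triangle[of "f z" "g z" "g y"] X
        commute[of "f y" "f z"] commute[of "g y" "g z"] U(3)[of y] V(3)[of y] y by fastforce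
    then show ?thesis using \<epsilon>(2) by (auto simp: dist_real_def)
  qed
  then show "\<exists>A. open A \<and> z \<in> A \<and> (\<forall>y\<in>K. y \<in> A \<longrightarrow> d (f y) (g y) \<in> B)"
    using U V by (intro exI[of _ "U \<inter> V"]) auto
qed

text \<open>The ambient type is not assumed to be Hausdorff, so the coincidence set is obtained as
  the zero set of the metric.\<close>

lemma closed_agree:
  assumes "closed K" "continuous_on K f" "continuous_on K g" "f ` K \<subseteq> X" "g ` K \<subseteq> X"
  shows "closed {z \<in> K. f z = g z}"
proof -
  have "closed {z \<in> K. d (f z) (g z) = 0}"
    using continuous_on_d[OF assms(2-5)] assms(1) by (rule continuous_closed_preimage_constant)
  also have "{z \<in> K. d (f z) (g z) = 0} = {z \<in> K. f z = g z}"
    using assms(4,5) by (auto simp: image_subset_iff)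
  finally show ?thesis .
qed

text \<open>A code of a homotopy between loops at \<open>x0\<close>, described by the values on the
  four sides of the square. Pointwise equations are used because they are closed conditions on the
  code and on the two loops.\<close>

definition hcode :: "(nat \<Rightarrow> nat) \<Rightarrow> (real \<Rightarrow> 'a) \<Rightarrow> (real \<Rightarrow> 'a) \<Rightarrow> bool" where
  "hcode w p q \<longleftrightarrow> w \<in> codes \<and> (\<forall>t\<in>{0..1}. decode (w, (0, t)) = p t \<and> decode (w, (1, t)) = q t \<and>
     decode (w, (t, 0)) = x0 \<and> decode (w, (t, 1)) = x0)"

lemma cl_eq_iff_hcode:
  assumes p: "loop p" and q: "loop q"
  shows "cl p = cl q \<longleftrightarrow> (\<exists>w. hcode w p q)"
proof -
  have pe: "p 0 = x0" "p 1 = x0" using p by (auto simp: loop_def pathstart_def pathfinish_def)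
  have "cl p = cl q \<longleftrightarrow> homotopic_paths X p q" using p cl_eq_iff by (auto simp: loop_def)
  also have "\<dots> \<longleftrightarrow> (\<exists>w. hcode w p q)"
  proof
    assume "homotopic_paths X p q"
    then obtain h where h: "continuous_on unit_square h" "h ` unit_square \<subseteq> X"
      "\<forall>x\<in>{0..1}. h (0, x) = p x" "\<forall>x\<in>{0..1}. h (1, x) = q x"
      "\<forall>t\<in>{0..1}. pathstart (h \<circ> Pair t) = pathstart p \<and> pathfinish (h \<circ> Pair t) = pathfinish p"
      unfolding homotopic_paths by (auto simp: image_subset_iff_funcset)
    obtain w where w: "w \<in> codes" "\<And>p. p \<in> unit_square \<Longrightarrow> decode (w, p) = h p"
      using decode_surj[OF h(1,2)] by metis
    have "hcode w p q"
      unfolding hcode_def using w h pe by (auto simp: pathstart_def pathfinish_def)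
    then show "\<exists>w. hcode w p q" by blast
  next
    assume "\<exists>w. hcode w p q"
    then obtain w where w: "hcode w p q" by blast
    then have wc: "w \<in> codes" by (simp add: hcode_def)
    have "continuous_on unit_square (\<lambda>p. decode (w, p))"
      by (intro continuous_on_compose2[OF continuous_decode] continuous_on_Pair continuous_on_const continuous_on_id)
         (use wc in auto)
    then show "homotopic_paths X p q"
      unfolding homotopic_paths
      using w wc decode(1)[OF wc] pe
      by (intro exI[of _ "\<lambda>p. decode (w, p)"])
         (auto simp: o_def hcode_def pathstart_def pathfinish_def)
  qed
  finally show ?thesis .
qed

lemma continuous_on_decode_slice:
  assumes "continuous_on K g" "g ` K \<subseteq> codes" "p \<in> unit_square"
  shows "continuous_on K (\<lambda>z. decode (g z, p))"
proof -
  have "continuous_on K (\<lambda>z. (g z, p))"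
    using assms(1) continuous_on_const by (rule continuous_on_Pair)
  then show ?thesis
    by (rule continuous_on_compose2[OF continuous_decode]) (use assms in auto)
qed

lemma closed_hcode:
  assumes "closed K" "family K F" "family K G" "continuous_on K g"
  shows "closed {z \<in> K. hcode (g z) (F z) (G z)}"
proof -
  \<comment> \<open>Decoding is continuous on \<open>codes\<close> only, so the parameters are first
    restricted to the closed set that is mapped there.\<close>
  define L where "L = K \<inter> g -` codes"
  have L: "closed L" unfolding L_def
    using assms(4,1) closed_codes by (rule continuous_closed_preimage)
  have g: "continuous_on L g" "g ` L \<subseteq> codes"
    using assms(4) by (auto simp: L_def intro: continuous_on_subset)
  have D: "continuous_on L (\<lambda>z. decode (g z, p))" "(\<lambda>z. decode (g z, p)) ` L \<subseteq> X" if "p \<in> unit_square" for p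
    using continuous_on_decode_slice[OF g that] decode(1) g(2) that by auto
  have FG: "continuous_on L (\<lambda>z. F z t)" "continuous_on L (\<lambda>z. G z t)"
    "(\<lambda>z. F z t) ` L \<subseteq> X" "(\<lambda>z. G z t) ` L \<subseteq> X" if "t \<in> {0..1}" for t
    using assms(2,3)[THEN family_slice, OF that] assms(2,3) that
    by (auto simp: L_def family_def path_in_alt intro: continuous_on_subset)
  have 1: "closed {z \<in> L. decode (g z, (0, t)) = F z t}" if "t \<in> {0..1}" for t
    using that by (intro closed_agree L D FG) auto
  have 2: "closed {z \<in> L. decode (g z, (1, t)) = G z t}" if "t \<in> {0..1}" for t
    using that by (intro closed_agree L D FG) auto
  have 3: "closed {z \<in> L. decode (g z, (t, u)) = x0}" if "t \<in> {0..1}" "u \<in> {0..1}" for t u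
    using that x0 by (intro closed_agree L D continuous_on_const) auto
  have "closed (L \<inter> (\<Inter>t\<in>{0..1}. {z \<in> L. decode (g z, (0, t)) = F z t} \<inter> {z \<in> L. decode (g z, (1, t)) = G z t} \<inter>
    {z \<in> L. decode (g z, (t, 0)) = x0} \<inter> {z \<in> L. decode (g z, (t, 1)) = x0}))"
    by (intro closed_Int closed_INT ballI L 1 2 3) auto
  also have "\<dots> = {z \<in> K. hcode (g z) (F z) (G z)}"
    by (auto simp: L_def hcode_def)
  finally show ?thesis .
qed

section \<open>Closure properties of analytic sets of homotopy classes\<close>

definition loop_family :: "'t::topological_space set \<Rightarrow> ('t \<Rightarrow> real \<Rightarrow> 'a) \<Rightarrow> bool" where
  "loop_family K F \<longleftrightarrow> family K F \<and> (\<forall>z\<in>K. loop (F z))"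

text \<open>Analyticity is stated for sets of classes: a closed set of parameters has to reach at
  least one representative of each class, not all loops in it. A closed domain is used instead of
  the whole Baire space, so the empty set needs no exception.\<close>

definition analytic :: "(real \<Rightarrow> 'a) set set \<Rightarrow> bool" where
  "analytic S \<longleftrightarrow> (\<exists>(K :: (nat \<Rightarrow> nat) set) F. closed K \<and> loop_family K F \<and> S = (\<lambda>z. cl (F z)) ` K)"

lemma analyticE:
  assumes "analytic S"
  obtains K :: "(nat \<Rightarrow> nat) set" and F where "closed K" "loop_family K F" "S = (\<lambda>z. cl (F z)) ` K"
  using assms unfolding analytic_def by blast

lemma analyticI:
  assumes "closed (K :: (nat \<Rightarrow> nat) set)" "loop_family K F" "S = (\<lambda>z. cl (F z)) ` K"
  shows "analytic S"
  using assms unfolding analytic_def by blast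

lemma loop_family_comp:
  "loop_family K F \<Longrightarrow> continuous_on L g \<Longrightarrow> g ` L \<subseteq> K \<Longrightarrow> loop_family L (\<lambda>w. F (g w))"
  by (auto simp: loop_family_def intro: family_comp)

lemma loop_family_join: "loop_family K F \<Longrightarrow> loop_family K G \<Longrightarrow> loop_family K (\<lambda>z. F z +++ G z)"
  by (auto simp: loop_family_def loop_join intro!: family_join) (simp add: loop_def)

lemma loop_family_reversepath: "loop_family K F \<Longrightarrow> loop_family K (\<lambda>z. reversepath (F z))"
  by (auto simp: loop_family_def loop_reversepath intro: family_reversepath)

lemma loop_family_const: "loop p \<Longrightarrow> loop_family K (\<lambda>_. p)"
  by (auto simp: loop_family_def loop_def intro: family_const)

lemma analytic_one: "analytic {\<one>\<^bsub>\<G>\<^esub>}"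
  by (rule analyticI[OF closed_UNIV loop_family_const[OF loop_const]]) (auto simp: one_Pi)

lemma analytic_image:
  assumes "analytic S" "\<And>(K :: (nat \<Rightarrow> nat) set) F. loop_family K F \<Longrightarrow> loop_family K (\<lambda>z. \<Phi> (F z))"
    "\<And>p. loop p \<Longrightarrow> cl (\<Phi> p) = \<phi> (cl p)"
  shows "analytic (\<phi> ` S)"
proof -
  obtain K :: "(nat \<Rightarrow> nat) set" and F where K: "closed K" "loop_family K F" "S = (\<lambda>z. cl (F z)) ` K"
    using assms(1) by (rule analyticE)
  show ?thesis
    by (rule analyticI[OF K(1) assms(2)[OF K(2)]])
       (use K assms(3) in \<open>auto simp: loop_family_def image_image intro!: image_cong\<close>)
qed

lemma analytic_image2:
  assumes "analytic S" "analytic T"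
    "\<And>(K :: (nat \<Rightarrow> nat) set) F G. loop_family K F \<Longrightarrow> loop_family K G \<Longrightarrow> loop_family K (\<lambda>z. \<Phi> (F z) (G z))"
    "\<And>p q. loop p \<Longrightarrow> loop q \<Longrightarrow> cl (\<Phi> p q) = \<phi> (cl p) (cl q)"
  shows "analytic {\<phi> x y |x y. x \<in> S \<and> y \<in> T}"
proof -
  obtain K :: "(nat \<Rightarrow> nat) set" and F where K: "closed K" "loop_family K F" "S = (\<lambda>z. cl (F z)) ` K"
    using assms(1) by (rule analyticE)
  obtain L :: "(nat \<Rightarrow> nat) set" and G where L: "closed L" "loop_family L G" "T = (\<lambda>z. cl (G z)) ` L"
    using assms(2) by (rule analyticE)
  define M where "M = part 0 -` K \<inter> part 1 -` L"
  have M: "closed M" unfolding M_def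
    using K L by (intro closed_Int closed_vimage continuous_on_part) auto
  have F: "loop_family M (\<lambda>z. F (part 0 z))"
    by (rule loop_family_comp[OF K(2) continuous_on_part]) (auto simp: M_def)
  have G: "loop_family M (\<lambda>z. G (part 1 z))"
    by (rule loop_family_comp[OF L(2) continuous_on_part]) (auto simp: M_def)
  show ?thesis
  proof (rule analyticI[OF M assms(3)[OF F G]], intro subset_antisym subsetI)
    fix x assume "x \<in> {\<phi> x y |x y. x \<in> S \<and> y \<in> T}"
    then obtain z w where zw: "z \<in> K" "w \<in> L" "x = \<phi> (cl (F z)) (cl (G w))" using K L by auto
    define v where "v = merge (\<lambda>n. if n = 0 then z else w)"
    have "v \<in> M" using zw by (simp add: M_def v_def)
    moreover have "x = cl (\<Phi> (F (part 0 v)) (G (part 1 v)))"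
      using zw K(2) L(2) assms(4) by (simp add: v_def loop_family_def)
    ultimately show "x \<in> (\<lambda>z. cl (\<Phi> (F (part 0 z)) (G (part 1 z)))) ` M" by blast
  next
    fix x assume "x \<in> (\<lambda>z. cl (\<Phi> (F (part 0 z)) (G (part 1 z)))) ` M"
    then obtain v where v: "v \<in> M" "x = cl (\<Phi> (F (part 0 v)) (G (part 1 v)))" by auto
    then have "x = \<phi> (cl (F (part 0 v))) (cl (G (part 1 v)))"
      using F G assms(4) by (simp add: loop_family_def)
    then show "x \<in> {\<phi> x y |x y. x \<in> S \<and> y \<in> T}" using v(1) K L by (auto simp: M_def)
  qed
qed

text \<open>Every loop is the left side of a square that does not depend on the first coordinate.
  Hence the codes whose two left corners are \<open>x0\<close> parametrise all loops.\<close>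

lemma analytic_carrier: "analytic (carrier \<G>)"
proof -
  define K where "K = {z \<in> codes. decode (z, (0, 0)) = x0} \<inter> {z \<in> codes. decode (z, (0, 1)) = x0}"
  define F where "F z t = decode (z, (0, t))" for z and t :: real
  have "closed K" unfolding K_def
    using x0 decode(1)
    by (intro closed_Int closed_agree closed_codes continuous_on_decode_slice continuous_on_id continuous_on_const) auto
  moreover have fam: "loop_family K F"
  proof -
    have "family K F"
    proof (rule familyI)
      have "continuous_on (K \<times> {0..1::real}) (\<lambda>p. (fst p, (0::real, snd p)))" by (intro continuous_intros)
      then have "continuous_on (K \<times> {0..1}) (\<lambda>p. decode (fst p, (0, snd p)))"
        by (rule continuous_on_compose2[OF continuous_decode]) (auto simp: K_def)
      then show "continuous_on (K \<times> {0..1}) (\<lambda>(z, t). F z t)" by (simp add: F_def case_prod_beta)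
    qed (auto simp: F_def K_def decode(1))
    then show ?thesis
      by (auto simp: loop_family_def family_def loop_def F_def K_def pathstart_def pathfinish_def)
  qed
  moreover have "carrier \<G> = (\<lambda>z. cl (F z)) ` K"
  proof (rule Set.set_eqI, rule iffI)
    fix x assume "x \<in> carrier \<G>"
    then obtain p where p: "loop p" "x = cl p" by (auto simp: carrier_Pi)
    have "continuous_on unit_square (\<lambda>x. p (snd x))"
      by (intro continuous_on_compose2[of "{0..1}" p _ snd] continuous_on_snd continuous_on_id)
         (use p in \<open>auto simp: path_in_alt loop_def\<close>)
    moreover have "(\<lambda>x. p (snd x)) ` unit_square \<subseteq> X" using p by (auto simp: path_in_alt loop_def)
    ultimately obtain z where z: "z \<in> codes" "\<And>q. q \<in> unit_square \<Longrightarrow> decode (z, q) = p (snd q)"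
      using decode_surj by metis
    have "z \<in> K" using z p by (auto simp: K_def loop_def pathstart_def pathfinish_def)
    moreover have "cl (F z) = cl p"
    proof (rule cl_eqI[OF homotopic_paths_sym[OF homotopic_paths_eq]])
      show "path p" "path_image p \<subseteq> X" using p(1) by (auto simp: loop_def path_in_def)
      show "p t = F z t" if "t \<in> {0..1}" for t using z(2)[of "(0, t)"] that by (simp add: F_def)
    qed
    ultimately show "x \<in> (\<lambda>z. cl (F z)) ` K" using p by blast
  next
    fix x assume "x \<in> (\<lambda>z. cl (F z)) ` K"
    then show "x \<in> carrier \<G>" using fam by (auto simp: carrier_Pi loop_family_def)
  qed
  ultimately show ?thesis by (rule analyticI)
qed

text \<open>Coordinate 0 of the parameter names the set and the remaining coordinates are the
  parameter there. Since coordinate 0 is locally constant, closedness and continuity can be checked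
  for each index separately.\<close>

lemma analytic_UN:
  assumes "\<And>n::nat. analytic (S n)"
  shows "analytic (\<Union>n. S n)"
proof -
  have "\<forall>n. \<exists>(K :: (nat \<Rightarrow> nat) set) F. closed K \<and> loop_family K F \<and> S n = (\<lambda>z. cl (F z)) ` K"
    using assms by (simp add: analytic_def)
  then obtain K :: "nat \<Rightarrow> (nat \<Rightarrow> nat) set" and F where K: "\<And>n. closed (K n)" "\<And>n. loop_family (K n) (F n)"
    "\<And>n. S n = (\<lambda>z. cl (F n z)) ` K n" by metis
  define tl where "tl z = (\<lambda>i. z (Suc i))" for z :: "nat \<Rightarrow> nat"
  have tl: "continuous_on A tl" for A unfolding tl_def by (rule continuous_on_reindex)
  define L where "L = {z. tl z \<in> K (z 0)}"
  have open0: "open {z :: nat \<Rightarrow> nat. z 0 = n}" for n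
  proof -
    have "{z :: nat \<Rightarrow> nat. z 0 = n} = cyl (\<lambda>_. n) 1" by (auto simp: cyl_def)
    then show ?thesis by simp
  qed
  have "- L = (\<Union>n. {z. z 0 = n} \<inter> tl -` (- K n))" by (auto simp: L_def)
  moreover have "open (\<Union>n. {z. z 0 = n} \<inter> tl -` (- K n))"
    using K(1) tl open0 by (intro open_UN ballI open_Int open_vimage) auto
  ultimately have cL: "closed L" by (simp add: closed_def)
  define G where "G z = F (z 0) (tl z)" for z
  have Gl: "loop (G z)" if "z \<in> L" for z using that K(2) by (auto simp: L_def G_def loop_family_def)
  have "family L G"
  proof (rule familyI)
    show GX: "G z t \<in> X" if "z \<in> L" "t \<in> {0..1}" for z t
      using Gl[OF that(1)] that by (auto simp: loop_def path_in_alt)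
    then have im: "(\<lambda>(z, t). G z t) ` (L \<times> {0..1}) \<subseteq> X" by auto
    show "continuous_on (L \<times> {0..1}) (\<lambda>(z, t). G z t)"
      unfolding continuous_on_iff_d[OF im]
    proof (intro ballI allI impI)
      fix zt and \<epsilon> :: real assume zt: "zt \<in> L \<times> {0..1::real}" and \<epsilon>: "\<epsilon> > 0"
      obtain z t where [simp]: "zt = (z, t)" and z: "z \<in> L" "t \<in> {0..1}" using zt by blast
      define n where "n = z 0"
      define M where "M = L \<inter> {z. z 0 = n}"
      have "family M (\<lambda>z. F n (tl z))"
        by (rule family_comp[OF _ tl, of "K n"]) (use K(2) in \<open>auto simp: M_def L_def loop_family_def\<close>)
      then have c: "continuous_on (M \<times> {0..1}) (\<lambda>(z, t). F n (tl z) t)"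
        and "(\<lambda>(z, t). F n (tl z) t) ` (M \<times> {0..1}) \<subseteq> X" by (auto simp: family_def path_in_alt)
      moreover have "(z, t) \<in> M \<times> {0..1}" using z by (simp add: M_def n_def)
      ultimately obtain U where U: "open U" "(z, t) \<in> U"
        "\<And>y. y \<in> M \<times> {0..1} \<inter> U \<Longrightarrow> d (F n (tl z) t) ((\<lambda>(z, t). F n (tl z) t) y) < \<epsilon>"
        using continuous_on_iff_d[of "\<lambda>(z, t). F n (tl z) t" "M \<times> {0..1}"] \<epsilon> by (metis (mono_tags, lifting) case_prod_conv)
      show "\<exists>U. open U \<and> zt \<in> U \<and> (\<forall>y\<in>L \<times> {0..1} \<inter> U. d (case zt of (z, t) \<Rightarrow> G z t) (case y of (z, t) \<Rightarrow> G z t) < \<epsilon>)"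
      proof (intro exI conjI)
        show "open (U \<inter> {z. z 0 = n} \<times> UNIV)" using U open0 by (intro open_Int open_Times) auto
        show "zt \<in> U \<inter> {z. z 0 = n} \<times> UNIV" using U by (simp add: n_def)
        show "\<forall>y\<in>L \<times> {0..1} \<inter> (U \<inter> {z. z 0 = n} \<times> UNIV).
            d (case zt of (z, t) \<Rightarrow> G z t) (case y of (z, t) \<Rightarrow> G z t) < \<epsilon>"
          using U(3) by (auto simp: G_def M_def n_def)
      qed
    qed
  qed
  then have fam: "loop_family L G" using Gl by (simp add: loop_family_def)
  show ?thesis
  proof (rule analyticI[OF cL fam], intro subset_antisym subsetI)
    fix x assume "x \<in> (\<Union>n. S n)"
    then obtain n z where z: "z \<in> K n" "x = cl (F n z)" using K(3) by auto
    have "case_nat n z \<in> L" "G (case_nat n z) = F n z"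
      using z by (auto simp: L_def tl_def G_def)
    then show "x \<in> (\<lambda>z. cl (G z)) ` L" using z by (metis image_eqI)
  qed (auto simp: K(3) L_def G_def)
qed

lemma analytic_Un: "analytic S \<Longrightarrow> analytic T \<Longrightarrow> analytic (S \<union> T)"
proof -
  assume "analytic S" "analytic T"
  then have "analytic (\<Union>n::nat. if n = 0 then S else T)" by (intro analytic_UN) auto
  also have "(\<Union>n::nat. if n = 0 then S else T) = S \<union> T" by (auto split: if_splits)
  finally show ?thesis .
qed

text \<open>Different sets may reach the same class by different representatives. A parameter
  therefore stores, for every \<open>n\<close>, a parameter of \<open>S n\<close> (in part 0) and a
  code of a homotopy from the representative for index 0 (in part 1); the compatible parameters form
  a closed set.\<close>

lemma analytic_INT:
  assumes "\<And>n::nat. analytic (S n)"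
  shows "analytic (\<Inter>n. S n)"
proof -
  have "\<forall>n. \<exists>(K :: (nat \<Rightarrow> nat) set) F. closed K \<and> loop_family K F \<and> S n = (\<lambda>z. cl (F z)) ` K"
    using assms by (simp add: analytic_def)
  then obtain K :: "nat \<Rightarrow> (nat \<Rightarrow> nat) set" and F where K: "\<And>n. closed (K n)" "\<And>n. loop_family (K n) (F n)"
    "\<And>n. S n = (\<lambda>z. cl (F n z)) ` K n" by metis
  define L where "L = (\<Inter>n. (\<lambda>z. part 0 (part n z)) -` K n)"
  have cL: "closed L" unfolding L_def
    using K(1) by (intro closed_INT ballI closed_vimage continuous_on_part_comp) auto
  have fam: "loop_family L (\<lambda>z. F n (part 0 (part n z)))" for n
    by (rule loop_family_comp[OF K(2) continuous_on_part_comp]) (auto simp: L_def)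
  define M where "M = (\<Inter>n. {z \<in> L. hcode (part 1 (part n z)) (F 0 (part 0 (part 0 z))) (F n (part 0 (part n z)))})"
  have cM: "closed M" unfolding M_def
    using fam by (intro closed_INT ballI closed_hcode cL continuous_on_part_comp) (auto simp: loop_family_def)
  have sub: "M \<subseteq> L" by (auto simp: M_def)
  have famM: "loop_family M (\<lambda>z. F 0 (part 0 (part 0 z)))"
    using fam[of 0] sub by (auto simp: loop_family_def intro: family_mono)
  show ?thesis
  proof (rule analyticI[OF cM famM], intro subset_antisym subsetI)
    fix x assume "x \<in> (\<Inter>n. S n)"
    then have "\<forall>n. \<exists>z. z \<in> K n \<and> x = cl (F n z)" using K(3) by auto
    then obtain z where z: "\<And>n. z n \<in> K n" "\<And>n. x = cl (F n (z n))" by metis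
    have l: "loop (F n (z n))" for n using z K(2) by (auto simp: loop_family_def)
    have "\<exists>w. hcode w (F 0 (z 0)) (F n (z n))" for n
      using cl_eq_iff_hcode[OF l l, of 0 n] z(2) by auto
    then obtain w where w: "\<And>n. hcode (w n) (F 0 (z 0)) (F n (z n))" by metis
    define v where "v = merge (\<lambda>n. merge (\<lambda>i. if i = 0 then z n else w n))"
    have v: "part 0 (part n v) = z n" "part 1 (part n v) = w n" for n by (simp_all add: v_def)
    have "v \<in> M" using z w by (simp add: M_def L_def v del: One_nat_def)
    then show "x \<in> (\<lambda>z. cl (F 0 (part 0 (part 0 z)))) ` M" using z(2)[of 0] v by (metis image_eqI)
  next
    fix x assume "x \<in> (\<lambda>z. cl (F 0 (part 0 (part 0 z)))) ` M"
    then obtain v where v: "v \<in> M" "x = cl (F 0 (part 0 (part 0 v)))" by auto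
    have "x \<in> S n" for n
    proof -
      have m: "part 0 (part m v) \<in> K m" for m using v(1) sub by (auto simp: L_def)
      have "hcode (part 1 (part n v)) (F 0 (part 0 (part 0 v))) (F n (part 0 (part n v)))"
        using v(1) by (auto simp: M_def)
      then have "x = cl (F n (part 0 (part n v)))"
        using cl_eq_iff_hcode[of "F 0 (part 0 (part 0 v))" "F n (part 0 (part n v))"] m K(2) v(2)
        by (auto simp: loop_family_def)
      then show ?thesis using m K(3) by blast
    qed
    then show "x \<in> (\<Inter>n. S n)" by blast
  qed
qed

text \<open>A witness consists of a parameter of \<open>S\<close> and a code of a homotopy from
  \<open>P x\<close> to the corresponding loop. This is the form in which the category argument
  receives its relation.\<close>

lemma analytic_preimage_projection:
  fixes P :: "'t::topological_space \<Rightarrow> real \<Rightarrow> 'a"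
  assumes "analytic S" "loop_family UNIV P"
  obtains R :: "('t \<times> (nat \<Rightarrow> nat)) set" where "closed R" "\<And>x. cl (P x) \<in> S \<longleftrightarrow> (\<exists>z. (x, z) \<in> R)"
proof -
  obtain K :: "(nat \<Rightarrow> nat) set" and F where K: "closed K" "loop_family K F" "S = (\<lambda>z. cl (F z)) ` K"
    using assms(1) by (rule analyticE)
  have c: "continuous_on A (\<lambda>x :: 't \<times> (nat \<Rightarrow> nat). part n (snd x))" for A n
    by (rule continuous_on_compose2[OF continuous_on_part continuous_on_snd[OF continuous_on_id]]) auto
  define L where "L = (\<lambda>x :: 't \<times> (nat \<Rightarrow> nat). part 0 (snd x)) -` K"
  have L: "closed L" unfolding L_def using K(1) c by (rule closed_vimage)
  have F: "family L (\<lambda>x. F (part 0 (snd x)))"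
    by (rule family_comp[OF _ c]) (use K(2) in \<open>auto simp: loop_family_def L_def\<close>)
  have P: "family L (\<lambda>x. P (fst x))"
    by (rule family_comp[of UNIV, OF _ continuous_on_fst[OF continuous_on_id]])
       (use assms(2) in \<open>auto simp: loop_family_def\<close>)
  define R where "R = {x \<in> L. hcode (part 1 (snd x)) (P (fst x)) (F (part 0 (snd x)))}"
  have "closed R" unfolding R_def by (rule closed_hcode[OF L P F c])
  moreover have "cl (P x) \<in> S \<longleftrightarrow> (\<exists>z. (x, z) \<in> R)" for x
  proof
    assume "cl (P x) \<in> S"
    then obtain z where z: "z \<in> K" "cl (P x) = cl (F z)" using K(3) by auto
    then obtain w where "hcode w (P x) (F z)"
      using cl_eq_iff_hcode[of "P x" "F z"] assms(2) K(2) by (auto simp: loop_family_def)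
    then have "(x, merge (\<lambda>i. if i = 0 then z else w)) \<in> R"
      using z(1) by (simp add: R_def L_def)
    then show "\<exists>z. (x, z) \<in> R" by blast
  next
    assume "\<exists>z. (x, z) \<in> R"
    then obtain z where "part 0 z \<in> K" "hcode (part 1 z) (P x) (F (part 0 z))" by (auto simp: R_def L_def)
    then show "cl (P x) \<in> S"
      using cl_eq_iff_hcode[of "P x" "F (part 0 z)"] assms(2) K(2,3) by (auto simp: loop_family_def)
  qed
  ultimately show ?thesis by (rule that)
qed

end

section \<open>Normal subgroups of the three series\<close>

context group begin

lemma normal_Inter:
  assumes "\<N> \<noteq> {}" "\<And>N. N \<in> \<N> \<Longrightarrow> N \<lhd> G"
  shows "\<Inter>\<N> \<lhd> G"
proof (rule normal_invI)
  show "subgroup (\<Inter>\<N>) G"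
    using assms by (intro subgroups_Inter) (auto simp: normal_imp_subgroup)
  show "g \<otimes> h \<otimes> inv g \<in> \<Inter>\<N>" if "g \<in> carrier G" "h \<in> \<Inter>\<N>" for g h
    using assms(2) that normal.inv_op_closed2 by fastforce
qed

lemma carrier_normal: "carrier G \<lhd> G"
  by (rule normal_invI) (auto simp: subgroup_self)

text \<open>The intersections range over sets of elements of the index type. For well-orders on the
  naturals they are countable, which is the closure that analytic sets offer.\<close>

lemma derived_series_induct:
  fixes r :: "'i rel"
  assumes r: "Well_order r" and carrier: "P (carrier G)"
    and derived: "\<And>N. P N \<Longrightarrow> P (derived G N)"
    and Inter: "\<And>J (f :: 'i \<Rightarrow> 'a set). J \<noteq> {} \<Longrightarrow> (\<And>j. j \<in> J \<Longrightarrow> P (f j)) \<Longrightarrow> P (\<Inter> (f ` J))"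
  shows "P (derived_series G r)"
proof -
  have anti: "antisym r" and wf: "wf (r - Id)"
    using r by (simp_all add: well_order_on_def linear_order_on_def partial_order_on_def)
  have step: "P (derived_step G r f J)" if f: "\<And>j. j \<in> J \<Longrightarrow> P (f j)" for f J
  proof -
    have "(THE m. m \<in> J \<and> (\<forall>j\<in>J. (j, m) \<in> r)) \<in> J" if "\<exists>m\<in>J. \<forall>j\<in>J. (j, m) \<in> r"
    proof -
      have "\<exists>!m. m \<in> J \<and> (\<forall>j\<in>J. (j, m) \<in> r)" using that by (blast intro: antisymD[OF anti])
      from theI'[OF this] show ?thesis by (rule conjunct1)
    qed
    then show ?thesis
      unfolding derived_step_def using carrier derived f Inter by simp
  qed
  have "P (derived_term G r a)" for a
    using wf
  proof (induction a rule: wf_induct_rule)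
    case (less a)
    show ?case
      unfolding derived_term_unfold[OF r, of G a] by (rule step, rule less) (auto simp: underS_def)
  qed
  then show ?thesis unfolding derived_series_def by (intro step) auto
qed

lemma conj_mult:
  "g \<in> carrier G \<Longrightarrow> x \<in> carrier G \<Longrightarrow> y \<in> carrier G \<Longrightarrow>
    (g \<otimes> x \<otimes> inv g) \<otimes> (g \<otimes> y \<otimes> inv g) = g \<otimes> (x \<otimes> y) \<otimes> inv g"
proof -
  assume *: "g \<in> carrier G" "x \<in> carrier G" "y \<in> carrier G"
  then have "inv g \<otimes> (g \<otimes> (y \<otimes> inv g)) = y \<otimes> inv g" by (simp flip: m_assoc)
  with * show ?thesis by (simp add: m_assoc)
qed

lemma conj_inv:
  "g \<in> carrier G \<Longrightarrow> x \<in> carrier G \<Longrightarrow> inv (g \<otimes> x \<otimes> inv g) = g \<otimes> inv x \<otimes> inv g"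
  by (simp add: inv_mult_group m_assoc)

lemma conj_pow:
  "g \<in> carrier G \<Longrightarrow> x \<in> carrier G \<Longrightarrow> (g \<otimes> x \<otimes> inv g) [^] (n::nat) = g \<otimes> x [^] n \<otimes> inv g"
  by (induction n) (simp_all add: conj_mult)

text \<open>A conjugate of a commutator is the commutator of the conjugates, so the generating set
  is invariant under conjugation.\<close>

lemma commutator_subgroup_normal:
  assumes "H \<lhd> G" "K \<lhd> G"
  shows "commutator_subgroup G H K \<lhd> G"
  unfolding commutator_subgroup_def
proof (rule normal_generateI)
  interpret H: normal H G + K: normal K G by fact+
  show "{h \<otimes> k \<otimes> inv h \<otimes> inv k |h k. h \<in> H \<and> k \<in> K} \<subseteq> carrier G" by auto
  fix x g assume "x \<in> {h \<otimes> k \<otimes> inv h \<otimes> inv k |h k. h \<in> H \<and> k \<in> K}" and g: "g \<in> carrier G"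
  then obtain h k where hk: "h \<in> H" "k \<in> K" "x = h \<otimes> k \<otimes> inv h \<otimes> inv k" by auto
  then have hkc: "h \<in> carrier G" "k \<in> carrier G" by auto
  have "g \<otimes> x \<otimes> inv g = (g \<otimes> h \<otimes> inv g) \<otimes> (g \<otimes> k \<otimes> inv g) \<otimes> inv (g \<otimes> h \<otimes> inv g) \<otimes> inv (g \<otimes> k \<otimes> inv g)"
    using g hkc by (simp only: conj_inv conj_mult hk inv_closed m_closed)
  then show "g \<otimes> x \<otimes> inv g \<in> {h \<otimes> k \<otimes> inv h \<otimes> inv k |h k. h \<in> H \<and> k \<in> K}"
    using hk g H.inv_op_closed2 K.inv_op_closed2 by blast
qed

lemma lower_central_normal: "lower_central G n \<lhd> G"
  by (induction n) (auto intro: carrier_normal commutator_subgroup_normal)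

lemma normal_closure_normal:
  assumes "S \<subseteq> carrier G"
  shows "normal_closure G S \<lhd> G"
  unfolding normal_closure_def using assms carrier_normal by (intro normal_Inter) auto

lemma subset_normal_closure: "S \<subseteq> normal_closure G S"
  by (auto simp: normal_closure_def)

lemma normal_closure_minimal: "N \<lhd> G \<Longrightarrow> S \<subseteq> N \<Longrightarrow> normal_closure G S \<subseteq> N"
  by (auto simp: normal_closure_def)

text \<open>A conjugate of an \<open>n\<close>-th power is an \<open>n\<close>-th power, so the
  generated subgroup is already normal. This replaces an intersection over all normal subgroups by a
  countable construction.\<close>

lemma power_subgroup_eq_generate:
  "power_subgroup G n = generate G {x [^] n |x. x \<in> carrier G}"
proof
  let ?S = "{x [^] n |x. x \<in> carrier G}"
  have "generate G ?S \<lhd> G"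
  proof (rule normal_generateI)
    fix h g assume h: "h \<in> ?S" and g: "g \<in> carrier G"
    from h obtain x where x: "x \<in> carrier G" "h = x [^] n" by auto
    then have "g \<otimes> h \<otimes> inv g = (g \<otimes> x \<otimes> inv g) [^] n" using g by (simp add: conj_pow)
    moreover have "g \<otimes> x \<otimes> inv g \<in> carrier G" using g x by simp
    ultimately show "g \<otimes> h \<otimes> inv g \<in> ?S" by blast
  qed auto
  then show "power_subgroup G n \<subseteq> generate G ?S"
    unfolding power_subgroup_def by (intro normal_closure_minimal) (auto intro: generate.incl)
  have "subgroup (power_subgroup G n) G"
    unfolding power_subgroup_def by (intro normal_imp_subgroup normal_closure_normal) auto
  then show "generate G ?S \<subseteq> power_subgroup G n"
    using subset_normal_closure[of ?S] unfolding power_subgroup_def by (intro generate_subgroup_incl) auto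
qed

lemma power_subgroup_normal: "power_subgroup G n \<lhd> G"
  unfolding power_subgroup_def by (intro normal_closure_normal) auto

primrec words_of :: "'a set \<Rightarrow> nat \<Rightarrow> 'a set" where
  "words_of T 0 = {\<one>}"
| "words_of T (Suc n) = {x \<otimes> y |x y. x \<in> words_of T n \<and> y \<in> T}"

text \<open>The generated subgroup becomes a countable union of iterated product sets, to which the
  closure properties of analytic sets apply.\<close>

lemma generate_eq_words_of:
  assumes S: "S \<subseteq> carrier G"
  shows "generate G S = (\<Union>n. words_of (S \<union> m_inv G ` S) n)" (is "_ = (\<Union>n. words_of ?T n)")
proof
  have T: "?T \<subseteq> carrier G" using S by auto
  have wc: "words_of ?T n \<subseteq> carrier G" for n by (induction n) (use T in auto)
  have "x \<in> words_of ?T m \<Longrightarrow> y \<in> words_of ?T n \<Longrightarrow> x \<otimes> y \<in> words_of ?T (m + n)" for x y m n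
  proof (induction n arbitrary: y)
    case 0
    moreover have "x \<in> carrier G" using wc 0 by blast
    ultimately show ?case by simp
  next
    case (Suc n)
    then obtain u v where uv: "u \<in> words_of ?T n" "v \<in> ?T" "y = u \<otimes> v" by auto
    then have "x \<otimes> y = (x \<otimes> u) \<otimes> v" using wc T Suc.prems by (auto simp: m_assoc subset_iff)
    then show ?case using Suc uv by (auto simp del: Un_iff)
  qed
  then have mult: "x \<otimes> y \<in> (\<Union>n. words_of ?T n)" if "x \<in> (\<Union>n. words_of ?T n)" "y \<in> (\<Union>n. words_of ?T n)" for x y
    using that by blast
  have T1: "x \<in> words_of ?T 1" if "x \<in> ?T" for x
    using that T by (auto simp del: Un_iff intro!: exI[of _ \<one>] exI[of _ x])
  show "generate G S \<subseteq> (\<Union>n. words_of ?T n)"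
  proof
    fix x assume "x \<in> generate G S"
    then show "x \<in> (\<Union>n. words_of ?T n)"
    proof induction
      case one
      have "\<one> \<in> words_of ?T 0" by simp
      then show ?case by blast
    next
      case (incl h)
      then show ?case using T1[of h] by blast
    next
      case (inv h)
      then show ?case using T1[of "inv h"] by blast
    qed (rule mult)
  qed
  have "words_of ?T n \<subseteq> generate G S" for n
  proof (induction n)
    case (Suc n)
    have "?T \<subseteq> generate G S" by (auto intro: generate.incl generate.inv)
    with Suc show ?case by (auto simp del: Un_iff intro!: generate.eng)
  qed (auto intro: generate.one)
  then show "(\<Union>n. words_of ?T n) \<subseteq> generate G S" by blast
qed

end

section \<open>Analyticity of the subgroups in question\<close>

context polish_based_space begin

lemma analytic_subset_carrier: "analytic S \<Longrightarrow> S \<subseteq> carrier \<G>"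
  by (auto simp: analytic_def loop_family_def carrier_Pi)

lemma analytic_mult:
  assumes "analytic S" "analytic T"
  shows "analytic {x \<otimes>\<^bsub>\<G>\<^esub> y |x y. x \<in> S \<and> y \<in> T}"
  using assms by (rule analytic_image2[where \<Phi> = "(+++)"]) (auto intro: loop_family_join simp: mult_Pi)

lemma analytic_inv: "analytic S \<Longrightarrow> analytic (m_inv \<G> ` S)"
  by (rule analytic_image[where \<Phi> = reversepath]) (auto intro: loop_family_reversepath simp: inv_Pi)

lemma analytic_commutators:
  assumes "analytic S" "analytic T"
  shows "analytic {x \<otimes>\<^bsub>\<G>\<^esub> y \<otimes>\<^bsub>\<G>\<^esub> inv\<^bsub>\<G>\<^esub> x \<otimes>\<^bsub>\<G>\<^esub> inv\<^bsub>\<G>\<^esub> y |x y. x \<in> S \<and> y \<in> T}"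
  using assms
  by (rule analytic_image2[where \<Phi> = "\<lambda>p q. ((p +++ q) +++ reversepath p) +++ reversepath q"])
     (auto intro!: loop_family_join loop_family_reversepath
       simp: mult_Pi inv_Pi loop_join loop_reversepath)

lemma analytic_powers: "analytic {x [^]\<^bsub>\<G>\<^esub> (n::nat) |x. x \<in> carrier \<G>}"
proof -
  define \<Phi> :: "nat \<Rightarrow> (real \<Rightarrow> 'a) \<Rightarrow> real \<Rightarrow> 'a" where "\<Phi> = rec_nat (\<lambda>_ _. x0) (\<lambda>n f p. f p +++ p)"
  have \<Phi>: "\<Phi> 0 p = (\<lambda>_. x0)" "\<Phi> (Suc n) p = \<Phi> n p +++ p" for n p by (simp_all add: \<Phi>_def)
  have l: "loop (\<Phi> n p)" if "loop p" for n p
    by (induction n) (use that in \<open>auto simp: \<Phi> loop_const loop_join\<close>)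
  have "analytic ((\<lambda>x. x [^]\<^bsub>\<G>\<^esub> n) ` carrier \<G>)"
  proof (rule analytic_image[OF analytic_carrier, where \<Phi> = "\<Phi> n"])
    show "loop_family K (\<lambda>z. \<Phi> n (F z))" if "loop_family K F" for K :: "(nat \<Rightarrow> nat) set" and F
      by (induction n) (use that in \<open>auto simp: \<Phi> intro: loop_family_const loop_const loop_family_join\<close>)
    show "cl (\<Phi> n p) = cl p [^]\<^bsub>\<G>\<^esub> n" if "loop p" for p
      by (induction n) (use that l in \<open>auto simp: \<Phi> one_Pi simp flip: mult_Pi\<close>)
  qed
  then show ?thesis by (simp add: image_def Setcompr_eq_image)
qed

lemma analytic_generate:
  assumes "analytic S"
  shows "analytic (generate \<G> S)"
proof -
  have "analytic (Pi.words_of (S \<union> m_inv \<G> ` S) n)" for n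
  proof (induction n)
    case (Suc n)
    show ?case unfolding Pi.words_of.simps
      by (intro analytic_mult Suc analytic_Un analytic_inv assms)
  qed (simp add: analytic_one)
  then show ?thesis
    unfolding Pi.generate_eq_words_of[OF analytic_subset_carrier[OF assms]] by (rule analytic_UN)
qed

lemma analytic_derived:
  assumes "analytic S"
  shows "analytic (derived \<G> S)"
proof -
  have "derived_set \<G> S = {x \<otimes>\<^bsub>\<G>\<^esub> y \<otimes>\<^bsub>\<G>\<^esub> inv\<^bsub>\<G>\<^esub> x \<otimes>\<^bsub>\<G>\<^esub> inv\<^bsub>\<G>\<^esub> y |x y. x \<in> S \<and> y \<in> S}" by auto
  then show ?thesis
    unfolding derived_def using assms by (auto intro!: analytic_generate analytic_commutators)
qed

lemma derived_series_normal_analytic: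
  fixes r :: "nat rel"
  assumes "Well_order r"
  shows "derived_series \<G> r \<lhd> \<G> \<and> analytic (derived_series \<G> r)"
  using assms
proof (rule Pi.derived_series_induct)
  show "carrier \<G> \<lhd> \<G> \<and> analytic (carrier \<G>)"
    using Pi.carrier_normal analytic_carrier by simp
  show "derived \<G> N \<lhd> \<G> \<and> analytic (derived \<G> N)" if "N \<lhd> \<G> \<and> analytic N" for N
    using that Pi.derived_is_normal analytic_derived by simp
  fix J :: "nat set" and f assume J: "J \<noteq> {}" "\<And>j. j \<in> J \<Longrightarrow> f j \<lhd> \<G> \<and> analytic (f j)"
  have "analytic (\<Inter>n. f (from_nat_into J n))"
    using J by (intro analytic_INT) (auto simp: from_nat_into)
  moreover have "f ` J = range (\<lambda>n. f (from_nat_into J n))"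
    using image_image[of f "from_nat_into J" UNIV] range_from_nat_into[OF J(1)] by simp
  ultimately have "analytic (\<Inter> (f ` J))" by simp
  moreover have "\<Inter> (f ` J) \<lhd> \<G>" using J by (intro Pi.normal_Inter) auto
  ultimately show "\<Inter> (f ` J) \<lhd> \<G> \<and> analytic (\<Inter> (f ` J))" by blast
qed

lemma lower_central_analytic: "analytic (lower_central \<G> n)"
  by (induction n)
     (auto simp: commutator_subgroup_def intro: analytic_carrier intro!: analytic_generate analytic_commutators)

lemma power_subgroup_analytic: "analytic (power_subgroup \<G> n)"
  unfolding Pi.power_subgroup_eq_generate by (intro analytic_generate analytic_powers)

end

section \<open>Infinite concatenations and the dichotomy\<close>

lemma (in group) mult_inv_cancel_middle:
  assumes "a \<in> carrier G" "b \<in> carrier G" "c \<in> carrier G"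
  shows "(a \<otimes> inv b) \<otimes> (b \<otimes> c) = a \<otimes> c"
proof -
  have "inv b \<otimes> (b \<otimes> c) = c" using assms by (simp flip: m_assoc)
  then show ?thesis using assms by (simp add: m_assoc)
qed

lemma (in group) conj_cancel:
  assumes "a \<in> carrier G" "w \<in> carrier G"
  shows "inv a \<otimes> (a \<otimes> w \<otimes> inv a) \<otimes> a = w"
proof -
  have "inv a \<otimes> (a \<otimes> w) = w" using assms by (simp flip: m_assoc)
  then show ?thesis using assms by (simp add: m_assoc)
qed

text \<open>The joins are nested to the right, so loop \<open>i\<close> runs from time
  \<open>1 - (1/2) ^ i\<close> to time \<open>1 - (1/2) ^ Suc i\<close>, and longer concatenations
  agree with shorter ones on the common initial part.\<close>

primrec concat_paths :: "'a \<Rightarrow> nat \<Rightarrow> (nat \<Rightarrow> real \<Rightarrow> 'a) \<Rightarrow> real \<Rightarrow> 'a::topological_space" where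
  "concat_paths x 0 q = (\<lambda>_. x)"
| "concat_paths x (Suc n) q = q 0 +++ concat_paths x n (\<lambda>i. q (Suc i))"

text \<open>The first finite stage that has settled the value at \<open>t\<close> is used. Time 1 is
  not settled by any stage and receives the limit \<open>x\<close>.\<close>

definition inf_concat :: "'a \<Rightarrow> (nat \<Rightarrow> real \<Rightarrow> 'a) \<Rightarrow> real \<Rightarrow> 'a::topological_space" where
  "inf_concat x q t = (if \<exists>n. t \<le> 1 - (1/2) ^ n
     then concat_paths x (LEAST n. t \<le> 1 - (1/2) ^ n) q t else x)"

lemma dyadic_half_iff: "2 * t - 1 \<le> 1 - (1/2) ^ n \<longleftrightarrow> t \<le> 1 - (1/2::real) ^ Suc n"
  by auto

lemma concat_paths_start:
  assumes "\<And>i. q i 0 = x" shows "concat_paths x n q 0 = x"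
  using assms by (cases n) (auto simp: joinpaths_def)

lemma concat_paths_stable:
  assumes "\<And>i. q i 0 = x" "t \<in> {0..1}" "t \<le> 1 - (1/2) ^ n" "n \<le> m"
  shows "concat_paths x m q t = concat_paths x n q t"
  using assms
proof (induction n arbitrary: m q t)
  case 0
  then have "t = 0" by simp
  then show ?case using 0 concat_paths_start[of q x] by simp
next
  case (Suc n)
  obtain m' where m: "m = Suc m'" "n \<le> m'" using Suc.prems(4) by (cases m) auto
  show ?case
  proof (cases "t \<le> 1/2")
    case False
    then have "concat_paths x m' (\<lambda>i. q (Suc i)) (2 * t - 1) = concat_paths x n (\<lambda>i. q (Suc i)) (2 * t - 1)"
      using Suc.prems m dyadic_half_iff[of t n] by (intro Suc.IH) auto
    with False show ?thesis by (simp add: m joinpaths_def)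
  qed (simp add: m joinpaths_def)
qed

lemma inf_concat_eq:
  assumes "\<And>i. q i 0 = x" "t \<in> {0..1}" "t \<le> 1 - (1/2) ^ n"
  shows "inf_concat x q t = concat_paths x n q t"
proof -
  define k where "k = (LEAST n. t \<le> 1 - (1/2) ^ n)"
  have "t \<le> 1 - (1/2) ^ k" unfolding k_def using assms(3) by (rule LeastI)
  moreover have "k \<le> n" unfolding k_def using assms(3) by (rule Least_le)
  ultimately have "concat_paths x n q t = concat_paths x k q t"
    using assms by (intro concat_paths_stable) auto
  then show ?thesis using assms(3) by (auto simp: inf_concat_def k_def)
qed

lemma ex_dyadic: "(t::real) < 1 \<Longrightarrow> \<exists>n. t \<le> 1 - (1/2) ^ n"
  using real_arch_pow_inv[of "1 - t" "1/2"] by (auto intro: less_imp_le simp: algebra_simps)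

lemma inf_concat_1: "inf_concat x q 1 = x"
proof -
  have "\<not> (\<exists>n. (1::real) \<le> 1 - (1/2) ^ n)" by (auto simp: not_le)
  then show ?thesis by (simp add: inf_concat_def)
qed

lemma inf_concat_0:
  assumes "\<And>i. q i 0 = x" shows "inf_concat x q 0 = x"
  using inf_concat_eq[of q x 0 0] assms by simp

lemma inf_concat_unfold:
  assumes "\<And>i. q i 0 = x" "t \<in> {0..1}"
  shows "inf_concat x q t = (q 0 +++ inf_concat x (\<lambda>i. q (Suc i))) t"
proof -
  consider "t \<le> 1/2" | "1/2 < t" "t < 1" | "t = 1" using assms(2) by fastforce
  then show ?thesis
  proof cases
    case 1
    then show ?thesis using inf_concat_eq[of q x t 1] assms by (simp add: joinpaths_def)
  next
    case 2
    then obtain n where n: "2 * t - 1 \<le> 1 - (1/2) ^ n" using ex_dyadic[of "2 * t - 1"] by auto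
    then have "inf_concat x q t = concat_paths x (Suc n) q t"
      using assms dyadic_half_iff by (intro inf_concat_eq) blast+
    also have "\<dots> = inf_concat x (\<lambda>i. q (Suc i)) (2 * t - 1)"
      using 2 n assms inf_concat_eq[of "\<lambda>i. q (Suc i)" x "2 * t - 1" n] by (simp add: joinpaths_def)
    finally show ?thesis using 2 by (simp add: joinpaths_def)
  next
    case 3
    then show ?thesis by (simp add: joinpaths_def inf_concat_1)
  qed
qed

lemma concat_paths_in:
  assumes "\<And>i t. t \<in> {0..1} \<Longrightarrow> q i t \<in> B" "x \<in> B" "t \<in> {0..1}"
  shows "concat_paths x n q t \<in> B"
  using assms by (induction n arbitrary: q t) (auto simp: joinpaths_def)

lemma inf_concat_in:
  assumes "\<And>i t. t \<in> {0..1} \<Longrightarrow> q i t \<in> B" "x \<in> B" "t \<in> {0..1}"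
  shows "inf_concat x q t \<in> B"
  unfolding inf_concat_def using assms concat_paths_in[of q B x t] by auto

text \<open>From time \<open>1 - (1/2) ^ n\<close> on, only loops with index at least
  \<open>n\<close> are traversed. The starting time itself still belongs to the preceding loop in
  the definition of a join, but its value there is the end point \<open>x\<close>; hence the
  hypothesis on \<open>q i 1\<close>.\<close>

lemma inf_concat_tail_in:
  assumes "\<And>i t. t \<in> {0..1} \<Longrightarrow> q i t \<in> B i" "\<And>i. q i 0 = x" "\<And>i. q i 1 = x" "\<And>i. x \<in> B i"
    "\<And>i j. i \<le> j \<Longrightarrow> B j \<subseteq> B i" "t \<in> {0..1}" "1 - (1/2) ^ n \<le> t"
  shows "inf_concat x q t \<in> B n"
  using assms
proof (induction n arbitrary: q B t)
  case 0
  have "q i t \<in> B 0" if "t \<in> {0..1}" for i t using 0(1)[OF that, of i] 0(5)[of 0 i] by auto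
  then show ?case using 0 by (intro inf_concat_in) auto
next
  case (Suc n)
  have t: "1/2 \<le> t" "1 - (1/2) ^ n \<le> 2 * t - 1"
    using Suc.prems(7) power_le_one[of "1/2::real" n] by simp_all
  have eq: "inf_concat x q t = (q 0 +++ inf_concat x (\<lambda>i. q (Suc i))) t"
    using Suc.prems by (intro inf_concat_unfold) auto
  show ?case
  proof (cases "t = 1/2")
    case True
    then have "2 * t = 1" by simp
    then have "q 0 (2 * t) = x" by (simp only: Suc.prems)
    moreover have "(q 0 +++ r) t = q 0 (2 * t)" for r using True by (simp add: joinpaths_def)
    ultimately show ?thesis using eq Suc.prems(4) by simp
  next
    case False
    have "inf_concat x (\<lambda>i. q (Suc i)) (2 * t - 1) \<in> (\<lambda>i. B (Suc i)) n"
      using Suc.prems(6) t by (intro Suc.IH) (auto simp: Suc.prems)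
    then show ?thesis using eq False t by (simp add: joinpaths_def)
  qed
qed

lemma concat_paths_tail:
  assumes "\<And>i. q i 1 = x" "t \<in> {0..1}" "1 - (1/2) ^ n \<le> t"
  shows "concat_paths x n q t = x"
  using assms
proof (induction n arbitrary: q t)
  case (Suc n)
  have t: "1/2 \<le> t" "1 - (1/2) ^ n \<le> 2 * t - 1"
    using Suc.prems(3) power_le_one[of "1/2::real" n] by simp_all
  show ?case
  proof (cases "t = 1/2")
    case True
    then have "2 * t = 1" by simp
    then have "q 0 (2 * t) = x" by (simp only: Suc.prems)
    moreover have "(q 0 +++ r) t = q 0 (2 * t)" for r using True by (simp add: joinpaths_def)
    ultimately show ?thesis by simp
  next
    case False
    have "concat_paths x n (\<lambda>i. q (Suc i)) (2 * t - 1) = x"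
      using Suc.prems t by (intro Suc.IH) auto
    then show ?thesis using False t by (simp add: joinpaths_def)
  qed
qed simp

text \<open>An omitted loop is replaced by the constant one, so that the other loops keep their time
  intervals.\<close>

definition select :: "'a \<Rightarrow> (nat \<Rightarrow> real \<Rightarrow> 'a) \<Rightarrow> (nat \<Rightarrow> nat) \<Rightarrow> nat \<Rightarrow> real \<Rightarrow> 'a" where
  "select x p \<alpha> n = (if odd (\<alpha> n) then p n else (\<lambda>_. x))"

lemma select_Suc: "(\<lambda>i. select x p \<alpha> (Suc i)) = select x (\<lambda>i. p (Suc i)) (\<lambda>i. \<alpha> (Suc i))"
  by (simp add: select_def fun_eq_iff)

section \<open>Selections from a sequence of shrinking loops\<close>

locale pi_space = polish_based_space X d e x0 + connected_based_space X x0
  for X :: "'a::topological_space set" and d e x0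
begin

lemma family_If:
  assumes "family UNIV F" "family UNIV G" "open A" "closed (A :: (nat \<Rightarrow> nat) set)"
  shows "family UNIV (\<lambda>z. if z \<in> A then F z else G z)"
proof (rule familyI)
  have "continuous_on ((A \<times> {0..1}) \<union> ((- A) \<times> {0..1::real}))
      (\<lambda>p. if fst p \<in> A then (\<lambda>(z, t). F z t) p else (\<lambda>(z, t). G z t) p)"
    by (rule continuous_on_cases)
       (use assms in \<open>auto intro!: closed_Times simp: closed_Compl family_def intro: continuous_on_subset\<close>)
  moreover have "(A \<times> {0..1}) \<union> ((- A) \<times> {0..1::real}) = UNIV \<times> {0..1}" by auto
  ultimately show "continuous_on (UNIV \<times> {0..1}) (\<lambda>(z, t). (if z \<in> A then F z else G z) t)"
    by (simp add: case_prod_beta if_distrib[of "\<lambda>f. f _"] cong: if_cong)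
qed (use assms in \<open>auto simp: family_def path_in_alt\<close>)

lemma family_concat_paths:
  assumes "x \<in> X" "\<And>i. path_in X (p i)" "\<And>i. pathstart (p i) = x" "\<And>i. pathfinish (p i) = x"
  shows "family UNIV (\<lambda>\<alpha>. concat_paths x n (select x p \<alpha>))"
  using assms(2-4)
proof (induction n arbitrary: p)
  case 0
  then show ?case using assms(1) by (auto intro: family_const)
next
  case (Suc n)
  have A: "open {\<alpha> :: nat \<Rightarrow> nat. odd (\<alpha> 0)}" "closed {\<alpha> :: nat \<Rightarrow> nat. odd (\<alpha> 0)}"
  proof -
    have "{\<alpha> :: nat \<Rightarrow> nat. odd (\<alpha> 0)} = (\<lambda>\<alpha>. \<alpha> 0) -` {k. odd k}" by auto
    then show "open {\<alpha> :: nat \<Rightarrow> nat. odd (\<alpha> 0)}"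
      using open_vimage[OF open_discrete continuous_on_product_coordinates] by metis
    have "- {\<alpha> :: nat \<Rightarrow> nat. odd (\<alpha> 0)} = (\<lambda>\<alpha>. \<alpha> 0) -` {k. even k}" by auto
    then show "closed {\<alpha> :: nat \<Rightarrow> nat. odd (\<alpha> 0)}"
      unfolding closed_def using open_vimage[OF open_discrete continuous_on_product_coordinates] by metis
  qed
  have "family UNIV (\<lambda>\<alpha> :: nat \<Rightarrow> nat. if \<alpha> \<in> {\<alpha>. odd (\<alpha> 0)} then p 0 else (\<lambda>_. x))"
    using Suc.prems assms(1) by (intro family_If[OF family_const family_const A]) auto
  then have 1: "family UNIV (\<lambda>\<alpha>. select x p \<alpha> 0)" by (simp add: select_def)
  have "family UNIV (\<lambda>\<alpha>. concat_paths x n (select x (\<lambda>i. p (Suc i)) \<alpha>))"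
    using Suc.prems by (intro Suc.IH) auto
  then have 2: "family UNIV (\<lambda>\<alpha>. concat_paths x n (select x (\<lambda>i. p (Suc i)) (\<lambda>i. \<alpha> (Suc i))))"
    by (rule family_comp[OF _ continuous_on_reindex]) auto
  have "pathfinish (select x p \<alpha> 0) = x" for \<alpha> using Suc.prems by (simp add: select_def)
  moreover have "pathstart (concat_paths x n (select x (\<lambda>i. p (Suc i)) (\<lambda>i. \<alpha> (Suc i)))) = x" for \<alpha>
    using Suc.prems unfolding pathstart_def by (intro concat_paths_start) (simp add: select_def)
  ultimately show ?case
    using family_join[OF 1 2] by (simp add: select_Suc)
qed

text \<open>The finite concatenations converge uniformly in selection and time: up to the end of
  stage \<open>n\<close> there is no difference, and afterwards the finite one rests at
  \<open>x\<close> while the infinite one stays in the ball of radius \<open>(1/2) ^ n\<close> about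
  \<open>x\<close>.\<close>

lemma family_inf_concat:
  assumes "x \<in> X" "\<And>i. path_in (mball x ((1/2) ^ i)) (p i)" "\<And>i. pathstart (p i) = x" "\<And>i. pathfinish (p i) = x"
  shows "family UNIV (\<lambda>\<alpha>. inf_concat x (select x p \<alpha>))"
proof -
  have mX: "mball x r \<subseteq> X" for r by auto
  have pX: "path_in X (p i)" for i using assms(2) mX by (rule path_in_mono)
  have xB: "x \<in> mball x ((1/2) ^ i)" for i :: nat using assms(1) by simp
  have Bm: "i \<le> j \<Longrightarrow> mball x ((1/2) ^ j) \<subseteq> mball x ((1/2) ^ i)" for i j :: nat
    by (intro mball_subset_concentric power_decreasing) auto
  have s: "select x p \<alpha> i t \<in> mball x ((1/2) ^ i)" if "t \<in> {0..1}" for \<alpha> i t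
    using assms(2)[of i] xB[of i] that unfolding select_def path_in_alt by auto
  have s0: "select x p \<alpha> i 0 = x" "select x p \<alpha> i 1 = x" for \<alpha> i
    using assms(3,4)[of i] by (auto simp: select_def pathstart_def pathfinish_def)
  have fam: "family UNIV (\<lambda>\<alpha>. concat_paths x n (select x p \<alpha>))" for n
    using assms(1) pX assms(3,4) by (rule family_concat_paths)
  have inX: "inf_concat x (select x p \<alpha>) t \<in> X" if "t \<in> {0..1}" for \<alpha> t
    using that s assms(1) mX by (intro inf_concat_in) blast+
  have close: "d (concat_paths x n (select x p \<alpha>) t) (inf_concat x (select x p \<alpha>) t) < (1/2) ^ n"
    if t: "t \<in> {0..1}" for n \<alpha> t
  proof (cases "t \<le> 1 - (1/2) ^ n")
    case True
    then have "concat_paths x n (select x p \<alpha>) t = inf_concat x (select x p \<alpha>) t"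
      using inf_concat_eq[of "select x p \<alpha>", OF s0(1) t True] by simp
    then show ?thesis using inX[OF t, of \<alpha>] by simp
  next
    case False
    then have "concat_paths x n (select x p \<alpha>) t = x" using t s0 by (intro concat_paths_tail) auto
    moreover have "inf_concat x (select x p \<alpha>) t \<in> mball x ((1/2) ^ n)"
      using False t by (intro inf_concat_tail_in[where B = "\<lambda>i. mball x ((1/2) ^ i)"] s s0 xB Bm) auto
    ultimately show ?thesis by simp
  qed
  show ?thesis
  proof (rule familyI)
    let ?F = "\<lambda>(\<alpha>, t). inf_concat x (select x p \<alpha>) t"
    have im: "?F ` (UNIV \<times> {0..1}) \<subseteq> X" using inX by auto
    show "continuous_on (UNIV \<times> {0..1}) ?F"
      unfolding continuous_on_iff_d[OF im]
    proof (intro ballI allI impI)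
      fix y and \<epsilon> :: real assume y: "y \<in> (UNIV :: (nat \<Rightarrow> nat) set) \<times> {0..1::real}" and \<epsilon>: "\<epsilon> > 0"
      obtain n where n: "(1/2) ^ n < \<epsilon> / 3" using real_arch_pow_inv[of "\<epsilon> / 3" "1/2"] \<epsilon> by auto
      let ?C = "\<lambda>(\<alpha>, t). concat_paths x n (select x p \<alpha>) t"
      have C: "continuous_on (UNIV \<times> {0..1}) ?C" "?C ` (UNIV \<times> {0..1}) \<subseteq> X"
        using fam[of n] by (auto simp: family_def path_in_alt)
      obtain U where U: "open U" "y \<in> U" "\<And>z. z \<in> UNIV \<times> {0..1} \<inter> U \<Longrightarrow> d (?C y) (?C z) < \<epsilon> / 3"
        using C(1) continuous_on_iff_d[OF C(2)] y \<epsilon> by (metis (no_types, lifting) zero_less_divide_iff zero_less_numeral)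
      have "d (?F y) (?F z) < \<epsilon>" if z: "z \<in> UNIV \<times> {0..1} \<inter> U" for z
      proof -
        have X: "?F y \<in> X" "?F z \<in> X" "?C y \<in> X" "?C z \<in> X" using im C(2) y z by blast+
        have c: "d (?C y) (?F y) < (1/2) ^ n" "d (?C z) (?F z) < (1/2) ^ n"
          using close y z by auto
        have "d (?F y) (?F z) \<le> d (?F y) (?C y) + d (?C y) (?F z)" using X by (intro triangle)
        also have "d (?C y) (?F z) \<le> d (?C y) (?C z) + d (?C z) (?F z)" using X by (intro triangle)
        finally show ?thesis using c n U(3)[OF z] commute[of "?F y" "?C y"] by linarith
      qed
      then show "\<exists>U. open U \<and> y \<in> U \<and> (\<forall>z\<in>UNIV \<times> {0..1} \<inter> U. d (?F y) (?F z) < \<epsilon>)"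
        using U(1,2) by blast
    qed
  qed (use inX in auto)
qed

text \<open>For trivial \<open>N\<close> this says that \<open>X\<close> is semilocally simply
  connected at \<open>x\<close>; in general it is the same condition modulo
  \<open>N\<close>.\<close>

definition good_at :: "(real \<Rightarrow> 'a) set set \<Rightarrow> 'a \<Rightarrow> bool" where
  "good_at N x \<longleftrightarrow> (\<exists>\<epsilon>>0. \<forall>p. path_in (mball x \<epsilon>) p \<longrightarrow> pathstart p = x \<longrightarrow> pathfinish p = x \<longrightarrow> \<gamma> p \<in> N)"

lemma flip_Suc_tail: "(\<lambda>i. flip (Suc n) \<alpha> (Suc i)) = flip n (\<lambda>i. \<alpha> (Suc i))"
  by (auto simp: flip_def fun_eq_iff)

text \<open>Induction on the flipped index, peeling off the initial loop. For index 0 the common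
  tail cancels and leaves the class of \<open>p 0\<close> or its inverse; otherwise the common
  initial factor conjugates the quotient of the tails, and \<open>N\<close> is normal. The shifted
  sequence lies in even smaller balls, so the hypotheses persist.\<close>

lemma gamma_flip:
  assumes N: "N \<lhd> \<G>" and x: "x \<in> X"
    and p: "\<And>i. path_in (mball x ((1/2) ^ i)) (p i)" "\<And>i. pathstart (p i) = x" "\<And>i. pathfinish (p i) = x"
    "\<And>i. \<gamma> (p i) \<notin> N"
  shows "\<gamma> (inf_concat x (select x p \<alpha>)) \<otimes>\<^bsub>\<G>\<^esub> inv\<^bsub>\<G>\<^esub> \<gamma> (inf_concat x (select x p (flip n \<alpha>))) \<notin> N"
  using p
proof (induction n arbitrary: p \<alpha>)
  interpret N: normal N \<G> by (rule N)
  have mono: "mball x ((1/2) ^ Suc i) \<subseteq> mball x ((1/2) ^ i)" for i :: nat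
    by (intro mball_subset_concentric) auto
  have unfold: "\<gamma> (inf_concat x (select x p \<alpha>)) = \<gamma> (select x p \<alpha> 0) \<otimes>\<^bsub>\<G>\<^esub>
      \<gamma> (inf_concat x (select x (\<lambda>i. p (Suc i)) (\<lambda>i. \<alpha> (Suc i))))"
    and closed: "\<gamma> (select x p \<alpha> 0) \<in> carrier \<G>"
      "\<gamma> (inf_concat x (select x (\<lambda>i. p (Suc i)) (\<lambda>i. \<alpha> (Suc i)))) \<in> carrier \<G>"
    if p: "\<And>i. path_in (mball x ((1/2) ^ i)) (p i)" "\<And>i. pathstart (p i) = x" "\<And>i. pathfinish (p i) = x" for p \<alpha>
  proof -
    have s0: "select x p \<alpha> i 0 = x" "select x p \<alpha> i 1 = x" for \<alpha> i
      using p(2,3)[of i] by (auto simp: select_def pathstart_def pathfinish_def)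
    have "path_in X (p 0)" using p(1)[of 0] by (rule path_in_mono) auto
    then have P0: "path_in X (select x p \<alpha> 0)" "pathstart (select x p \<alpha> 0) = x" "pathfinish (select x p \<alpha> 0) = x"
      using x p by (auto simp: select_def)
    have "path_in (mball x ((1/2) ^ i)) (p (Suc i))" for i using p(1)[of "Suc i"] mono by (rule path_in_mono)
    from family_inf_concat[OF x this p(2,3)]
    have P1: "path_in X (inf_concat x (select x (\<lambda>i. p (Suc i)) (\<lambda>i. \<alpha> (Suc i))))"
      by (auto simp: family_def)
    have e1: "pathstart (inf_concat x (select x (\<lambda>i. p (Suc i)) (\<lambda>i. \<alpha> (Suc i)))) = x"
      using p(2) unfolding pathstart_def by (intro inf_concat_0) (auto simp: select_def pathstart_def)
    have "path_in X (inf_concat x (select x p \<alpha>))"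
      using family_inf_concat[OF x p] by (auto simp: family_def)
    then have "\<gamma> (inf_concat x (select x p \<alpha>)) = \<gamma> (select x p \<alpha> 0 +++ inf_concat x (select x (\<lambda>i. p (Suc i)) (\<lambda>i. \<alpha> (Suc i))))"
      using inf_concat_unfold[of "select x p \<alpha>" x] s0 by (intro gamma.cong) (auto simp: select_Suc)
    then show "\<gamma> (inf_concat x (select x p \<alpha>)) = \<gamma> (select x p \<alpha> 0) \<otimes>\<^bsub>\<G>\<^esub>
      \<gamma> (inf_concat x (select x (\<lambda>i. p (Suc i)) (\<lambda>i. \<alpha> (Suc i))))"
      using P0 P1 e1 by (simp add: gamma.join)
    show "\<gamma> (select x p \<alpha> 0) \<in> carrier \<G>"
      "\<gamma> (inf_concat x (select x (\<lambda>i. p (Suc i)) (\<lambda>i. \<alpha> (Suc i)))) \<in> carrier \<G>"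
      using P0 P1 by simp_all
  qed
  {
    case 0
    define a b T where "a = \<gamma> (select x p \<alpha> 0)" and "b = \<gamma> (select x p (flip 0 \<alpha>) 0)"
      and "T = \<gamma> (inf_concat x (select x (\<lambda>i. p (Suc i)) (\<lambda>i. \<alpha> (Suc i))))"
    have fl: "(\<lambda>i. flip 0 \<alpha> (Suc i)) = (\<lambda>i. \<alpha> (Suc i))" by (auto simp: flip_def)
    have c: "a \<in> carrier \<G>" "b \<in> carrier \<G>" "T \<in> carrier \<G>"
      using closed[OF 0(1-3)] by (auto simp: a_def b_def T_def)
    have p0: "\<gamma> (p 0) \<in> carrier \<G>"
      using path_in_mono[OF 0(1)[of 0] mball_subset_mspace] by (rule gamma.closed)
    have "(a \<otimes>\<^bsub>\<G>\<^esub> T) \<otimes>\<^bsub>\<G>\<^esub> inv\<^bsub>\<G>\<^esub> (b \<otimes>\<^bsub>\<G>\<^esub> T) = a \<otimes>\<^bsub>\<G>\<^esub> inv\<^bsub>\<G>\<^esub> b"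
      using c Pi.mult_inv_cancel_middle[of a "inv\<^bsub>\<G>\<^esub> T" "inv\<^bsub>\<G>\<^esub> b"] by (simp add: Pi.inv_mult_group)
    also have "\<dots> \<notin> N"
    proof (cases "odd (\<alpha> 0)")
      case True
      then have "a = \<gamma> (p 0)" "b = \<one>\<^bsub>\<G>\<^esub>" using x by (auto simp: a_def b_def select_def flip_def)
      then show ?thesis using 0(4) p0 by simp
    next
      case False
      then have "b = \<gamma> (p 0)" "a = \<one>\<^bsub>\<G>\<^esub>" using x by (auto simp: a_def b_def select_def flip_def)
      moreover have "inv\<^bsub>\<G>\<^esub> \<gamma> (p 0) \<notin> N" using 0(4)[of 0] p0 by (metis N.m_inv_closed Pi.inv_inv)
      ultimately show ?thesis using p0 by simp
    qed
    finally show ?case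
      using unfold[OF 0(1-3), of \<alpha>] unfold[OF 0(1-3), of "flip 0 \<alpha>"] by (simp add: a_def b_def T_def fl)
  next
    case (Suc n)
    define a u v where "a = \<gamma> (select x p \<alpha> 0)"
      and "u = \<gamma> (inf_concat x (select x (\<lambda>i. p (Suc i)) (\<lambda>i. \<alpha> (Suc i))))"
      and "v = \<gamma> (inf_concat x (select x (\<lambda>i. p (Suc i)) (flip n (\<lambda>i. \<alpha> (Suc i)))))"
    have f0: "select x p (flip (Suc n) \<alpha>) 0 = select x p \<alpha> 0" by (simp add: select_def flip_def)
    have c: "a \<in> carrier \<G>" "u \<in> carrier \<G>" "v \<in> carrier \<G>"
      using closed[OF Suc.prems(1-3), of \<alpha>] closed[OF Suc.prems(1-3), of "flip (Suc n) \<alpha>"]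
      by (auto simp: a_def u_def v_def flip_Suc_tail)
    have "path_in (mball x ((1/2) ^ i)) (p (Suc i))" for i
      using Suc.prems(1)[of "Suc i"] mono by (rule path_in_mono)
    then have uv: "u \<otimes>\<^bsub>\<G>\<^esub> inv\<^bsub>\<G>\<^esub> v \<notin> N"
      unfolding u_def v_def using Suc.prems by (intro Suc.IH) auto
    have eq: "(a \<otimes>\<^bsub>\<G>\<^esub> u) \<otimes>\<^bsub>\<G>\<^esub> inv\<^bsub>\<G>\<^esub> (a \<otimes>\<^bsub>\<G>\<^esub> v) = a \<otimes>\<^bsub>\<G>\<^esub> (u \<otimes>\<^bsub>\<G>\<^esub> inv\<^bsub>\<G>\<^esub> v) \<otimes>\<^bsub>\<G>\<^esub> inv\<^bsub>\<G>\<^esub> a"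
      using c by (simp add: Pi.inv_mult_group Pi.m_assoc)
    have "a \<otimes>\<^bsub>\<G>\<^esub> (u \<otimes>\<^bsub>\<G>\<^esub> inv\<^bsub>\<G>\<^esub> v) \<otimes>\<^bsub>\<G>\<^esub> inv\<^bsub>\<G>\<^esub> a \<notin> N"
    proof
      assume "a \<otimes>\<^bsub>\<G>\<^esub> (u \<otimes>\<^bsub>\<G>\<^esub> inv\<^bsub>\<G>\<^esub> v) \<otimes>\<^bsub>\<G>\<^esub> inv\<^bsub>\<G>\<^esub> a \<in> N"
      from N.inv_op_closed1[OF c(1) this]
      have "inv\<^bsub>\<G>\<^esub> a \<otimes>\<^bsub>\<G>\<^esub> (a \<otimes>\<^bsub>\<G>\<^esub> (u \<otimes>\<^bsub>\<G>\<^esub> inv\<^bsub>\<G>\<^esub> v) \<otimes>\<^bsub>\<G>\<^esub> inv\<^bsub>\<G>\<^esub> a) \<otimes>\<^bsub>\<G>\<^esub> a \<in> N" .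
      then have "u \<otimes>\<^bsub>\<G>\<^esub> inv\<^bsub>\<G>\<^esub> v \<in> N" using c by (simp add: Pi.conj_cancel)
      then show False using uv by simp
    qed
    then show ?case
      using unfold[OF Suc.prems(1-3), of \<alpha>] unfold[OF Suc.prems(1-3), of "flip (Suc n) \<alpha>"] eq
      by (simp add: a_def u_def v_def flip_Suc_tail f0)
  }
qed

theorem not_good_imp_independent:
  assumes N: "N \<lhd> \<G>" "analytic N" and x: "x \<in> X" and bad: "\<not> good_at N x"
  obtains f :: "nat set \<Rightarrow> (real \<Rightarrow> 'a) set" where "\<And>A. f A \<in> carrier \<G>"
    "\<And>A B. A \<noteq> B \<Longrightarrow> f A \<otimes>\<^bsub>\<G>\<^esub> inv\<^bsub>\<G>\<^esub> f B \<notin> N"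
proof -
  interpret N: normal N \<G> by (rule N)
  have "\<forall>i. \<exists>p. path_in (mball x ((1/2) ^ i)) p \<and> pathstart p = x \<and> pathfinish p = x \<and> \<gamma> p \<notin> N"
  proof
    fix i :: nat
    have "(1/2::real) ^ i > 0" by simp
    then show "\<exists>p. path_in (mball x ((1/2) ^ i)) p \<and> pathstart p = x \<and> pathfinish p = x \<and> \<gamma> p \<notin> N"
      using bad unfolding good_at_def by blast
  qed
  then obtain p where p: "\<And>i. path_in (mball x ((1/2) ^ i)) (p i)" "\<And>i. pathstart (p i) = x"
    "\<And>i. pathfinish (p i) = x" "\<And>i. \<gamma> (p i) \<notin> N" by metis
  define P where "P \<alpha> = inf_concat x (select x p \<alpha>)" for \<alpha>
  have famP: "family UNIV P" unfolding P_def using x p(1-3) by (rule family_inf_concat)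
  have PX: "path_in X (P \<alpha>)" for \<alpha> using famP by (simp add: family_def)
  have P0: "pathstart (P \<alpha>) = x" for \<alpha>
    using p(2) unfolding P_def pathstart_def by (intro inf_concat_0) (auto simp: select_def pathstart_def)
  have P1: "pathfinish (P \<alpha>) = x" for \<alpha> unfolding P_def pathfinish_def by (rule inf_concat_1)
  define g where "g \<alpha> = \<gamma> (P \<alpha>)" for \<alpha>
  have g: "g \<alpha> \<in> carrier \<G>" for \<alpha> using PX by (simp add: g_def)
  \<comment> \<open>The quotient of two selections is realised as a loop at \<open>x0\<close> that
    depends continuously on both of them.\<close>
  define L where "L = (\<lambda>(\<alpha>, \<beta>). tie (P \<alpha> +++ reversepath (P \<beta>)))"
  have famL: "loop_family UNIV L"
  proof -
    have 1: "family UNIV (\<lambda>ab. P (fst ab))" "family UNIV (\<lambda>ab. P (snd ab))"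
      by (rule family_comp[OF famP]; intro continuous_on_fst continuous_on_snd continuous_on_id subset_UNIV)+
    have "family UNIV (\<lambda>ab. (tether x +++ (P (fst ab) +++ reversepath (P (snd ab)))) +++ reversepath (tether x))"
      using x by (intro family_join family_reversepath 1 family_const tether) (auto simp: P0 P1 tether)
    also have "(\<lambda>ab. (tether x +++ (P (fst ab) +++ reversepath (P (snd ab)))) +++ reversepath (tether x)) = L"
      by (auto simp: L_def tie_def P0 P1 fun_eq_iff)
    finally show ?thesis by (auto simp: loop_family_def L_def P0 P1 PX intro!: loop_tie)
  qed
  have clL: "cl (L (\<alpha>, \<beta>)) = g \<alpha> \<otimes>\<^bsub>\<G>\<^esub> inv\<^bsub>\<G>\<^esub> g \<beta>" for \<alpha> \<beta>
    using gamma.join[of "P \<alpha>" "reversepath (P \<beta>)"] PX by (simp add: L_def g_def P0 P1 flip: \<gamma>_def)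
  obtain R :: "(((nat \<Rightarrow> nat) \<times> (nat \<Rightarrow> nat)) \<times> (nat \<Rightarrow> nat)) set" where R: "closed R"
    "\<And>y. cl (L y) \<in> N \<longleftrightarrow> (\<exists>z. (y, z) \<in> R)"
    using analytic_preimage_projection[OF N(2) famL] by metis
  \<comment> \<open>\<open>E\<close> relates selections whose classes lie in the same right coset of
    \<open>N\<close>; its description as a projection comes from the analyticity of
    \<open>N\<close>.\<close>
  define E where "E \<alpha> \<beta> \<longleftrightarrow> g \<alpha> \<otimes>\<^bsub>\<G>\<^esub> inv\<^bsub>\<G>\<^esub> g \<beta> \<in> N" for \<alpha> \<beta>
  have ER: "E \<alpha> \<beta> \<longleftrightarrow> (\<exists>z. ((\<alpha>, \<beta>), z) \<in> R)" for \<alpha> \<beta>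
    using R(2)[of "(\<alpha>, \<beta>)"] by (simp add: E_def clL)
  have sym: "symp E"
  proof (rule sympI)
    fix \<alpha> \<beta> assume "E \<alpha> \<beta>"
    then have "inv\<^bsub>\<G>\<^esub> (g \<alpha> \<otimes>\<^bsub>\<G>\<^esub> inv\<^bsub>\<G>\<^esub> g \<beta>) \<in> N" by (simp add: E_def)
    then show "E \<beta> \<alpha>" using g by (simp add: E_def Pi.inv_mult_group)
  qed
  have trans: "transp E"
  proof (rule transpI)
    fix \<alpha> \<beta> \<delta> assume "E \<alpha> \<beta>" "E \<beta> \<delta>"
    then have "(g \<alpha> \<otimes>\<^bsub>\<G>\<^esub> inv\<^bsub>\<G>\<^esub> g \<beta>) \<otimes>\<^bsub>\<G>\<^esub> (g \<beta> \<otimes>\<^bsub>\<G>\<^esub> inv\<^bsub>\<G>\<^esub> g \<delta>) \<in> N" by (simp add: E_def)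
    also have "(g \<alpha> \<otimes>\<^bsub>\<G>\<^esub> inv\<^bsub>\<G>\<^esub> g \<beta>) \<otimes>\<^bsub>\<G>\<^esub> (g \<beta> \<otimes>\<^bsub>\<G>\<^esub> inv\<^bsub>\<G>\<^esub> g \<delta>) = g \<alpha> \<otimes>\<^bsub>\<G>\<^esub> inv\<^bsub>\<G>\<^esub> g \<delta>"
      using g by (simp add: Pi.mult_inv_cancel_middle)
    finally show "E \<alpha> \<delta>" by (simp add: E_def)
  qed
  have flipE: "\<not> E \<alpha> (flip n \<alpha>)" for n \<alpha>
    unfolding E_def g_def P_def by (rule gamma_flip[OF N(1) x p])
  obtain f :: "nat set \<Rightarrow> nat \<Rightarrow> nat" where f: "\<And>A B. A \<noteq> B \<Longrightarrow> \<not> E (f A) (f B)"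
    using flip_inequivalent_imp_independent[OF R(1) ER sym trans flipE] by metis
  show ?thesis
    by (rule that[of "\<lambda>A. g (f A)"]) (use g f in \<open>auto simp: E_def\<close>)
qed

end

section \<open>Path characters that are trivial on small loops\<close>

context polish_subspace begin

lemma path_modulus:
  assumes "path_in X p" "\<epsilon> > 0"
  obtains N :: nat where "N > 0"
    "\<And>n s t. n \<ge> N \<Longrightarrow> s \<in> {0..1} \<Longrightarrow> t \<in> {0..1} \<Longrightarrow> \<bar>s - t\<bar> \<le> 1 / n \<Longrightarrow> d (p s) (p t) < \<epsilon>"
proof -
  obtain \<delta> where \<delta>: "\<delta> > 0" "\<And>s t. s \<in> {0..1} \<Longrightarrow> t \<in> {0..1} \<Longrightarrow> dist s t < \<delta> \<Longrightarrow> d (p s) (p t) < \<epsilon>"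
    using uniform_modulus[of "{0..1::real}" p \<epsilon>] assms by (auto simp: path_in_alt)
  obtain N :: nat where N: "1 / \<delta> < N" using reals_Archimedean2 by blast
  then have N0: "real N > 0" using \<delta>(1) by (meson divide_pos_pos less_trans zero_less_one)
  show ?thesis
  proof (rule that)
    show "N > 0" using N0 by simp
    fix n and s t :: real assume *: "n \<ge> N" "s \<in> {0..1}" "t \<in> {0..1}" "\<bar>s - t\<bar> \<le> 1 / n"
    have "1 / real n \<le> 1 / real N" using *(1) N0 by (intro divide_left_mono) auto
    also have "\<dots> < \<delta>" using N N0 \<delta>(1) by (simp add: field_simps)
    finally show "d (p s) (p t) < \<epsilon>" using * by (intro \<delta>(2)) (auto simp: dist_real_def)
  qed
qed

lemma grid_points: "n > 0 \<Longrightarrow> i \<le> n \<Longrightarrow> real i / real n \<in> {0..1}"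
  by auto

lemma grid_dist: "n > 0 \<Longrightarrow> \<bar>real (Suc i) / real n - real i / real n\<bar> \<le> 1 / real n"
  by (simp flip: diff_divide_distrib)

lemma grid_segment_in_ball:
  fixes i n :: nat
  assumes "path_in X p" "n > 0" "i < n"
    "\<And>s t. s \<in> {0..1} \<Longrightarrow> t \<in> {0..1} \<Longrightarrow> \<bar>s - t\<bar> \<le> 1 / n \<Longrightarrow> d (p s) (p t) < \<epsilon>"
  shows "path_in (mball (p (i / n)) \<epsilon>) (segment_path (i / n) (Suc i / n) p)"
proof (rule path_in_segment_pathI[OF assms(1)])
  show 0: "0 \<le> real i / n" and "real i / n \<le> real (Suc i) / n" and 1: "real (Suc i) / n \<le> 1"
    using assms(2,3) grid_points[of n "Suc i"] by (auto simp: divide_right_mono)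
  fix t assume t: "real i / n \<le> t" "t \<le> real (Suc i) / n"
  have "t \<in> {0..1}" using order_trans[OF 0 t(1)] order_trans[OF t(2) 1] by simp
  moreover have "\<bar>real i / n - t\<bar> \<le> 1 / n" using t grid_dist[OF assms(2), of i] by linarith
  ultimately have "d (p (i / n)) (p t) < \<epsilon>" using assms(3,2) by (intro assms(4) grid_points) auto
  then show "p t \<in> mball (p (i / n)) \<epsilon>"
    using assms(1) \<open>t \<in> {0..1}\<close> grid_points[of n i] assms(2,3) by (auto simp: path_in_alt)
qed

lemma path_in_mball_trans:
  assumes "path_in (mball y r) p" "x \<in> X" "d x y + r \<le> R"
  shows "path_in (mball x R) p"
proof (rule path_in_mono[OF assms(1)], rule subsetI)
  fix w assume w: "w \<in> mball y r"
  then have "d x w \<le> d x y + d y w" using assms(2) by (intro triangle) auto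
  then show "w \<in> mball x R" using w assms(2,3) by simp
qed

end

locale small_loops = polish_subspace X d e + path_character H X \<kappa>
  for X :: "'a::topological_space set" and d e and H :: "('h, 'm) monoid_scheme" (structure) and \<kappa> +
  assumes lpc: "locally path_connected X"
    and small: "\<And>x. x \<in> X \<Longrightarrow> \<exists>\<epsilon>>0. \<forall>p. path_in (mball x \<epsilon>) p \<longrightarrow> pathstart p = x \<longrightarrow> pathfinish p = x \<longrightarrow> \<kappa> p = \<one>"
begin

lemma path_connected_nhd:
  assumes "x \<in> X" "\<epsilon> > 0"
  obtains V where "openin mtopology V" "path_connected V" "x \<in> V" "V \<subseteq> mball x \<epsilon>"
proof -
  have "openin (top_of_set X) (mball x \<epsilon>)" "x \<in> mball x \<epsilon>"
    using assms openin_mball_X by auto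
  then have "\<exists>V. openin (top_of_set X) V \<and> path_connected V \<and> x \<in> V \<and> V \<subseteq> mball x \<epsilon>"
    using lpc[unfolded locally_path_connected] by blast
  then show ?thesis using that unfolding mtopology by metis
qed

lemma compactin_mtopology: "compact C \<Longrightarrow> C \<subseteq> X \<Longrightarrow> compactin mtopology C"
  unfolding mtopology by (simp add: compactin_subtopology)

text \<open>The assumption on small loops concerns loops based at the centre of a ball. In a path
  connected neighbourhood, any other loop is conjugate to one based at the centre, so its value is
  trivial too; a Lebesgue number then gives one radius for all of \<open>C\<close>.\<close>

lemma uniform_small_loops:
  assumes C: "compact C" "C \<subseteq> X"
  obtains \<epsilon> where "\<epsilon> > 0" "\<And>y p. y \<in> C \<Longrightarrow> path_in (mball y \<epsilon>) p \<Longrightarrow> pathfinish p = pathstart p \<Longrightarrow> \<kappa> p = \<one>"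
proof -
  have "\<exists>V. openin mtopology V \<and> path_connected V \<and> x \<in> V \<and>
      (\<forall>p. path_in V p \<longrightarrow> pathstart p = x \<longrightarrow> pathfinish p = x \<longrightarrow> \<kappa> p = \<one>)" if x: "x \<in> X" for x
  proof -
    obtain \<epsilon> where \<epsilon>: "\<epsilon> > 0" "\<And>p. path_in (mball x \<epsilon>) p \<Longrightarrow> pathstart p = x \<Longrightarrow> pathfinish p = x \<Longrightarrow> \<kappa> p = \<one>"
      using small[OF x] by blast
    obtain V where V: "openin mtopology V" "path_connected V" "x \<in> V" "V \<subseteq> mball x \<epsilon>"
      using path_connected_nhd[OF x \<epsilon>(1)] .
    have "\<kappa> p = \<one>" if "path_in V p" "pathstart p = x" "pathfinish p = x" for p
      using \<epsilon>(2)[OF path_in_mono[OF that(1) V(4)] that(2,3)] .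
    with V show ?thesis by metis
  qed
  then obtain V where V: "\<And>x. x \<in> X \<Longrightarrow> openin mtopology (V x)" "\<And>x. x \<in> X \<Longrightarrow> path_connected (V x)"
    "\<And>x. x \<in> X \<Longrightarrow> x \<in> V x"
    "\<And>x p. x \<in> X \<Longrightarrow> path_in (V x) p \<Longrightarrow> pathstart p = x \<Longrightarrow> pathfinish p = x \<Longrightarrow> \<kappa> p = \<one>" by metis
  have cover: "C \<subseteq> \<Union>(V ` C)" "\<And>U. U \<in> V ` C \<Longrightarrow> openin mtopology U"
    using V(1,3) C(2) by blast+
  obtain \<epsilon> where \<epsilon>: "\<epsilon> > 0" "\<And>y. y \<in> C \<Longrightarrow> \<exists>U\<in>V ` C. mball y \<epsilon> \<subseteq> U"
    using lebesgue_number[OF compactin_mtopology[OF C] cover] by metis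
  show ?thesis
  proof (rule that[OF \<epsilon>(1)])
    fix y p assume y: "y \<in> C" and p: "path_in (mball y \<epsilon>) p" "pathfinish p = pathstart p"
    obtain x where x: "x \<in> C" "mball y \<epsilon> \<subseteq> V x" using \<epsilon>(2)[OF y] by blast
    have xX: "x \<in> X" using x C by blast
    have VX: "V x \<subseteq> X" using openin_subset[OF V(1)[OF xX]] by simp
    have pV: "path_in (V x) p" using p(1) x(2) by (rule path_in_mono)
    then have "pathstart p \<in> V x" by (rule path_in_pathstart)
    then obtain \<sigma> where \<sigma>: "path_in (V x) \<sigma>" "pathstart \<sigma> = x" "pathfinish \<sigma> = pathstart p"
      using V(2,3)[OF xX] unfolding path_connected_def path_in_def by metis
    have X: "path_in X p" "path_in X \<sigma>" using path_in_mono[OF pV VX] path_in_mono[OF \<sigma>(1) VX] by auto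
    have "\<kappa> ((\<sigma> +++ p) +++ reversepath \<sigma>) = \<one>"
      using \<sigma> pV p(2) by (intro V(4)[OF xX]) simp_all
    then have "(\<kappa> \<sigma> \<otimes> \<kappa> p) \<otimes> inv \<kappa> \<sigma> = \<one>"
      using X \<sigma> p(2) by (simp add: join)
    then have "\<kappa> \<sigma> \<otimes> \<kappa> p = \<kappa> \<sigma>"
      using X by (metis closed inv_closed inv_equality inv_inv m_closed)
    then show "\<kappa> p = \<one>" using X by (simp add: r_cancel_one)
  qed
qed

lemma uniform_connecting_paths:
  assumes C: "compact C" "C \<subseteq> X" and \<eta>: "\<eta> > 0"
  obtains \<delta> where "\<delta> > 0" "\<And>y z. y \<in> C \<Longrightarrow> z \<in> X \<Longrightarrow> d y z < \<delta> \<Longrightarrow>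
    \<exists>p. path_in (mball y \<eta>) p \<and> pathstart p = y \<and> pathfinish p = z"
proof -
  \<comment> \<open>Half of \<eta>, because \<open>V\<close> is centred at \<open>x\<close> whereas
    the ball in the conclusion is centred at the point \<open>y\<close> of \<open>V\<close>.\<close>
  have "\<exists>V. openin mtopology V \<and> path_connected V \<and> x \<in> V \<and> V \<subseteq> mball x (\<eta> / 2)" if x: "x \<in> X" for x
    using path_connected_nhd[OF x, of "\<eta> / 2"] \<eta> by (metis half_gt_zero)
  then obtain V where V: "\<And>x. x \<in> X \<Longrightarrow> openin mtopology (V x)" "\<And>x. x \<in> X \<Longrightarrow> path_connected (V x)"
    "\<And>x. x \<in> X \<Longrightarrow> x \<in> V x" "\<And>x. x \<in> X \<Longrightarrow> V x \<subseteq> mball x (\<eta> / 2)" by metis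
  have cover: "C \<subseteq> \<Union>(V ` C)" "\<And>U. U \<in> V ` C \<Longrightarrow> openin mtopology U"
    using V(1,3) C(2) by blast+
  obtain \<delta> where \<delta>: "\<delta> > 0" "\<And>y. y \<in> C \<Longrightarrow> \<exists>U\<in>V ` C. mball y \<delta> \<subseteq> U"
    using lebesgue_number[OF compactin_mtopology[OF C] cover] by metis
  show ?thesis
  proof (rule that[OF \<delta>(1)])
    fix y z assume y: "y \<in> C" and z: "z \<in> X" "d y z < \<delta>"
    obtain x where x: "x \<in> C" "mball y \<delta> \<subseteq> V x" using \<delta>(2)[OF y] by blast
    have xX: "x \<in> X" and yX: "y \<in> X" using x y C by blast+
    have "y \<in> mball y \<delta>" "z \<in> mball y \<delta>" using yX z \<delta>(1) by auto
    then have "y \<in> V x" "z \<in> V x" using x(2) by blast+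
    then obtain p where p: "path_in (V x) p" "pathstart p = y" "pathfinish p = z"
      using V(2)[OF xX] unfolding path_connected_def path_in_def by metis
    have "y \<in> mball x (\<eta> / 2)" using \<open>y \<in> V x\<close> V(4)[OF xX] by blast
    then have yx: "d y x < \<eta> / 2" by (simp add: commute)
    have "mball x (\<eta> / 2) \<subseteq> mball y \<eta>"
    proof
      fix w assume w: "w \<in> mball x (\<eta> / 2)"
      then have "d y w \<le> d y x + d x w" using xX yX by (intro triangle) auto
      then show "w \<in> mball y \<eta>" using w yx yX by simp
    qed
    then have "path_in (mball y \<eta>) p"
      using path_in_mono[OF path_in_mono[OF p(1) V(4)[OF xX]]] by simp
    then show "\<exists>p. path_in (mball y \<eta>) p \<and> pathstart p = y \<and> pathfinish p = z" using p by metis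
  qed
qed

lemma small_square:
  assumes "\<And>p. path_in B p \<Longrightarrow> pathfinish p = pathstart p \<Longrightarrow> \<kappa> p = \<one>" "B \<subseteq> X"
    "path_in B p" "path_in B q" "path_in B s" "path_in B s'"
    "pathfinish p = pathstart s'" "pathfinish s' = pathfinish q" "pathstart q = pathfinish s"
    "pathstart s = pathstart p"
  shows "\<kappa> p \<otimes> \<kappa> s' = \<kappa> s \<otimes> \<kappa> q"
  using assms by (intro square) (auto intro: path_in_mono)

text \<open>The two paths are the sides of a ladder whose rungs are short paths between them at the
  grid points. Each cell lies in a ball in which loops have trivial value, so its square
  commutes.\<close>

lemma eq_of_uniformly_close:
  assumes "path_in X p"
  obtains \<delta> where "\<delta> > 0" "\<And>q. path_in X q \<Longrightarrow> pathstart q = pathstart p \<Longrightarrow> pathfinish q = pathfinish p \<Longrightarrow>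
    (\<And>t. t \<in> {0..1} \<Longrightarrow> d (p t) (q t) < \<delta>) \<Longrightarrow> \<kappa> q = \<kappa> p"
proof -
  have pX: "p t \<in> X" if "t \<in> {0..1}" for t using assms that by (auto simp: path_in_alt)
  have C: "compact (path_image p)" "path_image p \<subseteq> X" using assms by (auto simp: path_in_def compact_path_image)
  obtain \<epsilon> where \<epsilon>: "\<epsilon> > 0" "\<And>y p'. y \<in> path_image p \<Longrightarrow> path_in (mball y \<epsilon>) p' \<Longrightarrow> pathfinish p' = pathstart p' \<Longrightarrow> \<kappa> p' = \<one>"
    using uniform_small_loops[OF C] by metis
  obtain \<delta>0 where \<delta>0: "\<delta>0 > 0" "\<And>y z. y \<in> path_image p \<Longrightarrow> z \<in> X \<Longrightarrow> d y z < \<delta>0 \<Longrightarrow>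
    \<exists>p. path_in (mball y (\<epsilon> / 4)) p \<and> pathstart p = y \<and> pathfinish p = z"
    using uniform_connecting_paths[OF C, of "\<epsilon> / 4"] \<epsilon>(1) by (metis zero_less_divide_iff zero_less_numeral)
  \<comment> \<open>The first bound provides the rungs. The second keeps each cell in the
    \<epsilon>-ball about \<open>p (g i)\<close>, since the segment of \<open>p\<close> and every
    rung have size at most a quarter of \<epsilon>.\<close>
  define \<delta> where "\<delta> = min \<delta>0 (\<epsilon> / 4)"
  have \<delta>: "\<delta> > 0" "\<delta> \<le> \<delta>0" "\<delta> \<le> \<epsilon> / 4" using \<delta>0 \<epsilon> by (auto simp: \<delta>_def)
  obtain n :: nat where n: "n > 0"
    "\<And>s t. s \<in> {0..1} \<Longrightarrow> t \<in> {0..1} \<Longrightarrow> \<bar>s - t\<bar> \<le> 1 / n \<Longrightarrow> d (p s) (p t) < \<epsilon> / 4"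
    using path_modulus[OF assms, of "\<epsilon> / 4"] \<epsilon>(1) by (metis order_refl zero_less_divide_iff zero_less_numeral)
  show ?thesis
  proof (rule that[OF \<delta>(1)])
    fix q assume q: "path_in X q" "pathstart q = pathstart p" "pathfinish q = pathfinish p"
      and close: "\<And>t. t \<in> {0..1} \<Longrightarrow> d (p t) (q t) < \<delta>"
    have qX: "q t \<in> X" if "t \<in> {0..1}" for t using q that by (auto simp: path_in_alt)
    have im: "p t \<in> path_image p" if "t \<in> {0..1}" for t using that by (auto simp: path_image_def)
    define g where "g i = real i / real n" for i
    have g: "g i \<in> {0..1}" if "i \<le> n" for i using grid_points[OF n(1) that] by (simp add: g_def)
    have "\<exists>\<sigma>. path_in (mball (p (g i)) (\<epsilon> / 4)) \<sigma> \<and> pathstart \<sigma> = p (g i) \<and> pathfinish \<sigma> = q (g i)" if i: "i \<le> n" for i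
      using close[OF g[OF i]] \<delta>(2) by (intro \<delta>0(2) im qX g i) linarith
    then obtain \<sigma> where \<sigma>: "\<And>i. i \<le> n \<Longrightarrow> path_in (mball (p (g i)) (\<epsilon> / 4)) (\<sigma> i)"
      "\<And>i. i \<le> n \<Longrightarrow> pathstart (\<sigma> i) = p (g i)" "\<And>i. i \<le> n \<Longrightarrow> pathfinish (\<sigma> i) = q (g i)" by metis
    have \<sigma>X: "path_in X (\<sigma> i)" if "i \<le> n" for i using \<sigma>(1)[OF that] mball_subset_mspace by (rule path_in_mono)
    define a b s where "a i = \<kappa> (segment_path (g i) (g (Suc i)) p)" and
      "b i = \<kappa> (segment_path (g i) (g (Suc i)) q)" and "s i = \<kappa> (\<sigma> i)" for i
    have sq: "a i \<otimes> s (Suc i) = s i \<otimes> b i" if i: "i < n" for i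
      unfolding a_def b_def s_def
    proof (rule small_square[where B = "mball (p (g i)) \<epsilon>"])
      have i': "i \<le> n" "Suc i \<le> n" using i by auto
      have pgi: "p (g i) \<in> X" "p (g (Suc i)) \<in> X" using pX g i' by auto
      have dpp: "d (p (g i)) (p (g (Suc i))) < \<epsilon> / 4"
        using grid_dist[OF n(1), of i] by (intro n(2) g i') (simp add: g_def abs_minus_commute)
      show "\<kappa> r = \<one>" if "path_in (mball (p (g i)) \<epsilon>) r" "pathfinish r = pathstart r" for r
        using \<epsilon>(2)[OF im[OF g[OF i'(1)]]] that by blast
      show "mball (p (g i)) \<epsilon> \<subseteq> X" by auto
      have "path_in (mball (p (g i)) (\<epsilon> / 4)) (segment_path (g i) (g (Suc i)) p)"
        unfolding g_def using assms n i by (intro grid_segment_in_ball) auto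
      then show "path_in (mball (p (g i)) \<epsilon>) (segment_path (g i) (g (Suc i)) p)"
        using \<epsilon>(1) pgi by (rule_tac path_in_mball_trans) auto
      show "path_in (mball (p (g i)) \<epsilon>) (segment_path (g i) (g (Suc i)) q)"
      proof (rule path_in_segment_pathI[OF q(1)])
        show "0 \<le> g i" "g i \<le> g (Suc i)" "g (Suc i) \<le> 1" using g i' by (auto simp: g_def divide_right_mono)
        fix t assume t: "g i \<le> t" "t \<le> g (Suc i)"
        then have t01: "t \<in> {0..1}" using g[OF i'(1)] g[OF i'(2)] by auto
        have "\<bar>g i - t\<bar> \<le> 1 / n" using t grid_dist[OF n(1), of i] unfolding g_def by linarith
        then have "d (p (g i)) (p t) < \<epsilon> / 4" using g[OF i'(1)] t01 by (intro n(2))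
        moreover have "d (p t) (q t) < \<epsilon> / 4" using close[OF t01] \<delta>(3) by linarith
        moreover have "d (p (g i)) (q t) \<le> d (p (g i)) (p t) + d (p t) (q t)"
          using pgi pX[OF t01] qX[OF t01] by (intro triangle)
        ultimately show "q t \<in> mball (p (g i)) \<epsilon>" using pgi qX[OF t01] \<epsilon>(1) by simp
      qed
      show "path_in (mball (p (g i)) \<epsilon>) (\<sigma> i)"
        using \<sigma>(1)[OF i'(1)] pgi \<epsilon>(1) by (rule_tac path_in_mball_trans) auto
      show "path_in (mball (p (g i)) \<epsilon>) (\<sigma> (Suc i))"
        using \<sigma>(1)[OF i'(2)] pgi \<epsilon>(1) dpp by (rule_tac path_in_mball_trans) auto
    qed (use i \<sigma> in auto)
    have seg: "path_in X (segment_path (g i) (g (Suc i)) r)" if "path_in X r" "i < n" for i r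
      using that g[of i] g[of "Suc i"] by (intro path_in_segment_path) auto
    have "gprod H a n \<otimes> s n = s 0 \<otimes> gprod H b n"
      by (rule gprod_ladder) (use sq seg assms q(1) \<sigma>X in \<open>auto simp: a_def b_def s_def\<close>)
    moreover have "gprod H a n = \<kappa> p"
      unfolding grid[OF assms n(1)] by (rule gprod_cong) (simp only: a_def g_def)
    moreover have "gprod H b n = \<kappa> q"
      unfolding grid[OF q(1) n(1)] by (rule gprod_cong) (simp only: b_def g_def)
    \<comment> \<open>The paths agree at both ends, so the outer rungs are themselves small
      loops.\<close>
    moreover have "s i = \<one>" if "i = 0 \<or> i = n" for i
    proof -
      have "q (g i) = p (g i)" using that q(2,3) n(1) by (auto simp: g_def pathstart_def pathfinish_def)
      moreover have "path_in (mball (p (g i)) \<epsilon>) (\<sigma> i)"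
        using path_in_mball_trans[OF \<sigma>(1)[of i], of "p (g i)" \<epsilon>] pX[OF g[of i]] \<epsilon>(1) that by auto
      ultimately show ?thesis
        unfolding s_def using that \<sigma> by (intro \<epsilon>(2)[OF im[OF g[of i]]]) auto
    qed
    ultimately show "\<kappa> q = \<kappa> p" using assms q(1) by simp
  qed
qed

end

context polish_based_space begin

text \<open>A tube argument: finitely many time intervals cover the unit interval, and the largest
  of their depths works for all times.\<close>

lemma family_uniformly_close:
  fixes K :: "(nat \<Rightarrow> nat) set"
  assumes F: "family K F" and z: "z \<in> K" and \<delta>: "\<delta> > 0"
  obtains n where "\<And>w t. w \<in> K \<Longrightarrow> w \<in> cyl z n \<Longrightarrow> t \<in> {0..1} \<Longrightarrow> d (F z t) (F w t) < \<delta>"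
proof -
  have FX: "F w t \<in> X" if "w \<in> K" "t \<in> {0..1}" for w t using F that by (auto simp: family_def path_in_alt)
  then have im: "(\<lambda>(z, t). F z t) ` (K \<times> {0..1}) \<subseteq> X" by auto
  have c: "continuous_on (K \<times> {0..1}) (\<lambda>(z, t). F z t)" using F by (simp add: family_def)
  have "\<exists>n V. open V \<and> t \<in> V \<and> (\<forall>w\<in>K \<inter> cyl z n. \<forall>s\<in>{0..1} \<inter> V. d (F z t) (F w s) < \<delta> / 2)"
    if t: "t \<in> {0..1}" for t
  proof -
    have zt: "(z, t) \<in> K \<times> {0..1}" using z t by simp
    obtain U where U: "open U" "(z, t) \<in> U" "\<And>y. y \<in> K \<times> {0..1} \<inter> U \<Longrightarrow> d (F z t) ((\<lambda>(z, t). F z t) y) < \<delta> / 2"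
      using c[unfolded continuous_on_iff_d[OF im]] zt \<delta> by (metis (no_types, lifting) case_prod_conv half_gt_zero)
    obtain A V where AV: "open A" "open V" "z \<in> A" "t \<in> V" "A \<times> V \<subseteq> U"
      using open_prod_elim[OF U(1,2)] by (metis mem_Sigma_iff)
    obtain n where n: "cyl z n \<subseteq> A" using open_contains_cyl[OF AV(1,3)] .
    have "d (F z t) (F w s) < \<delta> / 2" if "w \<in> K \<inter> cyl z n" "s \<in> {0..1} \<inter> V" for w s
      using U(3)[of "(w, s)"] that n AV(5) by auto
    then show ?thesis using AV by blast
  qed
  then obtain n V where nV: "\<And>t. t \<in> {0..1} \<Longrightarrow> open (V t)" "\<And>t. t \<in> {0..1} \<Longrightarrow> t \<in> V t"
    "\<And>t w s. t \<in> {0..1} \<Longrightarrow> w \<in> K \<inter> cyl z (n t) \<Longrightarrow> s \<in> {0..1} \<inter> V t \<Longrightarrow> d (F z t) (F w s) < \<delta> / 2" by metis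
  have "compact {0..1::real}" by simp
  then obtain T where T: "T \<subseteq> {0..1}" "finite T" "{0..1} \<subseteq> (\<Union>t\<in>T. V t)"
    using compactE_image[of "{0..1::real}" "{0..1}" V] nV(1,2) by (metis UN_I subsetI)
  define m where "m = Max (insert 0 (n ` T))"
  have m: "n t \<le> m" if "t \<in> T" for t unfolding m_def using T(2) that by (intro Max_ge) auto
  show ?thesis
  proof (rule that[of m])
    fix w s assume w: "w \<in> K" "w \<in> cyl z m" and s: "s \<in> {0..1::real}"
    obtain t where t: "t \<in> T" "s \<in> V t" using T(3) s by blast
    have t01: "t \<in> {0..1}" using t T(1) by blast
    have "cyl z m \<subseteq> cyl z (n t)" using m[OF t(1)] by (auto simp: cyl_def)
    then have "d (F z t) (F w s) < \<delta> / 2" "d (F z t) (F z s) < \<delta> / 2"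
      using nV(3)[OF t01] w s t(2) z cyl_refl by blast+
    moreover have "d (F z s) (F w s) \<le> d (F z t) (F z s) + d (F z t) (F w s)"
      using triangle[of "F z s" "F z t" "F w s"] FX z w s t01 commute[of "F z s" "F z t"] by simp
    ultimately show "d (F z s) (F w s) < \<delta>" by linarith
  qed
qed

end

text \<open>The value at \<open>z\<close> is determined by the finite word \<open>key z\<close>, and
  there are countably many such words. Equal keys have equal length, which places both points in one
  cylinder of the depth required.\<close>

lemma countable_image_locally_constant:
  assumes "\<And>z. z \<in> K \<Longrightarrow> \<exists>n. \<forall>w\<in>K. w \<in> cyl (z :: nat \<Rightarrow> nat) n \<longrightarrow> f w = f z"
  shows "countable (f ` K)"
proof -
  obtain n where n: "\<And>z w. z \<in> K \<Longrightarrow> w \<in> K \<Longrightarrow> w \<in> cyl z (n z) \<Longrightarrow> f w = f z" using assms by metis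
  define key where "key z = map z [0..<n z]" for z
  have key: "f z = f w" if "z \<in> K" "w \<in> K" "key z = key w" for z w
  proof -
    have len: "n z = n w" using arg_cong[OF that(3), of length] by (simp add: key_def)
    have "w i = z i" if "i < n z" for i
      using arg_cong[OF \<open>key z = key w\<close>, of "\<lambda>l. l ! i"] that len by (simp add: key_def)
    then have "w \<in> cyl z (n z)" by (simp add: cyl_def)
    then show ?thesis using n[OF that(1,2)] by simp
  qed
  have "f ` K \<subseteq> (\<lambda>l. f (SOME z. z \<in> K \<and> key z = l)) ` UNIV"
  proof
    fix y assume "y \<in> f ` K"
    then obtain z where z: "z \<in> K" "y = f z" by auto
    then have "\<exists>z'. z' \<in> K \<and> key z' = key z" by blast
    from someI_ex[OF this] have "f (SOME z'. z' \<in> K \<and> key z' = key z) = f z" using key z by blast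
    then show "y \<in> (\<lambda>l. f (SOME z. z \<in> K \<and> key z = l)) ` UNIV"
      using z(2) by (intro image_eqI[of _ _ "key z"]) simp_all
  qed
  then show ?thesis by (rule countable_subset) simp
qed

section \<open>Free groups and presentations\<close>

lemma words_append [simp]: "u @ v \<in> words S \<longleftrightarrow> u \<in> words S \<and> v \<in> words S"
  by (auto simp: words_def)

lemma words_Nil [simp]: "[] \<in> words S" by (simp add: words_def)

lemma words_Cons [simp]: "x # w \<in> words S \<longleftrightarrow> fst x \<in> S \<and> w \<in> words S"
  by (cases x) (auto simp: words_def)

lemma word_cancel_words: "(u, v) \<in> word_cancel S \<Longrightarrow> u \<in> words S \<and> v \<in> words S"
  by (auto simp: word_cancel_def)

lemma word_equiv_words: "(u, v) \<in> word_equiv S \<Longrightarrow> u \<in> words S \<longleftrightarrow> v \<in> words S"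
  unfolding word_equiv_def by (induction rule: rtrancl_induct) (auto dest: word_cancel_words)

lemma word_equiv_refl [simp]: "(u, u) \<in> word_equiv S"
  by (simp add: word_equiv_def)

lemma word_equiv_sym: "(u, v) \<in> word_equiv S \<Longrightarrow> (v, u) \<in> word_equiv S"
proof -
  have "sym (word_equiv S)" unfolding word_equiv_def by (intro sym_rtrancl sym_Un_converse)
  then show "(u, v) \<in> word_equiv S \<Longrightarrow> (v, u) \<in> word_equiv S" by (rule symD)
qed

lemma word_equiv_trans: "(u, v) \<in> word_equiv S \<Longrightarrow> (v, w) \<in> word_equiv S \<Longrightarrow> (u, w) \<in> word_equiv S"
  unfolding word_equiv_def by (rule rtrancl_trans)

lemma word_cancel_context:
  assumes "(u, u') \<in> word_cancel S" "a \<in> words S" "b \<in> words S"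
  shows "(a @ u @ b, a @ u' @ b) \<in> word_cancel S"
proof -
  obtain x y s c where *: "u = x @ [(s, c), (s, \<not> c)] @ y" "u' = x @ y" "x \<in> words S" "y \<in> words S" "s \<in> S"
    using assms(1) by (auto simp: word_cancel_def)
  have "a @ u @ b = (a @ x) @ [(s, c), (s, \<not> c)] @ (y @ b)" "a @ u' @ b = (a @ x) @ (y @ b)"
    using * by simp_all
  moreover have "a @ x \<in> words S" "y @ b \<in> words S" using * assms by simp_all
  ultimately show ?thesis using *(5) unfolding word_cancel_def by blast
qed

lemma word_equiv_context:
  assumes "(u, u') \<in> word_equiv S" "a \<in> words S" "b \<in> words S"
  shows "(a @ u @ b, a @ u' @ b) \<in> word_equiv S"
  using assms(1) unfolding word_equiv_def
proof (induction rule: rtrancl_induct)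
  case (step y z)
  then have "(a @ y @ b, a @ z @ b) \<in> word_cancel S \<union> (word_cancel S)\<inverse>"
    using word_cancel_context[OF _ assms(2,3)] by auto
  with step show ?case by (meson rtrancl.rtrancl_into_rtrancl)
qed simp

lemma word_equiv_append:
  assumes "(u, u') \<in> word_equiv S" "(v, v') \<in> word_equiv S" "u \<in> words S" "v \<in> words S"
  shows "(u @ v, u' @ v') \<in> word_equiv S"
proof -
  have "(u @ v, u' @ v) \<in> word_equiv S" using word_equiv_context[OF assms(1), of "[]" v] assms by simp
  moreover have "(u' @ v, u' @ v') \<in> word_equiv S"
    using word_equiv_context[OF assms(2), of u' "[]"] assms word_equiv_words[OF assms(1)] by simp
  ultimately show ?thesis by (rule word_equiv_trans)
qed

definition wcl :: "'s set \<Rightarrow> ('s \<times> bool) list \<Rightarrow> ('s \<times> bool) list set" where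
  "wcl S w = word_equiv S `` {w}"

lemma wcl_eq_iff: "wcl S u = wcl S v \<longleftrightarrow> (u, v) \<in> word_equiv S"
proof
  assume "wcl S u = wcl S v"
  moreover have "v \<in> wcl S v" by (simp add: wcl_def)
  ultimately have "v \<in> wcl S u" by blast
  then show "(u, v) \<in> word_equiv S" by (simp add: wcl_def)
next
  assume "(u, v) \<in> word_equiv S"
  then show "wcl S u = wcl S v"
    using word_equiv_trans word_equiv_sym unfolding wcl_def by blast
qed

lemma carrier_free_group: "carrier (free_group S) = wcl S ` words S"
  by (auto simp: free_group_def quotient_def wcl_def)

lemma one_free_group: "\<one>\<^bsub>free_group S\<^esub> = wcl S []"
  by (simp add: free_group_def wcl_def)

lemma mult_free_group:
  assumes "u \<in> words S" "v \<in> words S"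
  shows "wcl S u \<otimes>\<^bsub>free_group S\<^esub> wcl S v = wcl S (u @ v)"
proof -
  have "wcl S u \<otimes>\<^bsub>free_group S\<^esub> wcl S v = word_equiv S `` {u' @ v' |u' v'. u' \<in> wcl S u \<and> v' \<in> wcl S v}"
    by (simp add: free_group_def)
  also have "\<dots> = wcl S (u @ v)"
  proof (rule Set.set_eqI, rule iffI)
    fix w assume "w \<in> word_equiv S `` {u' @ v' |u' v'. u' \<in> wcl S u \<and> v' \<in> wcl S v}"
    then obtain u' v' where "(u, u') \<in> word_equiv S" "(v, v') \<in> word_equiv S" "(u' @ v', w) \<in> word_equiv S"
      by (auto simp: wcl_def)
    then show "w \<in> wcl S (u @ v)"
      using word_equiv_append[OF _ _ assms] word_equiv_trans unfolding wcl_def by blast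
  next
    fix w assume "w \<in> wcl S (u @ v)"
    moreover have "u \<in> wcl S u" "v \<in> wcl S v" by (simp_all add: wcl_def)
    ultimately show "w \<in> word_equiv S `` {u' @ v' |u' v'. u' \<in> wcl S u \<and> v' \<in> wcl S v}"
      unfolding wcl_def by blast
  qed
  finally show ?thesis .
qed

definition winv :: "('s \<times> bool) list \<Rightarrow> ('s \<times> bool) list" where
  "winv w = rev (map (\<lambda>(s, b). (s, \<not> b)) w)"

lemma winv_words [simp]: "winv w \<in> words S \<longleftrightarrow> w \<in> words S"
  by (induction w) (auto simp: winv_def split: prod.splits)

lemma winv_cancel: "w \<in> words S \<Longrightarrow> (winv w @ w, []) \<in> word_equiv S"
proof (induction w)
  case (Cons x w)
  obtain s b where x: "x = (s, b)" by (cases x)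
  have s: "s \<in> S" "w \<in> words S" using Cons.prems x by simp_all
  have eq: "winv (x # w) @ x # w = winv w @ [(s, \<not> b), (s, \<not> \<not> b)] @ w" by (simp add: winv_def x)
  have "(winv (x # w) @ x # w, winv w @ w) \<in> word_cancel S"
    unfolding eq word_cancel_def using s
    by (intro CollectI exI[of _ "winv w"] exI[of _ w] exI[of _ s] exI[of _ "\<not> b"] conjI refl) simp_all
  then have "(winv (x # w) @ x # w, winv w @ w) \<in> word_equiv S"
    by (auto simp: word_equiv_def)
  then show ?case using Cons.IH[OF s(2)] by (rule word_equiv_trans)
qed (simp add: winv_def)

lemma group_free_group: "group (free_group S)"
proof (rule groupI)
  fix x y assume "x \<in> carrier (free_group S)" "y \<in> carrier (free_group S)"
  then show "x \<otimes>\<^bsub>free_group S\<^esub> y \<in> carrier (free_group S)"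
    by (auto simp: carrier_free_group mult_free_group)
next
  fix x y z assume "x \<in> carrier (free_group S)" "y \<in> carrier (free_group S)" "z \<in> carrier (free_group S)"
  then show "x \<otimes>\<^bsub>free_group S\<^esub> y \<otimes>\<^bsub>free_group S\<^esub> z = x \<otimes>\<^bsub>free_group S\<^esub> (y \<otimes>\<^bsub>free_group S\<^esub> z)"
    by (auto simp: carrier_free_group mult_free_group)
next
  fix x assume x: "x \<in> carrier (free_group S)"
  then show "\<one>\<^bsub>free_group S\<^esub> \<otimes>\<^bsub>free_group S\<^esub> x = x"
    by (auto simp: carrier_free_group mult_free_group one_free_group)
  obtain w where w: "w \<in> words S" "x = wcl S w" using x by (auto simp: carrier_free_group)
  then have "wcl S (winv w) \<otimes>\<^bsub>free_group S\<^esub> x = \<one>\<^bsub>free_group S\<^esub>"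
    using winv_cancel by (simp add: mult_free_group one_free_group wcl_eq_iff)
  then show "\<exists>y\<in>carrier (free_group S). y \<otimes>\<^bsub>free_group S\<^esub> x = \<one>\<^bsub>free_group S\<^esub>"
    using w by (auto simp: carrier_free_group)
qed (auto simp: carrier_free_group one_free_group)

lemma inv_free_group: "w \<in> words S \<Longrightarrow> inv\<^bsub>free_group S\<^esub> (wcl S w) = wcl S (winv w)"
  using winv_cancel
  by (intro group.inv_equality[OF group_free_group])
     (auto simp: mult_free_group one_free_group wcl_eq_iff carrier_free_group)

lemma countable_free_group: "countable S \<Longrightarrow> countable (carrier (free_group S))"
  unfolding carrier_free_group words_def
  by (intro countable_image countable_lists countable_SIGMA) auto

definition letter :: "'s set \<Rightarrow> 's \<Rightarrow> ('s \<times> bool) list set" where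
  "letter S s = wcl S [(s, True)]"

lemma letter_closed [simp]: "s \<in> S \<Longrightarrow> letter S s \<in> carrier (free_group S)"
  by (simp add: letter_def carrier_free_group)

lemma hom_free_group_eqI:
  assumes "group G" "\<phi> \<in> hom (free_group S) G" "\<psi> \<in> hom (free_group S) G"
    "\<And>s. s \<in> S \<Longrightarrow> \<phi> (letter S s) = \<psi> (letter S s)" "x \<in> carrier (free_group S)"
  shows "\<phi> x = \<psi> x"
proof -
  interpret \<phi>: group_hom "free_group S" G \<phi>
    using assms group_free_group by (simp add: group_hom_def group_hom_axioms_def)
  interpret \<psi>: group_hom "free_group S" G \<psi>
    using assms group_free_group by (simp add: group_hom_def group_hom_axioms_def)
  have "\<phi> (wcl S w) = \<psi> (wcl S w)" if "w \<in> words S" for w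
    using that
  proof (induction w)
    case Nil
    then show ?case using \<phi>.hom_one \<psi>.hom_one by (simp add: one_free_group)
  next
    case (Cons x w)
    obtain s b where x: "x = (s, b)" by (cases x)
    have s: "s \<in> S" "w \<in> words S" using Cons.prems x by simp_all
    have c: "wcl S [x] \<in> carrier (free_group S)" "wcl S w \<in> carrier (free_group S)"
      using s x by (auto simp: carrier_free_group)
    have "wcl S [x] = (if b then letter S s else inv\<^bsub>free_group S\<^esub> (letter S s))"
      using s by (simp add: x letter_def inv_free_group winv_def)
    then have "\<phi> (wcl S [x]) = \<psi> (wcl S [x])"
      using assms(4)[OF s(1)] letter_closed[OF s(1)] by simp
    moreover have "wcl S (x # w) = wcl S [x] \<otimes>\<^bsub>free_group S\<^esub> wcl S w"
      using s x by (simp add: mult_free_group)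
    ultimately show ?case using Cons.IH[OF s(2)] c by simp
  qed
  then show ?thesis using assms(5) by (auto simp: carrier_free_group)
qed

context group begin

primrec word_eval :: "('s \<Rightarrow> 'a) \<Rightarrow> ('s \<times> bool) list \<Rightarrow> 'a" where
  "word_eval f [] = \<one>"
| "word_eval f (x # w) = (if snd x then f (fst x) else inv (f (fst x))) \<otimes> word_eval f w"

lemma word_eval_closed: "f ` S \<subseteq> carrier G \<Longrightarrow> w \<in> words S \<Longrightarrow> word_eval f w \<in> carrier G"
  by (induction w) auto

lemma word_eval_append:
  assumes "f ` S \<subseteq> carrier G" "u \<in> words S" "v \<in> words S"
  shows "word_eval f (u @ v) = word_eval f u \<otimes> word_eval f v"
  using assms(2)
proof (induction u)
  case (Cons x u)
  then have "f (fst x) \<in> carrier G" "word_eval f u \<in> carrier G" "word_eval f v \<in> carrier G"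
    using assms(1,3) word_eval_closed[OF assms(1)] by auto
  with Cons show ?case by (simp add: m_assoc)
qed (use assms word_eval_closed[OF assms(1)] in simp)

lemma word_eval_cancel:
  assumes "f ` S \<subseteq> carrier G" "(u, v) \<in> word_cancel S"
  shows "word_eval f u = word_eval f v"
proof -
  obtain x y s c where *: "u = x @ [(s, c), (s, \<not> c)] @ y" "v = x @ y" "x \<in> words S" "y \<in> words S" "s \<in> S"
    using assms(2) by (auto simp: word_cancel_def)
  have fs: "f s \<in> carrier G" using assms(1) *(5) by auto
  have "word_eval f ([(s, c), (s, \<not> c)] @ y) = word_eval f y"
    using fs word_eval_closed[OF assms(1) *(4)] by (auto simp flip: m_assoc)
  then show ?thesis using * word_eval_append[OF assms(1), of x] by simp
qed

lemma word_eval_equiv: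
  assumes "f ` S \<subseteq> carrier G" "(u, v) \<in> word_equiv S"
  shows "word_eval f u = word_eval f v"
  using assms(2) unfolding word_equiv_def
  by (induction rule: rtrancl_induct) (auto dest: word_eval_cancel[OF assms(1)])

lemma free_group_lift:
  assumes "f ` S \<subseteq> carrier G"
  obtains \<Phi> where "\<Phi> \<in> hom (free_group S) G" "\<And>s. s \<in> S \<Longrightarrow> \<Phi> (letter S s) = f s"
proof -
  define \<Phi> where "\<Phi> A = word_eval f (SOME w. w \<in> words S \<and> A = wcl S w)" for A
  have \<Phi>: "\<Phi> (wcl S w) = word_eval f w" if "w \<in> words S" for w
  proof -
    have "\<exists>w'. w' \<in> words S \<and> wcl S w = wcl S w'" using that by blast
    from someI_ex[OF this] have "(w, SOME w'. w' \<in> words S \<and> wcl S w = wcl S w') \<in> word_equiv S"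
      by (simp add: wcl_eq_iff)
    from word_eval_equiv[OF assms this] show ?thesis by (simp add: \<Phi>_def)
  qed
  show ?thesis
  proof (rule that)
    show "\<Phi> \<in> hom (free_group S) G"
      by (rule homI) (auto simp: carrier_free_group \<Phi> mult_free_group word_eval_append[OF assms] word_eval_closed[OF assms])
    show "\<Phi> (letter S s) = f s" if "s \<in> S" for s
      using that assms by (auto simp: letter_def \<Phi>)
  qed
qed

end

text \<open>A presentation is recognised by a left inverse of the evaluation map modulo the relators.\<close>

lemma presentation_isoI:
  fixes S :: "'s set"
  assumes "group G" "\<Phi> \<in> hom (free_group S) G" "\<Phi> ` carrier (free_group S) = carrier G"
    and R: "R \<subseteq> carrier (free_group S)" "\<And>r. r \<in> R \<Longrightarrow> \<Phi> r = \<one>\<^bsub>G\<^esub>"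
    and \<psi>: "\<psi> \<in> hom G (free_group S Mod normal_closure (free_group S) R)"
      "\<And>s. s \<in> S \<Longrightarrow> \<psi> (\<Phi> (letter S s)) = normal_closure (free_group S) R #>\<^bsub>free_group S\<^esub> letter S s"
  shows "G \<cong> free_group S Mod normal_closure (free_group S) R"
proof -
  let ?F = "free_group S" and ?N = "normal_closure (free_group S) R"
  interpret F: group ?F by (rule group_free_group)
  interpret \<Phi>: group_hom ?F G \<Phi> using assms(1,2) group_free_group by (simp add: group_hom_def group_hom_axioms_def)
  interpret N: normal ?N ?F using F.normal_closure_normal[OF R(1)] .
  have ker: "kernel ?F G \<Phi> = ?N"
  proof
    show "?N \<subseteq> kernel ?F G \<Phi>"
      using R by (intro F.normal_closure_minimal \<Phi>.normal_kernel) (auto simp: kernel_def)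
    show "kernel ?F G \<Phi> \<subseteq> ?N"
    proof
      fix x assume "x \<in> kernel ?F G \<Phi>"
      then have x: "x \<in> carrier ?F" "\<Phi> x = \<one>\<^bsub>G\<^esub>" by (auto simp: kernel_def)
      \<comment> \<open>The two homomorphisms agree on letters and hence everywhere. For
        \<open>x\<close> in the kernel this shows that the coset of \<open>x\<close> is
        trivial.\<close>
      have "(\<psi> \<circ> \<Phi>) x = (#>\<^bsub>?F\<^esub>) ?N x"
      proof (rule hom_free_group_eqI[OF N.factorgroup_is_group _ N.r_coset_hom_Mod _ x(1)])
        show "\<psi> \<circ> \<Phi> \<in> hom ?F (?F Mod ?N)" using assms(2) \<psi>(1) by (rule hom_compose)
      qed (use \<psi>(2) in auto)
      moreover have "\<psi> \<one>\<^bsub>G\<^esub> = \<one>\<^bsub>?F Mod ?N\<^esub>"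
        using assms(1) N.factorgroup_is_group \<psi>(1) by (intro hom_one)
      ultimately have "?N #>\<^bsub>?F\<^esub> x = ?N" using x by simp
      then show "x \<in> ?N" using F.rcos_self[OF x(1) N.subgroup_axioms] by simp
    qed
  qed
  have "?F Mod ?N \<cong> G"
    using \<Phi>.FactGroup_iso assms(3) ker by simp
  then show ?thesis by (intro group.iso_sym[OF N.factorgroup_is_group])
qed

section \<open>Nets and discrete approximation of paths\<close>

text \<open>\<open>v\<close> rounds points to the net. Each of two points moves by less than a third
  of \<delta>, so points closer than \<delta>/3 are rounded to net points closer than \<delta>. Net
  points are fixed, so a path between net points keeps its ends.\<close>

locale net = polish_subspace X d e
  for X :: "'a::topological_space set" and d and e +
  fixes V :: "'a set" and \<delta> :: real and v :: "'a \<Rightarrow> 'a"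
  assumes V: "finite V" "V \<subseteq> X" and \<delta>: "\<delta> > 0"
    and v_in: "\<And>x. x \<in> X \<Longrightarrow> v x \<in> V"
    and v_fix: "\<And>u. u \<in> V \<Longrightarrow> v u = u"
    and v_close: "\<And>x. x \<in> X \<Longrightarrow> d x (v x) < \<delta> / 3"
begin

lemma v_in_X: "x \<in> X \<Longrightarrow> v x \<in> X"
  using v_in V by blast

lemma v_adjacent: "x \<in> X \<Longrightarrow> y \<in> X \<Longrightarrow> d x y < \<delta> / 3 \<Longrightarrow> d (v x) (v y) < \<delta>"
  using triangle[of "v x" x "v y"] triangle[of x y "v y"] v_close[of x] v_close[of y]
    commute[of x "v x"] v_in_X[of x] v_in_X[of y] by simp

definition fine_grid :: "nat \<Rightarrow> (real \<Rightarrow> 'a) \<Rightarrow> bool" where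
  "fine_grid n p \<longleftrightarrow> n > 0 \<and> (\<forall>s\<in>{0..1}. \<forall>t\<in>{0..1}. \<bar>s - t\<bar> \<le> 1 / n \<longrightarrow> d (p s) (p t) < \<delta> / 3)"

lemma eventually_fine_grid: "path_in X p \<Longrightarrow> \<exists>N. \<forall>n\<ge>N. fine_grid n p"
proof -
  assume p: "path_in X p"
  obtain N :: nat where N: "N > 0"
    "\<And>(n::nat) s t. n \<ge> N \<Longrightarrow> s \<in> {0..1} \<Longrightarrow> t \<in> {0..1} \<Longrightarrow> \<bar>s - t\<bar> \<le> 1 / n \<Longrightarrow> d (p s) (p t) < \<delta> / 3"
    using path_modulus[OF p, of "\<delta> / 3"] \<delta> by (metis zero_less_divide_iff zero_less_numeral)
  have "fine_grid n p" if "n \<ge> N" for n :: nat unfolding fine_grid_def using N that by simp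
  then show ?thesis by blast
qed

end

lemma (in polish_subspace) ex_net:
  assumes "compact X" "\<delta> > 0" "x0 \<in> X"
  obtains V v where "net X d e V \<delta> v" "x0 \<in> V"
proof -
  have "compactin mtopology X" using assms(1) mtopology by (simp add: compactin_subtopology)
  then have "mtotally_bounded X" by (rule compactin_imp_mtotally_bounded)
  then obtain K where K: "finite K" "K \<subseteq> X" "X \<subseteq> (\<Union>x\<in>K. mball x (\<delta> / 3))"
    using assms(2) unfolding mtotally_bounded_def by (metis zero_less_divide_iff zero_less_numeral)
  define V where "V = insert x0 K"
  have "\<exists>u\<in>V. (x \<in> V \<longrightarrow> u = x) \<and> d x u < \<delta> / 3" if x: "x \<in> X" for x
  proof (cases "x \<in> V")
    case True
    then show ?thesis using x assms(2) by (intro bexI[of _ x]) auto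
  next
    case False
    obtain u where "u \<in> K" "x \<in> mball u (\<delta> / 3)" using K(3) x by blast
    then show ?thesis using False by (intro bexI[of _ u]) (auto simp: V_def commute)
  qed
  then obtain v where v: "\<And>x. x \<in> X \<Longrightarrow> v x \<in> V" "\<And>x. x \<in> X \<Longrightarrow> x \<in> V \<Longrightarrow> v x = x"
    "\<And>x. x \<in> X \<Longrightarrow> d x (v x) < \<delta> / 3" by metis
  have VX: "V \<subseteq> X" using K assms(3) by (auto simp: V_def)
  have "net X d e V \<delta> v"
    by unfold_locales (use v VX K assms(2) in \<open>auto simp: V_def\<close>)
  then show ?thesis by (rule that) (simp add: V_def)
qed

text \<open>A multiplicative cocycle on the Vietoris-Rips complex of the net at scale \<delta>:
  labels are given for all pairs, but the triangle rule is demanded for short triangles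
  only.\<close>

locale cocycle = net X d e V \<delta> v + group Q
  for X :: "'a::topological_space set" and d e V \<delta> v and Q :: "('q, 'm) monoid_scheme" (structure) +
  fixes g :: "'a \<Rightarrow> 'a \<Rightarrow> 'q"
  assumes g_closed: "\<And>u w. u \<in> V \<Longrightarrow> w \<in> V \<Longrightarrow> g u w \<in> carrier Q"
    and g_triangle: "\<And>u w z. u \<in> V \<Longrightarrow> w \<in> V \<Longrightarrow> z \<in> V \<Longrightarrow> d u w < \<delta> \<Longrightarrow> d w z < \<delta> \<Longrightarrow> d u z < \<delta> \<Longrightarrow>
      g u w \<otimes> g w z = g u z"
begin

definition gv :: "'a \<Rightarrow> 'a \<Rightarrow> 'q" where
  "gv x y = g (v x) (v y)"

definition hn :: "nat \<Rightarrow> (real \<Rightarrow> 'a) \<Rightarrow> 'q" where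
  "hn n p = gprod Q (\<lambda>i. gv (p (i / n)) (p (Suc i / n))) n"

lemma gv_closed [simp]: "x \<in> X \<Longrightarrow> y \<in> X \<Longrightarrow> gv x y \<in> carrier Q"
  by (simp add: gv_def g_closed v_in)

lemma gv_triangle:
  assumes "x \<in> X" "y \<in> X" "z \<in> X" "d x y < \<delta> / 3" "d y z < \<delta> / 3" "d x z < \<delta> / 3"
  shows "gv x y \<otimes> gv y z = gv x z"
  unfolding gv_def using assms by (intro g_triangle v_in v_adjacent)

lemma gv_refl: "x \<in> X \<Longrightarrow> gv x x = \<one>"
  using gv_triangle[of x x x] \<delta> gv_closed[of x x] by (simp add: l_cancel_one)

lemma path_in_grid: "path_in X p \<Longrightarrow> n > 0 \<Longrightarrow> i \<le> n \<Longrightarrow> p (real i / real n) \<in> X"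
  using grid_points[of n i] by (auto simp: path_in_alt)

lemma hn_closed [simp]: "path_in X p \<Longrightarrow> hn n p \<in> carrier Q"
  unfolding hn_def by (rule gprod_closed, rule gv_closed; rule path_in_grid) auto

text \<open>The subdivision points of one cell of a fine grid are pairwise so close that the
  triangle rule applies to all of them. The labels inside the cell then telescope to the label of
  the cell.\<close>

lemma hn_refine:
  assumes p: "path_in X p" and n: "fine_grid n p" and m: "m > 0"
  shows "hn (n * m) p = hn n p"
proof -
  have n0: "n > 0" using n by (simp add: fine_grid_def)
  define f where "f j = gv (p (real j / real (n * m))) (p (real (Suc j) / real (n * m)))" for j
  have "hn (n * m) p = gprod Q f (n * m)" unfolding hn_def by (rule gprod_cong) (simp only: f_def)
  also have "\<dots> = gprod Q (\<lambda>i. gprod Q (\<lambda>j. f (i * m + j)) m) n"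
    using n0 m p unfolding f_def by (intro gprod_mult gv_closed path_in_grid) auto
  also have "\<dots> = gprod Q (\<lambda>i. gv (p (i / n)) (p (Suc i / n))) n"
  proof (rule gprod_cong)
    fix i assume i: "i < n"
    define P where "P a = real (i * m + a) / real (n * m)" for a
    have nm: "real n > 0" "real m > 0" using n0 m by auto
    have im: "i * m + a \<le> n * m" if "a \<le> m" for a
    proof -
      have "i * m + a \<le> i * m + m" using that by simp
      also have "\<dots> = Suc i * m" by simp
      also have "\<dots> \<le> n * m" using i by (intro mult_le_mono1) simp
      finally show ?thesis .
    qed
    have P01: "P a \<in> {0..1}" if "a \<le> m" for a
      using grid_points[of "n * m" "i * m + a"] im[OF that] n0 m by (simp add: P_def)
    have Pd: "\<bar>P a - P b\<bar> \<le> 1 / n" if "a \<le> m" "b \<le> m" for a b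
    proof -
      have "P a - P b = (real a - real b) / (real n * real m)" by (simp add: P_def flip: diff_divide_distrib)
      moreover have "\<bar>real a - real b\<bar> \<le> real m" using that by linarith
      ultimately have "\<bar>P a - P b\<bar> = \<bar>real a - real b\<bar> / (real n * real m)"
        "\<bar>real a - real b\<bar> / (real n * real m) \<le> real m / (real n * real m)"
        using nm by (simp add: abs_divide, intro divide_right_mono) auto
      moreover have "real m / (real n * real m) = 1 / real n" using nm by simp
      ultimately show ?thesis by linarith
    qed
    have PX: "p (P a) \<in> X" if "a \<le> m" for a using p P01[OF that] by (auto simp: path_in_alt)
    have dP: "d (p (P a)) (p (P b)) < \<delta> / 3" if "a \<le> m" "b \<le> m" for a b
      using n P01[OF that(1)] P01[OF that(2)] Pd[OF that] by (simp add: fine_grid_def)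
    have "gprod Q (\<lambda>j. (\<lambda>a b. gv (p (P a)) (p (P b))) j (Suc j)) m = gv (p (P 0)) (p (P m))"
      by (rule gprod_telescope) (use PX dP in \<open>auto intro: gv_triangle\<close>)
    moreover have "f (i * m + j) = gv (p (P j)) (p (P (Suc j)))" for j by (simp add: f_def P_def)
    moreover have "P 0 = i / n" "P m = Suc i / n" using nm by (auto simp: P_def field_simps)
    ultimately show "gprod Q (\<lambda>j. f (i * m + j)) m = gv (p (i / n)) (p (Suc i / n))" by simp
  qed
  finally show ?thesis by (simp add: hn_def)
qed

lemma hn_fine_eq:
  assumes "path_in X p" "fine_grid n p" "fine_grid m p"
  shows "hn n p = hn m p"
  using hn_refine[OF assms(1,2), of m] hn_refine[OF assms(1,3), of n] assms(2,3)
  by (simp add: fine_grid_def mult.commute)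

definition h :: "(real \<Rightarrow> 'a) \<Rightarrow> 'q" where
  "h p = hn (SOME n. fine_grid n p) p"

lemma h_eq:
  assumes "path_in X p" "fine_grid n p"
  shows "h p = hn n p"
  unfolding h_def using assms by (intro hn_fine_eq) (auto intro: someI)

text \<open>The square of the homotopy is cut into small squares. Consecutive rows are the sides of
  a ladder with trivial outer rungs, as the homotopy fixes the end points.\<close>

lemma h_homotopic:
  assumes "homotopic_paths X p q"
  shows "h p = h q"
proof -
  obtain K where K: "continuous_on unit_square K" "K ` unit_square \<subseteq> X"
    "\<forall>t\<in>{0..1}. K (0, t) = p t" "\<forall>t\<in>{0..1}. K (1, t) = q t"
    "\<forall>t\<in>{0..1}. pathstart (K \<circ> Pair t) = pathstart p \<and> pathfinish (K \<circ> Pair t) = pathfinish p"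
    using assms unfolding homotopic_paths by (auto simp: image_subset_iff_funcset)
  have "compact unit_square" by (intro compact_Times) auto
  moreover have "\<delta> / 3 > 0" using \<delta> by simp
  ultimately obtain \<eta> where \<eta>: "\<eta> > 0" "\<And>a b. a \<in> unit_square \<Longrightarrow> b \<in> unit_square \<Longrightarrow> dist a b < \<eta> \<Longrightarrow> d (K a) (K b) < \<delta> / 3"
    using uniform_modulus[OF _ K(1,2)] by metis
  obtain n :: nat where "2 / \<eta> < real n" using reals_Archimedean2 by blast
  moreover from this have n0: "n > 0" using \<eta>(1) by (cases "n = 0") (auto simp: not_less)
  ultimately have n: "2 * (1 / real n) < \<eta>" using \<eta>(1) by (simp add: field_simps)
  have close: "d (K (s, t)) (K (s', t')) < \<delta> / 3"
    if "s \<in> {0..1}" "t \<in> {0..1}" "s' \<in> {0..1}" "t' \<in> {0..1}" "\<bar>s - s'\<bar> \<le> 1 / n" "\<bar>t - t'\<bar> \<le> 1 / n" for s t s' t'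
  proof (rule \<eta>(2))
    have "dist (s, t) (s', t') \<le> \<bar>s - s'\<bar> + \<bar>t - t'\<bar>"
      unfolding dist_Pair_Pair dist_real_def using sqrt_sum_squares_le_sum_abs by auto
    also have "\<dots> < \<eta>" using that n by linarith
    finally show "dist (s, t) (s', t') < \<eta>" .
  qed (use that in auto)
  define r where "r j t = K (real j / real n, t)" for j :: nat and t
  have KX: "K (s, t) \<in> X" if "s \<in> {0..1}" "t \<in> {0..1}" for s t using K(2) that by blast
  have pq: "path_in X p" "path_in X q"
    using homotopic_paths_imp_path[OF assms] homotopic_paths_imp_subset[OF assms] by (auto simp: path_in_def)
  have fine_grid: "fine_grid n p" "fine_grid n q"
    using close[of 0 _ 0] close[of 1 _ 1] K(3,4) n0 by (auto simp: fine_grid_def)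
  have step: "hn n (r j) = hn n (r (Suc j))" if j: "j < n" for j
  proof -
    define t where "t i = real i / real n" for i
    have t01: "t i \<in> {0..1}" if "i \<le> n" for i using grid_points[OF n0 that] by (simp add: t_def)
    have dt: "\<bar>t i - t (Suc i)\<bar> \<le> 1 / n" for i
      using grid_dist[OF n0, of i] by (simp add: t_def abs_minus_commute)
    have rr: "r j s = K (t j, s)" "r (Suc j) s = K (t (Suc j), s)" for s by (simp_all add: r_def t_def)
    have j': "j \<le> n" "Suc j \<le> n" using j by auto
    define s where "s i = gv (r j (t i)) (r (Suc j) (t i))" for i
    have rX: "r j (t i) \<in> X" "r (Suc j) (t i) \<in> X" if "i \<le> n" for i
      unfolding rr using that j' by (auto intro!: KX t01)
    have "gprod Q (\<lambda>i. gv (r j (t i)) (r j (t (Suc i)))) n \<otimes> s n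
        = s 0 \<otimes> gprod Q (\<lambda>i. gv (r (Suc j) (t i)) (r (Suc j) (t (Suc i)))) n"
    proof (rule gprod_ladder)
      fix i assume i: "i < n"
      then have i': "i \<le> n" "Suc i \<le> n" by auto
      show "gv (r j (t i)) (r j (t (Suc i))) \<in> carrier Q"
        "gv (r (Suc j) (t i)) (r (Suc j) (t (Suc i))) \<in> carrier Q" using rX i' by auto
      \<comment> \<open>Both ways around the small square are compared with its diagonal, which
        requires the triangle rule twice.\<close>
      have "gv (r j (t i)) (r j (t (Suc i))) \<otimes> s (Suc i) = gv (r j (t i)) (r (Suc j) (t (Suc i)))"
        unfolding s_def rr using i' j' dt t01 KX by (intro gv_triangle close) auto
      also have "\<dots> = s i \<otimes> gv (r (Suc j) (t i)) (r (Suc j) (t (Suc i)))"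
        unfolding s_def rr using i' j' dt t01 KX by (intro gv_triangle[symmetric] close) auto
      finally show "gv (r j (t i)) (r j (t (Suc i))) \<otimes> s (Suc i)
        = s i \<otimes> gv (r (Suc j) (t i)) (r (Suc j) (t (Suc i)))" .
    qed (use rX in \<open>auto simp: s_def\<close>)
    moreover have "s i = \<one>" if "i = 0 \<or> i = n" for i
    proof -
      have "r j (t i) = r (Suc j) (t i)"
        using that n0 K(5) t01[OF j'(1)] t01[OF j'(2)] unfolding rr
        by (auto simp: t_def pathstart_def pathfinish_def)
      then show ?thesis unfolding s_def using rX[of i] that by (auto intro: gv_refl)
    qed
    moreover have "gprod Q (\<lambda>i. gv (r j (t i)) (r j (t (Suc i)))) n \<in> carrier Q"
      "gprod Q (\<lambda>i. gv (r (Suc j) (t i)) (r (Suc j) (t (Suc i)))) n \<in> carrier Q"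
      using rX by auto
    moreover have "gprod Q (\<lambda>i. gv (r j (t i)) (r j (t (Suc i)))) n = hn n (r j)"
      "gprod Q (\<lambda>i. gv (r (Suc j) (t i)) (r (Suc j) (t (Suc i)))) n = hn n (r (Suc j))"
      by (simp_all only: hn_def t_def)
    ultimately show ?thesis by simp
  qed
  have "j \<le> n \<Longrightarrow> hn n (r 0) = hn n (r j)" for j
    by (induction j) (use step in auto)
  then have "hn n (r 0) = hn n (r n)" by simp
  moreover have "hn n (r 0) = hn n p" "hn n (r n) = hn n q"
    unfolding hn_def using K(3,4) n0 grid_points[OF n0]
    by (auto intro!: gprod_cong simp: r_def simp del: of_nat_Suc)
  ultimately show ?thesis using h_eq[OF pq(1) fine_grid(1)] h_eq[OF pq(2) fine_grid(2)] by simp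
qed

lemma h_join:
  assumes "path_in X p" "path_in X q" "pathfinish p = pathstart q"
  shows "h (p +++ q) = h p \<otimes> h q"
proof -
  have pq: "path_in X (p +++ q)" using assms by simp
  obtain N1 N2 N3 where "\<forall>n\<ge>N1. fine_grid n p" "\<forall>n\<ge>N2. fine_grid n q" "\<forall>n\<ge>N3. fine_grid n (p +++ q)"
    using eventually_fine_grid assms pq by metis
  then obtain n where n: "fine_grid n p" "fine_grid n q" "fine_grid (n + n) (p +++ q)"
    by (metis max.cobounded1 max.cobounded2 max.coboundedI1 max.coboundedI2 trans_le_add1)
  have n0: "n > 0" using n by (simp add: fine_grid_def)
  let ?f = "\<lambda>i. gv ((p +++ q) (real i / real (n + n))) ((p +++ q) (real (Suc i) / real (n + n)))"
  have first: "(p +++ q) (real i / real (n + n)) = p (real i / real n)" if "i \<le> n" for i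
    using that n0 by (simp add: joinpaths_def field_simps)
  \<comment> \<open>The junction \<open>i = 0\<close> is evaluated by the first branch of the join,
    so there the agreement of the end points is needed.\<close>
  have second: "(p +++ q) (real (n + i) / real (n + n)) = q (real i / real n)" for i
  proof (cases "i = 0")
    case True
    then show ?thesis using first[of n] n0 assms(3) by (simp add: pathfinish_def pathstart_def)
  next
    case False
    then have "\<not> real (n + i) / real (n + n) \<le> 1/2" using n0 by (simp add: field_simps)
    moreover have "2 * (real (n + i) / real (n + n)) - 1 = real i / real n" using n0 by (simp add: field_simps)
    ultimately show ?thesis by (simp only: joinpaths_def if_False)
  qed
  have "hn (n + n) (p +++ q) = gprod Q ?f n \<otimes> gprod Q (\<lambda>i. ?f (n + i)) n"
    unfolding hn_def using pq n0 by (intro gprod_add gv_closed path_in_grid) auto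
  also have "gprod Q ?f n = hn n p"
    unfolding hn_def by (rule gprod_cong) (simp only: first less_imp_le Suc_leI)
  also have "gprod Q (\<lambda>i. ?f (n + i)) n = hn n q"
    unfolding hn_def by (rule gprod_cong) (simp only: second add_Suc_right[symmetric])
  finally show ?thesis
    using h_eq[OF assms(1) n(1)] h_eq[OF assms(2) n(2)] h_eq[OF pq n(3)] by simp
qed

sublocale h: path_character Q X h
proof
  show "h p \<in> carrier Q" if "path_in X p" for p
    using eventually_fine_grid[OF that] h_eq[OF that] that by (metis hn_closed order_refl)
qed (auto intro: h_join h_homotopic)

end

text \<open>An edge path is chosen for every pair of net points, but only close pairs get a short
  one. The quarters of \<epsilon> leave room for triangles of short edges, and for the cells between
  a path and its rounding, inside one ball of radius \<epsilon>.\<close>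

locale small_net = small_loops X d e H \<kappa> + net X d e V \<delta> v
  for X :: "'a::topological_space set" and d e and H :: "('h, 'm) monoid_scheme" (structure) and \<kappa> V \<delta> v +
  fixes \<epsilon> :: real and E :: "'a \<Rightarrow> 'a \<Rightarrow> real \<Rightarrow> 'a"
  assumes \<epsilon>: "\<epsilon> > 0" "\<delta> \<le> \<epsilon> / 4"
    and small_loop: "\<And>y p. y \<in> X \<Longrightarrow> path_in (mball y \<epsilon>) p \<Longrightarrow> pathfinish p = pathstart p \<Longrightarrow> \<kappa> p = \<one>"
    and connect: "\<And>y z. y \<in> X \<Longrightarrow> z \<in> X \<Longrightarrow> d y z < \<delta> \<Longrightarrow>
      \<exists>p. path_in (mball y (\<epsilon> / 4)) p \<and> pathstart p = y \<and> pathfinish p = z"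
    and E: "\<And>u w. u \<in> V \<Longrightarrow> w \<in> V \<Longrightarrow> path_in X (E u w) \<and> pathstart (E u w) = u \<and> pathfinish (E u w) = w"
    and E_small: "\<And>u w. u \<in> V \<Longrightarrow> w \<in> V \<Longrightarrow> d u w < \<delta> \<Longrightarrow> path_in (mball u (\<epsilon> / 4)) (E u w)"
begin

lemma small_square_in_ball:
  assumes "y \<in> X" "path_in (mball y \<epsilon>) p" "path_in (mball y \<epsilon>) q" "path_in (mball y \<epsilon>) s" "path_in (mball y \<epsilon>) s'"
    "pathfinish p = pathstart s'" "pathfinish s' = pathfinish q" "pathstart q = pathfinish s"
    "pathstart s = pathstart p"
  shows "\<kappa> p \<otimes> \<kappa> s' = \<kappa> s \<otimes> \<kappa> q"
  using small_loop[OF assms(1)] mball_subset_mspace assms(2-) by (rule small_square)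

sublocale edge: cocycle X d e V \<delta> v H "\<lambda>u w. \<kappa> (E u w)"
proof
  show "\<kappa> (E u w) \<in> carrier H" if "u \<in> V" "w \<in> V" for u w using E[OF that] by simp
  fix u w z assume V': "u \<in> V" "w \<in> V" "z \<in> V" and dd: "d u w < \<delta>" "d w z < \<delta>" "d u z < \<delta>"
  have X: "u \<in> X" "w \<in> X" "z \<in> X" using V' V by auto
  \<comment> \<open>The triangle is treated as a square with one constant side.\<close>
  have "\<kappa> (E u w) \<otimes> \<kappa> (E w z) = \<kappa> (E u z) \<otimes> \<kappa> (\<lambda>_. z)"
  proof (rule small_square_in_ball[OF X(1)])
    show "path_in (mball u \<epsilon>) (E u w)" "path_in (mball u \<epsilon>) (E u z)" "path_in (mball u \<epsilon>) (E w z)"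
      using path_in_mball_trans[OF E_small[OF V'(1,2) dd(1)] X(1), of \<epsilon>]
        path_in_mball_trans[OF E_small[OF V'(1,3) dd(3)] X(1), of \<epsilon>]
        path_in_mball_trans[OF E_small[OF V'(2,3) dd(2)] X(1), of \<epsilon>] dd X \<epsilon> by auto
    show "path_in (mball u \<epsilon>) (\<lambda>_. z)" using X dd \<epsilon> \<delta> by auto
  qed (use E V' in auto)
  then show "\<kappa> (E u w) \<otimes> \<kappa> (E w z) = \<kappa> (E u z)" using X E V' by simp
qed

text \<open>A ladder joins the path to the chain of edges between its rounded grid points, with
  rungs from each grid point to its rounding. The outer rungs are small loops because
  \<open>v\<close> fixes the two end points.\<close>

lemma edge_h:
  assumes p: "path_in X p" "pathstart p \<in> V" "pathfinish p \<in> V"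
  shows "edge.h p = \<kappa> p"
proof -
  obtain n where n: "fine_grid n p" using eventually_fine_grid[OF p(1)] by blast
  then have n0: "n > 0" by (simp add: fine_grid_def)
  define t where "t i = real i / real n" for i
  have t01: "t i \<in> {0..1}" if "i \<le> n" for i using grid_points[OF n0 that] by (simp add: t_def)
  have pX: "p (t i) \<in> X" if "i \<le> n" for i using p(1) t01[OF that] by (auto simp: path_in_alt)
  have "\<exists>\<sigma>. path_in (mball (p (t i)) (\<epsilon> / 4)) \<sigma> \<and> pathstart \<sigma> = p (t i) \<and> pathfinish \<sigma> = v (p (t i))" if "i \<le> n" for i
    using v_close[OF pX[OF that]] \<delta> by (intro connect v_in_X pX that) auto
  then obtain \<sigma> where \<sigma>: "\<And>i. i \<le> n \<Longrightarrow> path_in (mball (p (t i)) (\<epsilon> / 4)) (\<sigma> i)"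
    "\<And>i. i \<le> n \<Longrightarrow> pathstart (\<sigma> i) = p (t i)" "\<And>i. i \<le> n \<Longrightarrow> pathfinish (\<sigma> i) = v (p (t i))" by metis
  have \<sigma>X: "path_in X (\<sigma> i)" if "i \<le> n" for i using \<sigma>(1)[OF that] mball_subset_mspace by (rule path_in_mono)
  define a b s where "a i = \<kappa> (segment_path (t i) (t (Suc i)) p)" and
    "b i = edge.gv (p (t i)) (p (t (Suc i)))" and "s i = \<kappa> (\<sigma> i)" for i
  have sq: "a i \<otimes> s (Suc i) = s i \<otimes> b i" if i: "i < n" for i
    unfolding a_def b_def s_def edge.gv_def
  proof (rule small_square_in_ball)
    have i': "i \<le> n" "Suc i \<le> n" using i by auto
    show y: "p (t i) \<in> X" using pX i' by simp
    have dpp: "d (p (t i)) (p (t (Suc i))) < \<delta> / 3"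
      using n t01[OF i'(1)] t01[OF i'(2)] grid_dist[OF n0, of i] by (simp add: fine_grid_def t_def abs_minus_commute)
    have "path_in (mball (p (t i)) (\<delta> / 3)) (segment_path (t i) (t (Suc i)) p)"
      unfolding t_def using p(1) n0 i n by (intro grid_segment_in_ball) (auto simp: fine_grid_def)
    then show "path_in (mball (p (t i)) \<epsilon>) (segment_path (t i) (t (Suc i)) p)"
      by (rule path_in_mball_trans) (use y \<epsilon> \<delta> in auto)
    show "path_in (mball (p (t i)) \<epsilon>) (\<sigma> i)"
      by (rule path_in_mball_trans[OF \<sigma>(1)[OF i'(1)]]) (use y \<epsilon> in auto)
    show "path_in (mball (p (t i)) \<epsilon>) (\<sigma> (Suc i))"
      by (rule path_in_mball_trans[OF \<sigma>(1)[OF i'(2)]]) (use y \<epsilon> \<delta> dpp in auto)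
    have vv: "v (p (t i)) \<in> V" "v (p (t (Suc i))) \<in> V" using v_in pX i' by auto
    have "d (v (p (t i))) (v (p (t (Suc i)))) < \<delta>" using dpp pX i' by (intro v_adjacent) auto
    then show "path_in (mball (p (t i)) \<epsilon>) (E (v (p (t i))) (v (p (t (Suc i)))))"
      by (intro path_in_mball_trans[OF E_small[OF vv]]) (use y \<epsilon> \<delta> v_close[OF y] in auto)
  qed (use i \<sigma> E v_in pX in auto)
  have "gprod H a n \<otimes> s n = s 0 \<otimes> gprod H b n"
  proof (rule gprod_ladder)
    fix i assume i: "i < n"
    show "a i \<in> carrier H" unfolding a_def using p(1) t01[of i] t01[of "Suc i"] i
      by (intro closed path_in_segment_path) auto
    show "b i \<in> carrier H" unfolding b_def using pX i by auto
  qed (use sq \<sigma>X in \<open>auto simp: s_def\<close>)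
  moreover have "gprod H a n = \<kappa> p"
    unfolding grid[OF p(1) n0] by (rule gprod_cong) (simp only: a_def t_def)
  moreover have "gprod H b n = edge.h p"
    unfolding edge.h_eq[OF p(1) n] edge.hn_def by (rule gprod_cong) (simp only: b_def t_def)
  moreover have "s i = \<one>" if "i = 0 \<or> i = n" for i
  proof -
    have "p (t i) \<in> V" using that p(2,3) n0 by (auto simp: t_def pathstart_def pathfinish_def)
    then have "v (p (t i)) = p (t i)" by (rule v_fix)
    moreover have "path_in (mball (p (t i)) \<epsilon>) (\<sigma> i)"
      using path_in_mball_trans[OF \<sigma>(1)[of i], of "p (t i)" \<epsilon>] pX[of i] \<epsilon>(1) that by auto
    ultimately show ?thesis
      unfolding s_def using that \<sigma> pX by (intro small_loop[of "p (t i)"]) auto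
  qed
  ultimately show ?thesis using p(1) by simp
qed

end

section \<open>Finite generation and finite presentation\<close>

lemma (in small_loops) ex_small_net:
  assumes "compact X" "path_connected X" "x0 \<in> X"
  obtains V \<delta> v \<epsilon> E where "small_net X d e H \<kappa> V \<delta> v \<epsilon> E" "x0 \<in> V"
proof -
  obtain \<epsilon> where \<epsilon>: "\<epsilon> > 0" "\<And>y p. y \<in> X \<Longrightarrow> path_in (mball y \<epsilon>) p \<Longrightarrow> pathfinish p = pathstart p \<Longrightarrow> \<kappa> p = \<one>"
    using uniform_small_loops[OF assms(1) subset_refl] by metis
  obtain \<delta>0 where \<delta>0: "\<delta>0 > 0" "\<And>y z. y \<in> X \<Longrightarrow> z \<in> X \<Longrightarrow> d y z < \<delta>0 \<Longrightarrow>
    \<exists>p. path_in (mball y (\<epsilon> / 4)) p \<and> pathstart p = y \<and> pathfinish p = z"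
    using uniform_connecting_paths[OF assms(1) subset_refl, of "\<epsilon> / 4"] \<epsilon>(1)
    by (metis zero_less_divide_iff zero_less_numeral)
  define \<delta> where "\<delta> = min \<delta>0 (\<epsilon> / 4)"
  have \<delta>: "\<delta> > 0" "\<delta> \<le> \<delta>0" "\<delta> \<le> \<epsilon> / 4" using \<delta>0 \<epsilon> by (auto simp: \<delta>_def)
  obtain V v where V: "net X d e V \<delta> v" "x0 \<in> V" using ex_net[OF assms(1) \<delta>(1) assms(3)] by metis
  then have VX: "V \<subseteq> X" by (simp add: net_def net_axioms_def)
  have con: "\<exists>p. path_in (mball y (\<epsilon> / 4)) p \<and> pathstart p = y \<and> pathfinish p = z"
    if "y \<in> X" "z \<in> X" "d y z < \<delta>" for y z
    using \<delta>0(2)[OF that(1,2)] less_le_trans[OF that(3) \<delta>(2)] by blast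
  have "\<exists>p. (path_in X p \<and> pathstart p = u \<and> pathfinish p = w) \<and> (d u w < \<delta> \<longrightarrow> path_in (mball u (\<epsilon> / 4)) p)"
    if "u \<in> X" "w \<in> X" for u w
  proof (cases "d u w < \<delta>")
    case True
    from con[OF that True] obtain p where "path_in (mball u (\<epsilon> / 4)) p" "pathstart p = u" "pathfinish p = w" by metis
    moreover from this have "path_in X p" using mball_subset_mspace by (metis path_in_mono)
    ultimately show ?thesis by metis
  next
    case False
    have "\<exists>p. path_in X p \<and> pathstart p = u \<and> pathfinish p = w"
      using assms(2) that unfolding path_connected_def path_in_def by metis
    with False show ?thesis by metis
  qed
  then obtain E where E: "\<And>u w. u \<in> X \<Longrightarrow> w \<in> X \<Longrightarrow>
      (path_in X (E u w) \<and> pathstart (E u w) = u \<and> pathfinish (E u w) = w) \<and>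
      (d u w < \<delta> \<longrightarrow> path_in (mball u (\<epsilon> / 4)) (E u w))" by metis
  have "small_net_axioms X d H \<kappa> V \<delta> \<epsilon> E"
    by unfold_locales (use \<epsilon> \<delta>(3) con E VX in \<open>auto simp: subset_iff\<close>)
  then have "small_net X d e H \<kappa> V \<delta> v \<epsilon> E"
    using V(1) small_loops_axioms by (simp add: small_net_def)
  then show ?thesis using V(2) by (rule that)
qed

lemma (in group) gprod_in_generate:
  "(\<And>i. i < n \<Longrightarrow> f i \<in> generate G S) \<Longrightarrow> gprod G f n \<in> generate G S"
  by (induction n) (auto intro: generate.one generate.eng)

lemma (in group_hom) hom_gprod:
  "(\<And>i. i < n \<Longrightarrow> f i \<in> carrier G) \<Longrightarrow> h (gprod G f n) = gprod H (\<lambda>i. h (f i)) n"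
  by (induction n) auto

section \<open>Generators and relators read off from a net\<close>

definition loop_surjective :: "'a::topological_space set \<Rightarrow> 'a \<Rightarrow> ((real \<Rightarrow> 'a) \<Rightarrow> 'h) \<Rightarrow> ('h, 'm) monoid_scheme \<Rightarrow> bool" where
  "loop_surjective X x0 \<kappa> H \<longleftrightarrow>
     (\<forall>a\<in>carrier H. \<exists>p. path_in X p \<and> pathstart p = x0 \<and> pathfinish p = x0 \<and> \<kappa> p = a)"

context small_net begin

lemma edge_hn:
  assumes "path_in X p" "pathstart p \<in> V" "pathfinish p \<in> V" "fine_grid n p"
  shows "edge.hn n p = \<kappa> p"
  using edge_h[OF assms(1-3)] edge.h_eq[OF assms(1,4)] by simp

text \<open>The value of a loop at a net point is a product of values of edge paths, and a finite
  net has finitely many of these.\<close>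

lemma finitely_generated:
  assumes "x0 \<in> V" "loop_surjective X x0 \<kappa> H"
  shows "finitely_generated H"
proof -
  define S where "S = (\<lambda>(u, w). \<kappa> (E u w)) ` (V \<times> V)"
  have S: "S \<subseteq> carrier H" "finite S" using E V by (auto simp: S_def)
  have "carrier H \<subseteq> generate H S"
  proof
    fix a assume "a \<in> carrier H"
    then obtain p where p: "path_in X p" "pathstart p = x0" "pathfinish p = x0" "\<kappa> p = a"
      using assms(2) by (auto simp: loop_surjective_def)
    obtain n where n: "fine_grid n p" using eventually_fine_grid[OF p(1)] by blast
    then have n0: "n > 0" by (simp add: fine_grid_def)
    have "edge.hn n p \<in> generate H S"
      unfolding edge.hn_def
    proof (rule gprod_in_generate, rule generate.incl)
      fix i assume i: "i < n"
      have "p (real i / n) \<in> X" "p (real (Suc i) / n) \<in> X"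
        using edge.path_in_grid[OF p(1) n0] i by (metis less_imp_le, metis Suc_leI)
      then show "edge.gv (p (real i / n)) (p (real (Suc i) / n)) \<in> S"
        unfolding edge.gv_def S_def using v_in by auto
    qed
    then show "a \<in> generate H S" using edge_hn[OF p(1) _ _ n] p assms(1) by simp
  qed
  then have "generate H S = carrier H" using generate_incl[OF S(1)] by blast
  then show ?thesis using S unfolding finitely_generated_def by blast
qed

text \<open>There is one letter for each ordered pair of net points. Reading words off loops gives
  an invariant with values in the presented group; as \<open>\<kappa>\<close> separates classes at
  \<open>x0\<close>, the invariant factors through \<open>H\<close> and provides the left inverse
  that recognises a presentation.\<close>

theorem finitely_presented:
  assumes x0: "x0 \<in> V" and surj: "loop_surjective X x0 \<kappa> H"
    and inj: "\<And>p q. path_in X p \<Longrightarrow> pathstart p = x0 \<Longrightarrow> pathfinish p = x0 \<Longrightarrow>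
      path_in X q \<Longrightarrow> pathstart q = x0 \<Longrightarrow> pathfinish q = x0 \<Longrightarrow> \<kappa> p = \<kappa> q \<Longrightarrow> homotopic_paths X p q"
    and T: "\<And>u. u \<in> V \<Longrightarrow> path_in X (T u) \<and> pathstart (T u) = x0 \<and> pathfinish (T u) = u \<and> \<kappa> (T u) = \<one>"
  shows "finitely_presented H"
proof -
  define n where "n = card (V \<times> V)"
  obtain c where c: "bij_betw c (V \<times> V) {..<n}"
    using ex_bij_betw_finite_nat[of "V \<times> V"] V by (auto simp: n_def atLeast0LessThan)
  define S where "S = {..<n}"
  define F where "F = free_group S"
  interpret F: group F unfolding F_def by (rule group_free_group)
  define L where "L u w = letter S (c (u, w))" for u w
  have cS: "c (u, w) \<in> S" if "u \<in> V" "w \<in> V" for u w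
    using bij_betw_apply[OF c] that by (simp add: S_def)
  have L [simp]: "L u w \<in> carrier F" if "u \<in> V" "w \<in> V" for u w
    using cS[OF that] by (simp add: L_def F_def)
  define f where "f s = (case inv_into (V \<times> V) c s of (u, w) \<Rightarrow> \<kappa> (E u w))" for s
  have f: "f (c (u, w)) = \<kappa> (E u w)" if "u \<in> V" "w \<in> V" for u w
    using that bij_betw_inv_into_left[OF c, of "(u, w)"] by (simp add: f_def)
  have S_c: "\<exists>u w. u \<in> V \<and> w \<in> V \<and> s = c (u, w)" if "s \<in> S" for s
  proof -
    have "s \<in> c ` (V \<times> V)" using that bij_betw_imp_surj_on[OF c] by (simp add: S_def)
    then show ?thesis by blast
  qed
  have "f ` S \<subseteq> carrier H" using S_c f E by fastforce
  then obtain \<Phi> where \<Phi>: "\<Phi> \<in> hom F H" "\<And>s. s \<in> S \<Longrightarrow> \<Phi> (letter S s) = f s"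
    using free_group_lift unfolding F_def by metis
  interpret \<Phi>: group_hom F H \<Phi> by (simp add: group_hom_def group_hom_axioms_def \<Phi>(1) F.group_axioms group_axioms)
  have \<Phi>L: "\<Phi> (L u w) = \<kappa> (E u w)" if "u \<in> V" "w \<in> V" for u w
    using \<Phi>(2)[OF cS[OF that]] f[OF that] by (simp add: L_def)
  define m where "m p = (SOME n. fine_grid n p)" for p
  have m: "fine_grid (m p) p" if "path_in X p" for p
    using eventually_fine_grid[OF that] unfolding m_def by (meson order_refl someI)
  have grid: "p (real i / real (m p)) \<in> X" if "path_in X p" "i \<le> m p" for p i
    using edge.path_in_grid[OF that(1) _ that(2)] m[OF that(1)] by (simp add: fine_grid_def)
  define wd where "wd p = gprod F (\<lambda>i. L (v (p (i / m p))) (v (p (Suc i / m p)))) (m p)" for p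
  have wd_closed: "wd p \<in> carrier F" if "path_in X p" for p
    unfolding wd_def using grid[OF that] v_in by (intro F.gprod_closed L) (auto simp del: of_nat_Suc)
  have \<Phi>wd: "\<Phi> (wd p) = \<kappa> p" if p: "path_in X p" "pathstart p \<in> V" "pathfinish p \<in> V" for p
  proof -
    have "\<Phi> (wd p) = gprod H (\<lambda>i. \<Phi> (L (v (p (i / m p))) (v (p (Suc i / m p))))) (m p)"
      unfolding wd_def using grid[OF p(1)] v_in by (intro \<Phi>.hom_gprod L) (auto simp del: of_nat_Suc)
    also have "\<dots> = edge.hn (m p) p"
      unfolding edge.hn_def edge.gv_def using grid[OF p(1)] v_in
      by (intro gprod_cong \<Phi>L) (auto simp del: of_nat_Suc)
    finally show ?thesis using edge_hn[OF p m[OF p(1)]] by simp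
  qed
  \<comment> \<open>The letters are edges between close net points, and discretising a path turns it into a word.
    The triangle relators \<open>R1\<close> make this homotopy invariant. The edge paths leave the scale on which
    \<open>R1\<close> operates, so \<open>R2\<close> must equate each letter with the word of its own path.\<close>
  define R1 where "R1 = {L u w \<otimes>\<^bsub>F\<^esub> L w z \<otimes>\<^bsub>F\<^esub> inv\<^bsub>F\<^esub> L u z |u w z. u \<in> V \<and> w \<in> V \<and> z \<in> V \<and>
      d u w < \<delta> \<and> d w z < \<delta> \<and> d u z < \<delta>}"
  define R2 where "R2 = {L u w \<otimes>\<^bsub>F\<^esub> inv\<^bsub>F\<^esub> wd (E u w) |u w. u \<in> V \<and> w \<in> V}"
  \<comment> \<open>A letter has to be recovered from the loop that reaches its edge along
    \<open>T u\<close> and returns along \<open>T w\<close>, so the words of these paths are made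
    trivial.\<close>
  define R3 where "R3 = {wd (T u) |u. u \<in> V}"
  define R where "R = R1 \<union> R2 \<union> R3"
  have finR: "finite R"
  proof -
    have "R1 \<subseteq> (\<lambda>(u, w, z). L u w \<otimes>\<^bsub>F\<^esub> L w z \<otimes>\<^bsub>F\<^esub> inv\<^bsub>F\<^esub> L u z) ` (V \<times> V \<times> V)" by (auto simp: R1_def)
    moreover have "R2 \<subseteq> (\<lambda>(u, w). L u w \<otimes>\<^bsub>F\<^esub> inv\<^bsub>F\<^esub> wd (E u w)) ` (V \<times> V)" by (auto simp: R2_def)
    moreover have "R3 \<subseteq> (\<lambda>u. wd (T u)) ` V" by (auto simp: R3_def)
    moreover have "finite ((\<lambda>(u, w, z). L u w \<otimes>\<^bsub>F\<^esub> L w z \<otimes>\<^bsub>F\<^esub> inv\<^bsub>F\<^esub> L u z) ` (V \<times> V \<times> V))"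
      "finite ((\<lambda>(u, w). L u w \<otimes>\<^bsub>F\<^esub> inv\<^bsub>F\<^esub> wd (E u w)) ` (V \<times> V))" "finite ((\<lambda>u. wd (T u)) ` V)"
      using V by auto
    ultimately show ?thesis unfolding R_def by (meson finite_UnI finite_subset)
  qed
  have RF: "R \<subseteq> carrier F"
    using wd_closed E T by (auto simp: R_def R1_def R2_def R3_def)
  have \<Phi>R: "\<Phi> r = \<one>" if "r \<in> R" for r
  proof -
    consider u w z where "u \<in> V" "w \<in> V" "z \<in> V" "d u w < \<delta>" "d w z < \<delta>" "d u z < \<delta>"
        "r = L u w \<otimes>\<^bsub>F\<^esub> L w z \<otimes>\<^bsub>F\<^esub> inv\<^bsub>F\<^esub> L u z"
      | u w where "u \<in> V" "w \<in> V" "r = L u w \<otimes>\<^bsub>F\<^esub> inv\<^bsub>F\<^esub> wd (E u w)"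
      | u where "u \<in> V" "r = wd (T u)"
      using \<open>r \<in> R\<close> unfolding R_def R1_def R2_def R3_def by blast
    then show ?thesis
    proof cases
      case 1
      then show ?thesis
        using edge.g_triangle[OF 1(1-6)] E by (simp add: \<Phi>L)
    next
      case 2
      then show ?thesis using E wd_closed by (simp add: \<Phi>L \<Phi>wd)
    next
      case 3
      then show ?thesis using T x0 by (simp add: \<Phi>wd)
    qed
  qed
  define N where "N = normal_closure F R"
  interpret N: normal N F unfolding N_def by (rule F.normal_closure_normal[OF RF])
  define Q where "Q = F Mod N"
  interpret Q: group Q unfolding Q_def by (rule N.factorgroup_is_group)
  define \<pi> where "\<pi> x = N #>\<^bsub>F\<^esub> x" for x
  have \<pi>: "\<pi> \<in> hom F Q" unfolding \<pi>_def Q_def by (rule N.r_coset_hom_Mod)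
  interpret \<pi>: group_hom F Q \<pi> by (simp add: group_hom_def group_hom_axioms_def \<pi> F.group_axioms Q.group_axioms)
  have \<pi>R: "\<pi> r = \<one>\<^bsub>Q\<^esub>" if "r \<in> R" for r
  proof -
    have "r \<in> N" using F.subset_normal_closure that unfolding N_def by blast
    moreover have "r \<in> carrier F" using RF that by blast
    ultimately show ?thesis unfolding \<pi>_def Q_def by (simp add: F.coset_join2 N.subgroup_axioms)
  qed
  have cancel: "\<pi> a = \<pi> b" if "a \<in> carrier F" "b \<in> carrier F" "\<pi> (a \<otimes>\<^bsub>F\<^esub> inv\<^bsub>F\<^esub> b) = \<one>\<^bsub>Q\<^esub>" for a b
  proof -
    have "\<pi> a \<otimes>\<^bsub>Q\<^esub> inv\<^bsub>Q\<^esub> \<pi> b = \<one>\<^bsub>Q\<^esub>" using that by simp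
    then show ?thesis using that by (metis Q.inv_closed Q.inv_equality Q.inv_inv \<pi>.hom_closed)
  qed
  interpret C: cocycle X d e V \<delta> v Q "\<lambda>u w. \<pi> (L u w)"
  proof
    show "\<pi> (L u w) \<in> carrier Q" if "u \<in> V" "w \<in> V" for u w using that by simp
    fix u w z assume *: "u \<in> V" "w \<in> V" "z \<in> V" "d u w < \<delta>" "d w z < \<delta>" "d u z < \<delta>"
    have "L u w \<otimes>\<^bsub>F\<^esub> L w z \<otimes>\<^bsub>F\<^esub> inv\<^bsub>F\<^esub> L u z \<in> R" using * unfolding R_def R1_def by blast
    from \<pi>R[OF this] have "\<pi> (L u w \<otimes>\<^bsub>F\<^esub> L w z) = \<pi> (L u z)" using * by (intro cancel) auto
    then show "\<pi> (L u w) \<otimes>\<^bsub>Q\<^esub> \<pi> (L w z) = \<pi> (L u z)" using * by simp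
  qed
  have Ch: "C.h p = \<pi> (wd p)" if p: "path_in X p" for p
  proof -
    have "\<pi> (wd p) = gprod Q (\<lambda>i. \<pi> (L (v (p (i / m p))) (v (p (Suc i / m p))))) (m p)"
      unfolding wd_def using grid[OF p] v_in by (intro \<pi>.hom_gprod L) (auto simp del: of_nat_Suc)
    then show ?thesis
      using C.h_eq[OF p m[OF p]] by (simp only: C.hn_def C.gv_def)
  qed
  have C_edge: "C.h (E u w) = \<pi> (L u w)" if "u \<in> V" "w \<in> V" for u w
  proof -
    have "L u w \<otimes>\<^bsub>F\<^esub> inv\<^bsub>F\<^esub> wd (E u w) \<in> R" using that unfolding R_def R2_def by blast
    from \<pi>R[OF this] have "\<pi> (L u w) = \<pi> (wd (E u w))" using that E wd_closed by (intro cancel) auto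
    then show ?thesis using Ch E that by simp
  qed
  have C_T: "C.h (T u) = \<one>\<^bsub>Q\<^esub>" if "u \<in> V" for u
  proof -
    have "wd (T u) \<in> R" using that unfolding R_def R3_def by blast
    then show ?thesis using Ch T that \<pi>R by simp
  qed
  \<comment> \<open>The choice of the loop is harmless: by \<open>inj\<close>, loops with the same
    value are homotopic, and \<open>C.h\<close> is a homotopy invariant.\<close>
  define \<psi> where "\<psi> a = C.h (SOME p. path_in X p \<and> pathstart p = x0 \<and> pathfinish p = x0 \<and> \<kappa> p = a)" for a
  have \<psi>: "\<psi> (\<kappa> p) = C.h p" if p: "path_in X p" "pathstart p = x0" "pathfinish p = x0" for p
  proof -
    define q where "q = (SOME q. path_in X q \<and> pathstart q = x0 \<and> pathfinish q = x0 \<and> \<kappa> q = \<kappa> p)"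
    have "path_in X q \<and> pathstart q = x0 \<and> pathfinish q = x0 \<and> \<kappa> q = \<kappa> p"
      unfolding q_def by (rule someI[of _ p]) (use p in simp)
    then have "homotopic_paths X q p" using p by (intro inj) auto
    then show ?thesis unfolding \<psi>_def q_def[symmetric] by (rule C.h_homotopic)
  qed
  have \<psi>_hom: "\<psi> \<in> hom H Q"
  proof (rule homI)
    fix a assume "a \<in> carrier H"
    then obtain p where "path_in X p" "pathstart p = x0" "pathfinish p = x0" "\<kappa> p = a"
      using surj by (auto simp: loop_surjective_def)
    then show "\<psi> a \<in> carrier Q" using \<psi>[of p] by auto
  next
    fix a b assume "a \<in> carrier H" "b \<in> carrier H"
    then obtain p q where "path_in X p" "pathstart p = x0" "pathfinish p = x0" "\<kappa> p = a"
      "path_in X q" "pathstart q = x0" "pathfinish q = x0" "\<kappa> q = b"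
      using surj unfolding loop_surjective_def by metis
    then show "\<psi> (a \<otimes> b) = \<psi> a \<otimes>\<^bsub>Q\<^esub> \<psi> b"
      using \<psi>[of p] \<psi>[of q] \<psi>[of "p +++ q"] by (auto simp: join C.h_join)
  qed
  have \<psi>_letter: "\<psi> (\<Phi> (letter S s)) = \<pi> (letter S s)" if "s \<in> S" for s
  proof -
    obtain u w where uw: "u \<in> V" "w \<in> V" "s = c (u, w)" using S_c[OF \<open>s \<in> S\<close>] by blast
    \<comment> \<open>The edge is completed to a loop at \<open>x0\<close>. The added paths are
      trivial both under \<open>\<kappa>\<close> and under \<open>C.h\<close>.\<close>
    define p where "p = (T u +++ E u w) +++ reversepath (T w)"
    have p: "path_in X p" "pathstart p = x0" "pathfinish p = x0"
      using T E uw by (simp_all add: p_def)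
    have "\<kappa> p = \<kappa> (E u w)" using T E uw by (simp add: p_def join)
    moreover have "C.h p = C.h (E u w)"
      using T[OF uw(1)] T[OF uw(2)] E[OF uw(1,2)] C_T[OF uw(1)] C_T[OF uw(2)]
      by (simp add: p_def C.h_join)
    ultimately have "\<psi> (\<kappa> (E u w)) = \<pi> (L u w)" using \<psi>[OF p] C_edge[OF uw(1,2)] by simp
    then show ?thesis using \<Phi>L[OF uw(1,2)] uw by (simp add: L_def)
  qed
  have "\<Phi> ` carrier F = carrier H"
  proof
    show "carrier H \<subseteq> \<Phi> ` carrier F"
    proof
      fix a assume "a \<in> carrier H"
      then obtain p where p: "path_in X p" "pathstart p = x0" "pathfinish p = x0" "\<kappa> p = a"
        using surj by (auto simp: loop_surjective_def)
      then have "\<Phi> (wd p) = a" using \<Phi>wd[of p] x0 by simp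
      then show "a \<in> \<Phi> ` carrier F" using wd_closed[OF p(1)] by blast
    qed
  qed auto
  then have "H \<cong> free_group S Mod normal_closure (free_group S) R"
    using group_axioms \<Phi>(1) RF \<Phi>R \<psi>_hom \<psi>_letter
    unfolding F_def Q_def N_def \<pi>_def by (intro presentation_isoI)
  then show ?thesis
    using finR RF unfolding finitely_presented_def F_def S_def by blast
qed

end

section \<open>The cardinality dichotomy\<close>

lemma free_group_quotient_countable:
  assumes "countable S" "G \<cong> free_group S Mod N"
  shows "countable (carrier G)"
proof -
  have "countable (carrier (free_group S Mod N))"
    unfolding carrier_FactGroup using countable_free_group[OF assms(1)] by (rule countable_image)
  moreover obtain f where "bij_betw f (carrier G) (carrier (free_group S Mod N))"
    using assms(2) by (auto simp: is_iso_def iso_def)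
  ultimately show ?thesis using countable_image_inj_on[of f "carrier G"]
    by (auto simp: bij_betw_def)
qed

lemma finitely_presented_imp_countable: "finitely_presented G \<Longrightarrow> countable (carrier G)"
  unfolding finitely_presented_def using free_group_quotient_countable by (metis countable_finite finite_lessThan)

lemma Baire_space_lepoll: "(UNIV :: (nat \<Rightarrow> nat) set) \<lesssim> (UNIV :: nat set set)"
proof -
  have "inj (\<lambda>f :: nat \<Rightarrow> nat. range (\<lambda>n. prod_encode (n, f n)))"
  proof (rule injI)
    fix f g :: "nat \<Rightarrow> nat" assume eq: "range (\<lambda>n. prod_encode (n, f n)) = range (\<lambda>n. prod_encode (n, g n))"
    have "f n = g n" for n
    proof -
      have "prod_encode (n, f n) \<in> range (\<lambda>n. prod_encode (n, g n))" using eq by blast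
      then show ?thesis by auto
    qed
    then show "f = g" by blast
  qed
  then show ?thesis unfolding lepoll_def by blast
qed

lemma continuum_sizedI:
  fixes f :: "nat set \<Rightarrow> 'b"
  assumes "inj f" "range f \<subseteq> A" "A \<lesssim> (UNIV :: nat set set)"
  shows "continuum_sized A"
  unfolding continuum_sized_def using assms by (intro lepoll_antisym) (auto simp: lepoll_def)

lemma continuum_sized_imp_uncountable: "continuum_sized A \<Longrightarrow> uncountable A"
proof
  assume "continuum_sized A" "countable A"
  then have "countable (UNIV :: nat set set)"
    unfolding continuum_sized_def by (meson countable_lepoll eqpoll_imp_lepoll eqpoll_sym)
  then have "range (from_nat_into (UNIV :: nat set set)) = Pow UNIV"
    by (simp add: range_from_nat_into)
  then show False using Cantors_theorem by blast
qed

lemma (in normal) rcos_eq_imp: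
  assumes "a \<in> carrier G" "b \<in> carrier G" "H #> a = H #> b"
  shows "a \<otimes> inv b \<in> H"
proof -
  have "a \<in> H #> b" using rcos_self[OF assms(1) subgroup_axioms] assms(3) by simp
  then obtain k where k: "k \<in> H" "a = k \<otimes> b" by (auto simp: r_coset_def)
  then have "a \<otimes> inv b = k" using assms(2) by (simp add: m_assoc)
  with k show ?thesis by simp
qed

lemma (in polish_based_space) carrier_lepoll: "carrier \<G> \<lesssim> (UNIV :: nat set set)"
proof -
  obtain K :: "(nat \<Rightarrow> nat) set" and F where "carrier \<G> = (\<lambda>z. cl (F z)) ` K"
    using analyticE[OF analytic_carrier] by metis
  then have "carrier \<G> \<lesssim> K" using image_lepoll by metis
  also have "K \<lesssim> (UNIV :: (nat \<Rightarrow> nat) set)" by (rule subset_imp_lepoll) simp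
  also note Baire_space_lepoll
  finally show ?thesis .
qed

text \<open>Nearby parameters give uniformly close loops, so \<open>\<kappa>\<close> is locally
  constant along a parametrisation of all classes. Separability enters through the countably many
  cylinders of the Baire space.\<close>

lemma (in polish_based_space) countable_character_image:
  assumes "small_loops X d e H \<kappa>" "loop_surjective X x0 \<kappa> H"
  shows "countable (carrier H)"
proof -
  interpret S: small_loops X d e H \<kappa> by (rule assms(1))
  obtain K :: "(nat \<Rightarrow> nat) set" and F where K: "loop_family K F" "carrier \<G> = (\<lambda>z. cl (F z)) ` K"
    using analyticE[OF analytic_carrier] by metis
  have l: "loop (F z)" if "z \<in> K" for z using K(1) that by (simp add: loop_family_def)
  have "countable ((\<lambda>z. \<kappa> (F z)) ` K)"
  proof (rule countable_image_locally_constant)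
    fix z assume z: "z \<in> K"
    obtain \<delta> where \<delta>: "\<delta> > 0" "\<And>q. path_in X q \<Longrightarrow> pathstart q = pathstart (F z) \<Longrightarrow> pathfinish q = pathfinish (F z) \<Longrightarrow>
      (\<And>t. t \<in> {0..1} \<Longrightarrow> d (F z t) (q t) < \<delta>) \<Longrightarrow> \<kappa> q = \<kappa> (F z)"
      using S.eq_of_uniformly_close[of "F z"] l[OF z] unfolding loop_def by metis
    obtain n where n: "\<And>w t. w \<in> K \<Longrightarrow> w \<in> cyl z n \<Longrightarrow> t \<in> {0..1} \<Longrightarrow> d (F z t) (F w t) < \<delta>"
      using family_uniformly_close[of K F z \<delta>] K(1) z \<delta>(1) unfolding loop_family_def by metis
    have "\<kappa> (F w) = \<kappa> (F z)" if "w \<in> K" "w \<in> cyl z n" for w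
      using l[OF z] l[OF that(1)] n[OF that] by (intro \<delta>(2)) (auto simp: loop_def)
    then show "\<exists>n. \<forall>w\<in>K. w \<in> cyl z n \<longrightarrow> \<kappa> (F w) = \<kappa> (F z)" by blast
  qed
  moreover have "carrier H \<subseteq> (\<lambda>z. \<kappa> (F z)) ` K"
  proof
    fix a assume "a \<in> carrier H"
    then obtain p where p: "loop p" "\<kappa> p = a"
      using assms(2) by (auto simp: loop_surjective_def loop_def)
    then have "cl p \<in> carrier \<G>" by (auto simp: carrier_Pi)
    then obtain z where z: "z \<in> K" "cl p = cl (F z)" using K(2) by auto
    then have "homotopic_paths X p (F z)" using p(1) cl_eq_iff by (auto simp: loop_def)
    then show "a \<in> (\<lambda>z. \<kappa> (F z)) ` K" using S.homotopic p(2) z(1) by auto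
  qed
  ultimately show ?thesis by (rule countable_subset[rotated])
qed

section \<open>The two cases of the dichotomy\<close>

context pi_space begin

lemma gamma_loop_surjective: "loop_surjective X x0 \<gamma> \<G>"
  unfolding loop_surjective_def
proof
  fix a assume "a \<in> carrier \<G>"
  then obtain p where "loop p" "a = cl p" by (auto simp: carrier_Pi)
  then show "\<exists>p. path_in X p \<and> pathstart p = x0 \<and> pathfinish p = x0 \<and> \<gamma> p = a"
    using gamma_loop[of p] by (auto simp: loop_def)
qed

lemma small_loops_gamma:
  assumes "locally path_connected X" "\<And>x. x \<in> X \<Longrightarrow> good_at {\<one>\<^bsub>\<G>\<^esub>} x"
  shows "small_loops X d e \<G> \<gamma>"
  by unfold_locales (use assms in \<open>auto simp: good_at_def\<close>)

lemma quotient_character: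
  assumes N: "N \<lhd> \<G>"
  shows "path_character (\<G> Mod N) X (\<lambda>p. N #>\<^bsub>\<G>\<^esub> \<gamma> p)" "loop_surjective X x0 (\<lambda>p. N #>\<^bsub>\<G>\<^esub> \<gamma> p) (\<G> Mod N)"
proof -
  interpret N: normal N \<G> by (rule N)
  interpret H: group "\<G> Mod N" by (rule N.factorgroup_is_group)
  show "path_character (\<G> Mod N) X (\<lambda>p. N #>\<^bsub>\<G>\<^esub> \<gamma> p)"
    by unfold_locales (auto simp: carrier_FactGroup gamma.join N.rcos_sum dest: gamma.homotopic)
  show "loop_surjective X x0 (\<lambda>p. N #>\<^bsub>\<G>\<^esub> \<gamma> p) (\<G> Mod N)"
    unfolding loop_surjective_def
  proof
    fix A assume "A \<in> carrier (\<G> Mod N)"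
    then obtain a where a: "a \<in> carrier \<G>" "A = N #>\<^bsub>\<G>\<^esub> a" by (auto simp: carrier_FactGroup)
    then obtain p where "path_in X p" "pathstart p = x0" "pathfinish p = x0" "\<gamma> p = a"
      using gamma_loop_surjective unfolding loop_surjective_def by metis
    then show "\<exists>p. path_in X p \<and> pathstart p = x0 \<and> pathfinish p = x0 \<and> N #>\<^bsub>\<G>\<^esub> \<gamma> p = A"
      using a(2) by metis
  qed
qed

lemma small_loops_quotient:
  assumes N: "N \<lhd> \<G>" and "locally path_connected X" and good: "\<And>x. x \<in> X \<Longrightarrow> good_at N x"
  shows "small_loops X d e (\<G> Mod N) (\<lambda>p. N #>\<^bsub>\<G>\<^esub> \<gamma> p)"
proof -
  interpret N: normal N \<G> by (rule N)
  interpret P: path_character "\<G> Mod N" X "\<lambda>p. N #>\<^bsub>\<G>\<^esub> \<gamma> p" by (rule quotient_character(1)[OF N])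
  have triv: "N #>\<^bsub>\<G>\<^esub> \<gamma> p = \<one>\<^bsub>\<G> Mod N\<^esub>" if "\<gamma> p \<in> N" for p
    using that N.subset by (simp add: Pi.coset_join2 N.subgroup_axioms subset_iff)
  show ?thesis
  proof
    show "\<exists>\<epsilon>>0. \<forall>p. path_in (mball x \<epsilon>) p \<longrightarrow> pathstart p = x \<longrightarrow> pathfinish p = x \<longrightarrow>
        N #>\<^bsub>\<G>\<^esub> \<gamma> p = \<one>\<^bsub>\<G> Mod N\<^esub>" if "x \<in> X" for x
      using good[OF that] triv unfolding good_at_def by metis
  qed (rule assms(2))
qed

lemma quotient_dichotomy:
  assumes N: "N \<lhd> \<G>" "analytic N" and lpc: "locally path_connected X"
  shows "continuum_or_countable (\<G> Mod N) \<and> (compact X \<longrightarrow> continuum_or_fin_gen (\<G> Mod N))"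
proof (cases "\<forall>x\<in>X. good_at N x")
  case True
  then have small: "small_loops X d e (\<G> Mod N) (\<lambda>p. N #>\<^bsub>\<G>\<^esub> \<gamma> p)"
    using N(1) lpc by (intro small_loops_quotient) auto
  interpret S: small_loops X d e "\<G> Mod N" "\<lambda>p. N #>\<^bsub>\<G>\<^esub> \<gamma> p" by (rule small)
  have "finitely_generated (\<G> Mod N)" if "compact X"
    using S.ex_small_net[OF that path_connected x0] small_net.finitely_generated quotient_character(2)[OF N(1)]
    by metis
  moreover have "countable (carrier (\<G> Mod N))"
    using small quotient_character(2)[OF N(1)] by (rule countable_character_image)
  ultimately show ?thesis by (auto simp: continuum_or_countable_def continuum_or_fin_gen_def)
next
  case False
  then obtain x where "x \<in> X" "\<not> good_at N x" by blast
  then obtain f :: "nat set \<Rightarrow> (real \<Rightarrow> 'a) set" where f: "\<And>A. f A \<in> carrier \<G>"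
    "\<And>A B. A \<noteq> B \<Longrightarrow> f A \<otimes>\<^bsub>\<G>\<^esub> inv\<^bsub>\<G>\<^esub> f B \<notin> N"
    using not_good_imp_independent[OF N] by metis
  interpret N: normal N \<G> by (rule N(1))
  have "inj (\<lambda>A. N #>\<^bsub>\<G>\<^esub> f A)"
    using f N.rcos_eq_imp by (intro injI) metis
  moreover have "range (\<lambda>A. N #>\<^bsub>\<G>\<^esub> f A) \<subseteq> carrier (\<G> Mod N)"
    using f(1) by (auto simp: carrier_FactGroup)
  moreover have "carrier (\<G> Mod N) \<lesssim> (UNIV :: nat set set)"
    unfolding carrier_FactGroup by (rule lepoll_trans[OF image_lepoll carrier_lepoll])
  ultimately have "continuum_sized (carrier (\<G> Mod N))" by (rule continuum_sizedI)
  then show ?thesis by (simp add: continuum_or_countable_def continuum_or_fin_gen_def)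
qed

text \<open>With trivial \<open>N\<close> the character \<open>\<gamma>\<close> is used directly
  instead of its cosets. It separates the classes at \<open>x0\<close>, which finite presentation
  requires.\<close>

lemma fundamental_group_dichotomy:
  assumes lpc: "locally path_connected X"
  shows "continuum_sized (carrier \<G>) \<or>
    countable (carrier \<G>) \<and> (compact X \<longrightarrow> finitely_generated \<G> \<and> finitely_presented \<G>)"
proof (cases "\<forall>x\<in>X. good_at {\<one>\<^bsub>\<G>\<^esub>} x")
  case True
  then have small: "small_loops X d e \<G> \<gamma>" using lpc by (intro small_loops_gamma) auto
  interpret S: small_loops X d e \<G> \<gamma> by (rule small)
  have "finitely_generated \<G> \<and> finitely_presented \<G>" if comp: "compact X"
  proof -
    obtain V \<delta> v \<epsilon> E where net: "small_net X d e \<G> \<gamma> V \<delta> v \<epsilon> E" and x0V: "x0 \<in> V"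
      using S.ex_small_net[OF comp path_connected x0] .
    interpret M: small_net X d e \<G> \<gamma> V \<delta> v \<epsilon> E by (rule net)
    have "finitely_presented \<G>"
    proof (rule M.finitely_presented[OF x0V gamma_loop_surjective, where T = tether])
      fix p q assume "path_in X p" "pathstart p = x0" "pathfinish p = x0"
        "path_in X q" "pathstart q = x0" "pathfinish q = x0" "\<gamma> p = \<gamma> q"
      then have "loop p" "loop q" "cl p = cl q" using gamma_loop by (auto simp: loop_def)
      then show "homotopic_paths X p q" using cl_eq_iff by (auto simp: loop_def)
    next
      fix u assume "u \<in> V"
      then have "u \<in> X" using M.V by blast
      then show "path_in X (tether u) \<and> pathstart (tether u) = x0 \<and> pathfinish (tether u) = u \<and> \<gamma> (tether u) = \<one>\<^bsub>\<G>\<^esub>"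
        using tether gamma_tether by simp
    qed
    then show ?thesis using M.finitely_generated[OF x0V gamma_loop_surjective] by simp
  qed
  moreover have "countable (carrier \<G>)"
    using small gamma_loop_surjective by (rule countable_character_image)
  ultimately show ?thesis by blast
next
  case False
  then obtain x where "x \<in> X" "\<not> good_at {\<one>\<^bsub>\<G>\<^esub>} x" by blast
  then obtain f :: "nat set \<Rightarrow> (real \<Rightarrow> 'a) set" where f: "\<And>A. f A \<in> carrier \<G>"
    "\<And>A B. A \<noteq> B \<Longrightarrow> f A \<otimes>\<^bsub>\<G>\<^esub> inv\<^bsub>\<G>\<^esub> f B \<notin> {\<one>\<^bsub>\<G>\<^esub>}"
    using not_good_imp_independent[OF Pi.one_is_normal analytic_one] by metis
  have "inj f"
    using f by (intro injI) (metis Pi.r_inv singletonI)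
  then have "continuum_sized (carrier \<G>)" using f(1) carrier_lepoll by (intro continuum_sizedI) auto
  then show ?thesis ..
qed

end

section \<open>From the topological hypotheses to the metric setting\<close>

lemma polish_subspace_exists:
  fixes X :: "'a::topological_space set"
  assumes "polish_topology (top_of_set X)" "X \<noteq> {}"
  obtains d e where "polish_subspace X d e"
proof -
  obtain M d where M: "Metric_space M d" "Metric_space.mcomplete M d" "top_of_set X = Metric_space.mtopology M d"
    using assms(1) unfolding polish_topology_def completely_metrizable_space_def by metis
  then have "M = X" using Metric_space.topspace_mtopology[OF M(1)] by (metis topspace_euclidean_subtopology)
  with M interpret Metric_space X d by simp
  obtain C where C: "countable C" "C \<subseteq> X" "top_of_set X closure_of C = X"
    using assms(1) unfolding polish_topology_def separable_space_def by auto
  \<comment> \<open>An enumeration by all naturals requires a nonempty dense set, which is where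
    \<open>X\<close> being nonempty enters.\<close>
  have "C \<noteq> {}" using C(3) assms(2) by auto
  then have r: "range (from_nat_into C) = C" using C(1) by (rule range_from_nat_into)
  have "polish_subspace X d (from_nat_into C)"
  proof
    show "mcomplete" using M \<open>M = X\<close> by simp
    show "mtopology = top_of_set X" using M \<open>M = X\<close> by simp
    show "from_nat_into C n \<in> X" for n using r C(2) by blast
    fix x and \<epsilon> :: real assume x: "x \<in> X" "\<epsilon> > 0"
    then have "x \<in> mtopology closure_of C" using C(3) M(3) \<open>M = X\<close> by simp
    then obtain y where "y \<in> C" "y \<in> mball x \<epsilon>" using x(2) unfolding metric_closure_of by blast
    moreover from this(1) obtain n where "y = from_nat_into C n" using r by (metis imageE)
    ultimately show "\<exists>n. d x (from_nat_into C n) < \<epsilon>" by auto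
  qed
  then show ?thesis by (rule that)
qed

lemma connected_imp_path_connected:
  assumes "connected X" "locally path_connected X"
  shows "path_connected X"
proof (cases "X = {}")
  case False
  then obtain x where x: "x \<in> X" by blast
  have "path_component_set X x = connected_component_set X x"
    using assms(2) by (rule path_component_eq_connected_component_set)
  also have "\<dots> = X" using assms(1) x by (rule connected_component_eq_self)
  finally show ?thesis using path_connected_path_component[of X x] by simp
qed simp

theorem theorem1:
  fixes X :: "'a::topological_space set" and x0 :: 'a
  assumes "polish_topology (top_of_set X)"
    and "connected X"
    and "locally path_connected X"
    and "x0 \<in> X"
  shows "let G = fundamental_group X x0 in
     (continuum_or_countable G \<and>
      (compact X \<longrightarrow> continuum_or_fin_gen G)) \<and>
     (\<forall>\<alpha> :: nat rel. Well_order \<alpha> \<longrightarrow>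
        continuum_or_countable (G Mod derived_series G \<alpha>) \<and>
        (compact X \<longrightarrow> continuum_or_fin_gen (G Mod derived_series G \<alpha>))) \<and>
     (\<forall>n :: nat.
        continuum_or_countable (G Mod lower_central G n) \<and>
        (compact X \<longrightarrow> continuum_or_fin_gen (G Mod lower_central G n))) \<and>
     (\<forall>n :: nat.
        continuum_or_countable (G Mod power_subgroup G n) \<and>
        (compact X \<longrightarrow> continuum_or_fin_gen (G Mod power_subgroup G n))) \<and>
     (compact X \<longrightarrow> (countable (carrier G) \<longleftrightarrow> finitely_presented G))"
proof -
  obtain d e where "polish_subspace X d e"
    using polish_subspace_exists[OF assms(1)] assms(4) by blast
  moreover have "path_connected X" using assms(2,3) by (rule connected_imp_path_connected)
  ultimately interpret pi_space X d e x0
    using assms(4)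
    by (simp add: pi_space_def polish_based_space_def connected_based_space_def based_space_def
        connected_based_space_axioms_def)
  \<comment> \<open>A countable group is not of the size of the continuum, so in the compact case
    the dichotomy leaves only the finitely presented alternative; the converse holds because
    finitely presented groups are countable.\<close>
  have pi1: "(continuum_or_countable \<G> \<and> (compact X \<longrightarrow> continuum_or_fin_gen \<G>)) \<and>
      (compact X \<longrightarrow> (countable (carrier \<G>) \<longleftrightarrow> finitely_presented \<G>))"
    using fundamental_group_dichotomy[OF assms(3)] finitely_presented_imp_countable[of \<G>]
      continuum_sized_imp_uncountable[of "carrier \<G>"]
    unfolding continuum_or_countable_def continuum_or_fin_gen_def by metis
  have derived: "continuum_or_countable (\<G> Mod derived_series \<G> \<alpha>) \<and>
      (compact X \<longrightarrow> continuum_or_fin_gen (\<G> Mod derived_series \<G> \<alpha>))" if "Well_order \<alpha>" for \<alpha> :: "nat rel"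
    using derived_series_normal_analytic[OF that] assms(3) by (intro quotient_dichotomy) auto
  have central: "continuum_or_countable (\<G> Mod lower_central \<G> n) \<and>
      (compact X \<longrightarrow> continuum_or_fin_gen (\<G> Mod lower_central \<G> n))" for n
    using Pi.lower_central_normal lower_central_analytic assms(3) by (rule quotient_dichotomy)
  have power: "continuum_or_countable (\<G> Mod power_subgroup \<G> n) \<and>
      (compact X \<longrightarrow> continuum_or_fin_gen (\<G> Mod power_subgroup \<G> n))" for n
    using Pi.power_subgroup_normal power_subgroup_analytic assms(3) by (rule quotient_dichotomy)
  show ?thesis
    using pi1 derived central power by (simp add: Let_def)
qed

end
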